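(* Given a text $T\in\Sigma^n$, a pattern $P\in\Sigma^m$ and a value $\delta>0$, there is a randomized algorithm that reports a set of locations $i\in[n-m+1]$ such that every location with $d_i=0$ is reported and every reported location has $d_i\le\delta m$. The algorithm is correct with high probability and has expected running time $\tilde O\!\left(\delta^{-1/3}n^{2/3} + \delta^{-1}\frac{n}{m} + \textit{occ}\right)$, where $\textit{occ}$ is the number of locations $i$ with $d_i\le\delta m$.
   Context: Strings are over the alphabet $\Sigma=[\sigma]$; $d_i=\mathsf{Ham}(P,T[i\mathinner{.\,.} i+m-1])$ is the number of $j\in[m]$ with $P[j]\neq T[i+j]$. The input strings are stored in arrays supporting random access. $\tilde O$ hides polylogarithmic factors in $n$. "With high probability" means error probability $O(n^{-c})$ for an arbitrarily large constant $c$. Model: word RAM with $\Theta(\log n)$-bit words. *)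

theory Defs
  imports "HOL-Probability.Probability"
begin

text \<open>Strings are lists over \<open>{..<\<sigma>}\<close>; indices start at 0 and \<open>[k]\<close> is \<open>{..<k}\<close>.\<close>

definition ham_at :: "nat list \<Rightarrow> nat list \<Rightarrow> nat \<Rightarrow> nat" where
  "ham_at P T i = card {j. j < length P \<and> P ! j \<noteq> T ! (i + j)}"

definition locations :: "nat list \<Rightarrow> nat list \<Rightarrow> nat set" where
  "locations P T = {..< length T - length P + 1}"

definition close_locations :: "nat list \<Rightarrow> nat list \<Rightarrow> real \<Rightarrow> nat set" where
  "close_locations P T \<delta> =
     {i \<in> locations P T. real (ham_at P T i) \<le> \<delta> * real (length P)}"

definition correct_report :: "nat list \<Rightarrow> nat list \<Rightarrow> real \<Rightarrow> nat set \<Rightarrow> bool" where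
  "correct_report P T \<delta> R \<longleftrightarrow>
     {i \<in> locations P T. ham_at P T i = 0} \<subseteq> R \<and> R \<subseteq> close_locations P T \<delta>"

text \<open>
  The randomized word RAM, presented as a structured language. Machine words are the natural
  numbers below \<open>2 ^ word_size\<close>; there are registers and a memory of \<open>2 ^ word_size\<close> words
  with indirect addressing. The two input strings are read-only random-access arrays. The real
  number \<open>\<delta>\<close> is accessible only through the exact unit-cost test \<open>x \<le> \<delta> * y\<close> on words
  \<open>x\<close>, \<open>y\<close>; if \<open>\<delta>\<close> is a fraction of two words, this test takes a constant number of the
  other operations.
\<close>

record ram_input =
  word_size :: nat
  text_arr :: "nat list"
  pat_arr :: "nat list"
  delta :: real

record ram_state =
  reg :: "nat \<Rightarrow> nat"
  mem :: "nat \<Rightarrow> nat"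
  reported :: "nat set"
  clock :: nat

datatype binop = Add | Sub | Mul | Div | Mod | And | Or | Xor | Shl | Shr | Lt | Eq

datatype expr =
    Const nat
  | Reg nat
  | Mem expr
  | TextAt expr
  | PatAt expr
  | DeltaLe expr expr
  | Bin binop expr expr

datatype com =
    Skip
  | Assign nat expr
  | Store expr expr
  | Rand nat
  | Report expr
  | Seq com com
  | Cond expr com com
  | While expr com

text \<open>Arithmetic is modulo \<open>2 ^ w\<close>; division by zero yields 0 and \<open>x\<close> modulo 0 is \<open>x\<close>.\<close>

fun apply_op :: "nat \<Rightarrow> binop \<Rightarrow> nat \<Rightarrow> nat \<Rightarrow> nat" where
  "apply_op w Add x y = take_bit w (x + y)"
| "apply_op w Sub x y = take_bit w (2 ^ w + x - y)"
| "apply_op w Mul x y = take_bit w (x * y)"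
| "apply_op w Div x y = x div y"
| "apply_op w Mod x y = x mod y"
| "apply_op w And x y = Bit_Operations.and x y"
| "apply_op w Or x y = Bit_Operations.or x y"
| "apply_op w Xor x y = Bit_Operations.xor x y"
| "apply_op w Shl x y = take_bit w (push_bit y x)"
| "apply_op w Shr x y = drop_bit y x"
| "apply_op w Lt x y = of_bool (x < y)"
| "apply_op w Eq x y = of_bool (x = y)"

primrec exp_val :: "ram_input \<Rightarrow> ram_state \<Rightarrow> expr \<Rightarrow> nat" where
  "exp_val I s (Const k) = take_bit (word_size I) k"
| "exp_val I s (Reg r) = reg s r"
| "exp_val I s (Mem e) = mem s (exp_val I s e)"
| "exp_val I s (TextAt e) =
     (let i = exp_val I s e in if i < length (text_arr I) then text_arr I ! i else 0)"
| "exp_val I s (PatAt e) =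
     (let i = exp_val I s e in if i < length (pat_arr I) then pat_arr I ! i else 0)"
| "exp_val I s (DeltaLe e1 e2) = of_bool (real (exp_val I s e1) \<le> delta I * real (exp_val I s e2))"
| "exp_val I s (Bin f e1 e2) = apply_op (word_size I) f (exp_val I s e1) (exp_val I s e2)"

primrec cost :: "expr \<Rightarrow> nat" where
  "cost (Const k) = 1"
| "cost (Reg r) = 1"
| "cost (Mem e) = 1 + cost e"
| "cost (TextAt e) = 1 + cost e"
| "cost (PatAt e) = 1 + cost e"
| "cost (DeltaLe e1 e2) = 1 + cost e1 + cost e2"
| "cost (Bin f e1 e2) = 1 + cost e1 + cost e2"

definition tick :: "nat \<Rightarrow> ram_state \<Rightarrow> ram_state" where
  "tick t s = s\<lparr>clock := clock s + t\<rparr>"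

text \<open>In the subprobability semantics the missing mass (\<open>None\<close>) is divergence.\<close>

partial_function (spmf) while_spmf ::
  "('s \<Rightarrow> bool) \<Rightarrow> ('s \<Rightarrow> 's spmf) \<Rightarrow> 's \<Rightarrow> 's spmf" where
  "while_spmf g f s = (if g s then bind_spmf (f s) (while_spmf g f) else return_spmf s)"

primrec exec :: "ram_input \<Rightarrow> com \<Rightarrow> ram_state \<Rightarrow> ram_state spmf" where
  "exec I Skip s = return_spmf (tick 1 s)"
| "exec I (Assign r e) s =
     return_spmf (tick (1 + cost e) (s\<lparr>reg := (reg s)(r := exp_val I s e)\<rparr>))"
| "exec I (Store a e) s =
     return_spmf (tick (1 + cost a + cost e) (s\<lparr>mem := (mem s)(exp_val I s a := exp_val I s e)\<rparr>))"
| "exec I (Rand r) s =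
     map_spmf (\<lambda>x. tick 1 (s\<lparr>reg := (reg s)(r := x)\<rparr>)) (spmf_of_set {..< 2 ^ word_size I})"
| "exec I (Report e) s =
     return_spmf (tick (1 + cost e) (s\<lparr>reported := insert (exp_val I s e) (reported s)\<rparr>))"
| "exec I (Seq c1 c2) s = bind_spmf (exec I c1 s) (exec I c2)"
| "exec I (Cond b c1 c2) s =
     (let s' = tick (1 + cost b) s in if exp_val I s b \<noteq> 0 then exec I c1 s' else exec I c2 s')"
| "exec I (While b c) s =
     map_spmf (tick (1 + cost b))
       (while_spmf (\<lambda>s. exp_val I s b \<noteq> 0) (\<lambda>s. exec I c (tick (1 + cost b) s)) s)"

text \<open>Initially register 0 holds \<open>n\<close>, register 1 holds \<open>m\<close>, and everything else is 0.\<close>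

definition init_state :: "ram_input \<Rightarrow> ram_state" where
  "init_state I =
     \<lparr>reg = (\<lambda>_. 0)(0 := take_bit (word_size I) (length (text_arr I)),
                    1 := take_bit (word_size I) (length (pat_arr I))),
      mem = (\<lambda>_. 0), reported = {}, clock = 0\<rparr>"

definition run :: "com \<Rightarrow> ram_input \<Rightarrow> ram_state spmf" where
  "run prog I = exec I prog (init_state I)"

text \<open>A diverging run counts as incorrect and as having infinite running time.\<close>

definition error_prob :: "com \<Rightarrow> ram_input \<Rightarrow> real" where
  "error_prob prog I = measure_pmf.prob (run prog I)
     {r. \<not> (\<exists>s. r = Some s \<and> correct_report (pat_arr I) (text_arr I) (delta I) (reported s))}"

definition expected_time :: "com \<Rightarrow> ram_input \<Rightarrow> ennreal" where
  "expected_time prog I = (\<integral>\<^sup>+ r.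
     (case r of None \<Rightarrow> \<infinity> | Some s \<Rightarrow> ennreal (real (clock s))) \<partial>measure_pmf (run prog I))"

end

(* Sample the strings along a sparse set of positions that is periodic modulo a product Q * p of random
   primes, up to random jitter inside each gap. The samples falling in a window form a string whose
   fingerprint modulo a third random prime is compared with that of the pattern: a location without
   mismatches always agrees, and one with more than delta * m mismatches agrees with probability at most
   1 / (2 L), where L is about (delta n)^(1/3). Text fingerprints are differences of prefix fingerprints,
   one chain for each residue modulo p, and pattern fingerprints are matched through hash buckets, so a
   round costs about n / D + n / L + L^2 m / D up to logarithmic factors, where D is about delta * m.
   A location is reported if it survives about log^2 n independent rounds; the work on the candidates
   of a round is charged to occ, plus an expected n / (2 L) false ones. *)
theory Submission
  imports Defs "HOL-Computational_Algebra.Primes" "HOL-Real_Asymp.Real_Asymp"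
begin

text \<open>A location is split as \<open>i = c * Q + h * H + y\<close> with \<open>y < H\<close>,
  so that the text fingerprint depends on \<open>(c, h)\<close> only and the pattern fingerprint on
  \<open>(h, y)\<close> only; without this sharing a round would need a separate comparison for each
  location. It forces all \<open>H\<close> shifts of a block to use the same samples, those in the
  part of the window common to all of them, and \<open>H - 1\<close> is kept at most
  \<open>D / 4\<close> so that the mismatches lost at the two ends are a minority. The choice of
  \<open>L\<close> balances \<open>n / L\<close> against \<open>L^2 / \<delta>\<close>. For
  correctness alone a false location could survive a round with probability \<open>1 / 2\<close>;
  the sharper \<open>1 / (2 * L)\<close> pays for the false candidates in the running time. All
  random words are drawn before the search starts: given that tape the search is deterministic, its
  analysis is a total-correctness proof, and probability remains only in statements about a product
  of uniform words. Memory is never cleared; each block gets a fresh zero table, and words of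
  \<open>8 * log n\<close> bits leave room for that.\<close>

section \<open>A Chebyshev-type lower bound on the number of primes, via the lcm of an initial
  segment\<close>

text \<open>The numbers \<open>(n + 1) * (n choose k)\<close> are the denominators of the Leibniz
  harmonic triangle, in which every entry is the sum of the two entries below it. The quotient of
  the lcm by the next denominator in a row is therefore a difference of two quotients known to be
  integers, which drives the induction on \<open>k\<close>.\<close>

lemma leibniz_triangle_dvd_Lcm:
  "n < N \<Longrightarrow> k \<le> n \<Longrightarrow> (n + 1) * (n choose k) dvd Lcm {1..N}"
proof (induction k arbitrary: n)
  case 0
  then show ?case by (auto intro!: dvd_Lcm)
next
  case (Suc k)
  define a where "a = (n + 1) * (n choose k)"
  define b where "b = n * ((n - 1) choose k)"
  define c where "c = (n + 1) * (n choose Suc k)"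
  have n: "n \<ge> 1" "Suc k \<le> n" using Suc.prems by auto
  have L0: "Lcm {1..N} \<noteq> 0" by (simp add: Lcm_0_iff)
  have da: "a dvd Lcm {1..N}" unfolding a_def using Suc by auto
  have db: "b dvd Lcm {1..N}" unfolding b_def using Suc.IH[of "n - 1"] n Suc.prems by auto
  obtain u v where u: "Lcm {1..N} = a * u" and v: "Lcm {1..N} = b * v" using da db unfolding dvd_def by blast
  have pos: "n choose k > 0" "(n - 1) choose k > 0" "n choose Suc k > 0" using n by (auto simp: zero_less_binomial_iff)
  have e1: "Suc k * (n choose Suc k) = n * ((n - 1) choose k)"
    using binomial_absorption[of k n] by simp
  have e2: "(n - k) * (n choose k) = n * ((n - 1) choose k)"
    using binomial_absorb_comp[of n k] by simp
  define x where "x = n * ((n - 1) choose k)"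
  have rb: "real b = real x" by (simp add: b_def x_def)
  have rc: "real (Suc k) * real c = real (n+1) * real x"
  proof -
    have "Suc k * c = (n + 1) * (Suc k * (n choose Suc k))" by (simp add: c_def algebra_simps)
    also have "\<dots> = (n + 1) * x" by (simp only: e1 x_def)
    finally show ?thesis by (metis of_nat_mult)
  qed
  have ra: "real (n - k) * real a = real (n+1) * real x"
  proof -
    have "(n - k) * a = (n + 1) * ((n - k) * (n choose k))" by (simp add: a_def algebra_simps)
    also have "\<dots> = (n + 1) * x" by (simp only: e2 x_def)
    finally show ?thesis by (metis of_nat_mult)
  qed
  have x0: "x > 0" using pos n by (simp add: x_def)
  let ?M = "real (Lcm {1..N})"
  have M0: "?M > 0" by (metis L0 of_nat_0_less_iff neq0_conv)
  have "a > 0" "b > 0" "c > 0" using pos n by (simp_all add: a_def b_def c_def)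
  then have a0: "real a > 0" and c0: "real c > 0" and b0: "real b > 0" by simp_all
  have ia: "1 / real a = real (n - k) / (real (n+1) * real x)"
    using ra a0 x0 by (intro iffD2[OF frac_eq_eq]) (auto simp: mult.commute simp del: of_nat_add)
  have ic: "1 / real c = real (Suc k) / (real (n+1) * real x)"
    using rc c0 x0 by (intro iffD2[OF frac_eq_eq]) (auto simp: mult.commute simp del: of_nat_add of_nat_Suc)
  \<comment> \<open>The recurrence of the Leibniz triangle; multiplied by the lcm it reads
    \<open>u + Lcm / c = v\<close>.\<close>
  have "1 / real a + 1 / real c = (real (n - k) + real (Suc k)) / (real (n+1) * real x)"
    by (simp only: ia ic add_divide_distrib)
  also have "real (n - k) + real (Suc k) = real (n + 1)" using n by (simp add: of_nat_diff)
  also have "real (n + 1) / (real (n + 1) * real x) = 1 / real b"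
    unfolding rb by (simp del: of_nat_add of_nat_Suc)
  finally have "1 / real a + 1 / real c = 1 / real b" .
  then have "?M * (1 / real a + 1 / real c) = ?M * (1 / real b)" by simp
  then have "?M / real c = ?M / real b - ?M / real a" by (simp add: ring_distribs)
  also have "\<dots> = real v - real u"
    using arg_cong[OF u, of real] arg_cong[OF v, of real] a0 b0 by (simp add: nonzero_divide_eq_eq eq_divide_eq mult.commute)
  finally have e: "?M / real c = real v - real u" .
  then have "real v - real u > 0" using M0 c0 by (metis divide_pos_pos)
  then have "?M = real c * real (v - u)" using e c0 by (simp add: of_nat_diff field_simps)
  then have "Lcm {1..N} = c * (v - u)" by (metis of_nat_eq_iff of_nat_mult)
  then show ?case unfolding c_def by (metis dvd_triv_left)
qed

text \<open>The central entry \<open>(2*k+1) * ((2*k) choose k)\<close> divides the lcm, and it is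
  at least \<open>4 ^ k\<close> because row \<open>2*k\<close> has \<open>2*k+1\<close> terms, the
  central one being the largest. The loss of 2 in the exponent covers both parities of
  \<open>N\<close>.\<close>

lemma two_power_le_Lcm: "2 ^ (N - 2) \<le> Lcm {1..N::nat}"
proof -
  have L0: "Lcm {1..N} > 0" for N :: nat by (rule Nat.gr0I) (simp add: Lcm_0_iff)
  consider "N = 0" | k where "N = 2 * k + 1" | k where "N = 2 * k + 2"
    by (metis One_nat_def Suc_pred add_2_eq_Suc' even_Suc evenE neq0_conv oddE add.commute plus_1_eq_Suc mult_Suc_right)
  then show ?thesis
  proof cases
    case 1 then show ?thesis by simp
  next
    case (2 k)
    have "(2*k+1) * ((2*k) choose k) dvd Lcm {1..N}" using leibniz_triangle_dvd_Lcm[of "2*k" N k] 2 by simp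
    then have "(2*k+1) * ((2*k) choose k) \<le> Lcm {1..N}" using L0 by (rule dvd_imp_le)
    moreover have "4 ^ k \<le> (2*k+1) * ((2*k) choose k)"
    proof -
      have "(2::nat) ^ (2*k) = (\<Sum>i\<le>2*k. (2*k) choose i)" by (simp add: choose_row_sum)
      also have "\<dots> \<le> (\<Sum>i\<le>2*k. (2*k) choose k)"
        by (intro sum_mono) (metis binomial_maximum nonzero_mult_div_cancel_left zero_neq_numeral)
      also have "\<dots> = (2*k+1) * ((2*k) choose k)" by simp
      finally show ?thesis by (simp add: power_mult)
    qed
    moreover have "(2::nat) ^ (N - 2) \<le> 4 ^ k"
      using 2 power_increasing[of "N - 2" "2*k" "2::nat"] by (simp add: power_mult)
    ultimately show ?thesis by linarith
  next
    case (3 k)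
    have "(2*k+1) * ((2*k) choose k) dvd Lcm {1..N}" using leibniz_triangle_dvd_Lcm[of "2*k" N k] 3 by simp
    then have "(2*k+1) * ((2*k) choose k) \<le> Lcm {1..N}" using L0 by (rule dvd_imp_le)
    moreover have "4 ^ k \<le> (2*k+1) * ((2*k) choose k)"
    proof -
      have "(2::nat) ^ (2*k) = (\<Sum>i\<le>2*k. (2*k) choose i)" by (simp add: choose_row_sum)
      also have "\<dots> \<le> (\<Sum>i\<le>2*k. (2*k) choose k)"
        by (intro sum_mono) (metis binomial_maximum nonzero_mult_div_cancel_left zero_neq_numeral)
      also have "\<dots> = (2*k+1) * ((2*k) choose k)" by simp
      finally show ?thesis by (simp add: power_mult)
    qed
    moreover have "(2::nat) ^ (N - 2) \<le> 4 ^ k" using 3 by (simp add: power_mult)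
    ultimately show ?thesis by linarith
  qed
qed

text \<open>Every prime power exactly dividing the lcm is at most \<open>N\<close>: otherwise no
  number up to \<open>N\<close> is divisible by it, and the lcm divided by that prime would still be
  a common multiple.\<close>

lemma Lcm_le_power_primes:
  "Lcm {1..N::nat} \<le> N ^ card {p. prime p \<and> p \<le> N}"
proof -
  let ?P = "{p. prime p \<and> p \<le> N}"
  have fin: "finite ?P" by (rule finite_subset[of _ "{..N}"]) auto
  let ?L = "Lcm {1..N}"
  have L0: "?L \<noteq> 0" by (simp add: Lcm_0_iff)
  have pf: "prime_factors ?L \<subseteq> ?P"
  proof
    fix p assume p: "p \<in> prime_factors ?L"
    then have pp: "prime p" "p dvd ?L" by auto
    have "?L dvd fact N" by (rule Lcm_least) (auto simp: dvd_fact)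
    then have "p dvd fact N" using pp dvd_trans by blast
    then show "p \<in> ?P" using pp prime_dvd_fact_iff by auto
  qed
  have le: "p ^ multiplicity p ?L \<le> N" if p: "p \<in> prime_factors ?L" for p
  proof (rule ccontr)
    assume c: "\<not> p ^ multiplicity p ?L \<le> N"
    have pp: "prime p" using p by auto
    define e where "e = multiplicity p ?L"
    have e0: "e > 0" using p L0 unfolding e_def by (simp add: prime_factors_multiplicity)
    obtain r where r: "?L = p ^ e * r" using multiplicity_dvd[of p ?L] unfolding e_def by (auto elim: dvdE)
    have nr: "\<not> p dvd r"
    proof
      assume "p dvd r"
      then have "p ^ Suc e dvd ?L" using r by (auto elim!: dvdE)
      then have "Suc e \<le> multiplicity p ?L" using L0 pp by (intro multiplicity_geI) auto
      then show False unfolding e_def by simp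
    qed
    \<comment> \<open>Here \<open>r\<close> is the part of the lcm prime to \<open>p\<close>, so the
      right side is the lcm divided by \<open>p\<close>.\<close>
    have "?L dvd p ^ (e - 1) * r"
    proof (rule Lcm_least)
      fix x assume x: "x \<in> {1..N}"
      have "x dvd p ^ e * r" using x r by (metis dvd_Lcm)
      obtain s where s: "x = p ^ multiplicity p x * s" using multiplicity_dvd[of p x] by (auto elim: dvdE)
      have x0: "x \<noteq> 0" using x by auto
      have s': "\<not> p dvd s"
      proof
        assume "p dvd s"
        then have "p ^ Suc (multiplicity p x) dvd x" using s by (metis mult_dvd_mono dvd_refl power_Suc2)
        then have "Suc (multiplicity p x) \<le> multiplicity p x" using x0 pp by (intro multiplicity_geI) auto
        then show False by simp
      qed
      have me: "multiplicity p x < e"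
      proof (rule ccontr)
        assume "\<not> multiplicity p x < e"
        then have "p ^ e dvd p ^ multiplicity p x" by (simp add: le_imp_power_dvd)
        then have "p ^ e dvd x" using s by (metis dvd_mult2)
        then have "p ^ e \<le> x" using x0 by (simp add: dvd_imp_le)
        then show False using c x e_def by auto
      qed
      have "s dvd p ^ e * r" using \<open>x dvd p ^ e * r\<close> s by (metis dvd_mult_right)
      moreover have "coprime s (p ^ e)" using pp s' by (simp add: prime_imp_coprime coprime_commute)
      ultimately have "s dvd r" by (simp add: coprime_dvd_mult_right_iff)
      moreover have "p ^ multiplicity p x dvd p ^ (e - 1)" using me by (simp add: le_imp_power_dvd)
      ultimately show "x dvd p ^ (e - 1) * r" using s by (metis mult_dvd_mono)
    qed
    moreover have "p ^ (e - 1) * r < ?L"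
    proof -
      have "p ^ (e - 1) < p ^ e" using prime_gt_1_nat[OF pp] e0 by (intro power_strict_increasing) auto
      moreover have "r > 0" using r L0 by (cases r) auto
      ultimately show ?thesis using r by simp
    qed
    moreover have "p ^ (e - 1) * r > 0" using r L0 pp e0 by (cases r) (auto simp: prime_gt_0_nat)
    ultimately show False by (meson dvd_imp_le leD)
  qed
  have "?L = (\<Prod>p\<in>prime_factors ?L. p ^ multiplicity p ?L)"
    using prime_factorization_nat[of ?L] L0 by blast
  also have "\<dots> \<le> (\<Prod>p\<in>prime_factors ?L. N)" using le by (intro prod_mono) auto
  also have "\<dots> = N ^ card (prime_factors ?L)" by simp
  also have "\<dots> \<le> N ^ card ?P"
  proof (cases "N = 0")
    case True
    then have "?P = {}" by auto
    then show ?thesis using True by (metis card.empty le_refl power_0 pf subset_empty)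
  next
    case False then show ?thesis using card_mono[OF fin pf] by (intro power_increasing) auto
  qed
  finally show ?thesis .
qed

text \<open>Compares the two estimates of the lcm. The bit length \<open>r\<close> stands for the
  logarithm of \<open>N\<close>, which keeps everything in the naturals.\<close>

lemma card_primes_ge:
  assumes "N \<le> 2 ^ r"
  shows "N \<le> r * card {p::nat. prime p \<and> p \<le> N} + 2"
proof -
  have "(2::nat) ^ (N - 2) \<le> N ^ card {p. prime p \<and> p \<le> N}"
    using two_power_le_Lcm Lcm_le_power_primes le_trans by blast
  also have "\<dots> \<le> (2 ^ r) ^ card {p. prime p \<and> p \<le> N}" using assms by (rule power_mono) simp
  finally have "(2::nat) ^ (N - 2) \<le> 2 ^ (r * card {p. prime p \<and> p \<le> N})" by (simp add: power_mult)
  then have "N - 2 \<le> r * card {p. prime p \<and> p \<le> N}" by simp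
  then show ?thesis by linarith
qed

lemma card_prime_divisors_le:
  assumes "0 < N" "N < 2 ^ r"
  shows "finite {x::nat. prime x \<and> x dvd N}" "card {x::nat. prime x \<and> x dvd N} \<le> r"
proof -
  let ?A = "{x::nat. prime x \<and> x dvd N}"
  have eq: "?A = prime_factors N" using assms by (auto simp: prime_factors_dvd)
  show fin: "finite ?A" unfolding eq by simp
  have "2 ^ card ?A \<le> \<Prod>?A"
    using prod_mono[of ?A "\<lambda>_. 2::nat" "\<lambda>x. x"] by (auto simp: prime_ge_2_nat)
  also have "\<Prod>?A \<le> N"
  proof (rule dvd_imp_le[OF _ assms(1)])
    show "\<Prod>?A dvd N"
    proof -
      have "(\<Prod>x\<in>prime_factors N. x) dvd (\<Prod>x\<in>prime_factors N. x ^ multiplicity x N)"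
        by (intro prod_dvd_prod dvd_power) (auto simp: prime_factors_multiplicity)
      also have "\<dots> = N" using prime_factorization_nat[of N] assms by simp
      finally show ?thesis by (simp add: eq)
    qed
  qed
  finally have "(2::nat) ^ card ?A < 2 ^ r" using assms by linarith
  then show "card ?A \<le> r" by simp
qed

section \<open>Independence in product distributions, and uniform words reduced modulo a
  number\<close>

text \<open>Fubini over the coordinates outside \<open>A\<close>. This is the form in which
  independence is used throughout: \<open>E\<close> may read everything as long as the bound holds
  for each fixed filling \<open>g\<close> outside \<open>A\<close>, while \<open>F\<close> must not
  read \<open>A\<close>, so for fixed \<open>g\<close> it is constantly true or constantly
  false.\<close>

lemma prob_Pi_pmf_cond:
  fixes p :: "'i \<Rightarrow> 'b pmf"
  assumes fin: "finite I" and A: "A \<subseteq> I"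
    and E: "\<And>g. measure_pmf.prob (Pi_pmf A d p) {f. E (\<lambda>x. if x \<in> A then f x else g x)} \<le> \<epsilon>"
    and F: "\<And>f f'. (\<And>x. x \<in> I - A \<Longrightarrow> f x = f' x) \<Longrightarrow> (\<And>x. x \<notin> I \<Longrightarrow> f x = f' x) \<Longrightarrow> F f \<Longrightarrow> F f'"
  shows "measure_pmf.prob (Pi_pmf I d p) {f. E f \<and> F f} \<le> \<epsilon> * measure_pmf.prob (Pi_pmf I d p) {f. F f}"
proof -
  have finA: "finite A" "finite (I - A)" using fin A finite_subset by auto
  let ?M = "Pi_pmf A d p" and ?N = "Pi_pmf (I - A) d p"
  let ?m = "\<lambda>f g x. if x \<in> A then f x else g x"
  have e0: "\<epsilon> \<ge> 0" using E[of undefined] measure_nonneg order_trans by blast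
  have split: "Pi_pmf I d p = map_pmf (\<lambda>(f, g). ?m f g) (pair_pmf ?M ?N)"
  proof -
    have "A \<union> (I - A) = I" using A by auto
    then show ?thesis using Pi_pmf_union[OF finA, of d p] by simp
  qed
  have em: "emeasure (measure_pmf (Pi_pmf I d p)) {f. P f} =
      (\<integral>\<^sup>+ g. emeasure (measure_pmf ?M) {f. P (?m f g)} \<partial>measure_pmf ?N)" for P
  proof -
    have "emeasure (measure_pmf (Pi_pmf I d p)) {f. P f} =
       (\<integral>\<^sup>+ f. indicator {f. P f} f \<partial>measure_pmf (Pi_pmf I d p))" by simp
    also have "\<dots> = (\<integral>\<^sup>+ g. \<integral>\<^sup>+ f. indicator {f. P f} (?m f g) \<partial>measure_pmf ?M \<partial>measure_pmf ?N)"
      unfolding split by (subst pair_commute_pmf) (simp add: nn_integral_pair_pmf')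
    also have "\<dots> = (\<integral>\<^sup>+ g. \<integral>\<^sup>+ f. indicator {f. P (?m f g)} f \<partial>measure_pmf ?M \<partial>measure_pmf ?N)"
      by (intro nn_integral_cong) (simp add: indicator_def)
    finally show ?thesis by simp
  qed
  have Fm: "F (?m f g) \<longleftrightarrow> F (?m f' g)" for f f' g
  proof -
    have "F (?m a g) \<Longrightarrow> F (?m b g)" for a b
      by (erule F[rotated 2]) (use A in auto)
    then show ?thesis by blast
  qed
  have "emeasure (measure_pmf (Pi_pmf I d p)) {f. E f \<and> F f} =
     (\<integral>\<^sup>+ g. emeasure (measure_pmf ?M) {f. E (?m f g) \<and> F (?m f g)} \<partial>measure_pmf ?N)" by (rule em)
  also have "\<dots> \<le> (\<integral>\<^sup>+ g. ennreal \<epsilon> * emeasure (measure_pmf ?M) {f. F (?m f g)} \<partial>measure_pmf ?N)"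
  proof (rule nn_integral_mono)
    fix g
    show "emeasure (measure_pmf ?M) {f. E (?m f g) \<and> F (?m f g)} \<le> ennreal \<epsilon> * emeasure (measure_pmf ?M) {f. F (?m f g)}"
    proof (cases "F (?m undefined g)")
      case True
      then have "F (?m f g)" for f using Fm by blast
      then show ?thesis using E[of g] by (simp add: measure_pmf.emeasure_eq_measure e0)
    next
      case False
      then have "\<not> F (?m f g)" for f using Fm by blast
      then show ?thesis by simp
    qed
  qed
  also have "\<dots> = ennreal \<epsilon> * emeasure (measure_pmf (Pi_pmf I d p)) {f. F f}"
    by (simp add: em nn_integral_cmult)
  finally show ?thesis
    by (simp add: measure_pmf.emeasure_eq_measure ennreal_mult'[symmetric] e0 ennreal_le_iff mult_nonneg_nonneg)
qed

lemma prob_Pi_pmf_le: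
  fixes p :: "'i \<Rightarrow> 'b pmf"
  assumes "finite I" "A \<subseteq> I"
    and "\<And>g. measure_pmf.prob (Pi_pmf A d p) {f. E (\<lambda>x. if x \<in> A then f x else g x)} \<le> \<epsilon>"
  shows "measure_pmf.prob (Pi_pmf I d p) {f. E f} \<le> \<epsilon>"
  using prob_Pi_pmf_cond[of I A d p E \<epsilon> "\<lambda>_. True", OF assms] by simp

lemma prob_component_in:
  assumes "finite I" "x \<in> I"
  shows "measure_pmf.prob (Pi_pmf I d p) {f. f x \<in> B} = measure_pmf.prob (p x) B"
proof -
  have "measure_pmf.prob (Pi_pmf I d p) {f. f x \<in> B} = measure_pmf.prob (map_pmf (\<lambda>f. f x) (Pi_pmf I d p)) B"
    by (simp add: vimage_def)
  then show ?thesis using Pi_pmf_component[OF assms(1), of x d p] assms(2) by simp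
qed

definition word_pmf :: "nat \<Rightarrow> nat pmf" where
  "word_pmf w = pmf_of_set {..< 2 ^ w}"

lemma prob_word_pmf: "measure_pmf.prob (word_pmf w) B = real (card (B \<inter> {..<2^w})) / 2 ^ w"
  unfolding word_pmf_def
  by (subst measure_pmf_of_set) (auto simp: Int_commute lessThan_empty_iff)

lemma card_residue:
  assumes "0 < b" "r < b"
  shows "card {x. x < M \<and> x mod b = (r::nat)} \<ge> M div b" "card {x. x < M \<and> x mod b = r} \<le> M div b + 1"
proof -
  have sub: "(\<lambda>k. k * b + r) ` {..< M div b} \<subseteq> {x. x < M \<and> x mod b = r}"
  proof (safe; simp add: assms)
    fix k assume "k < M div b"
    then have "(k + 1) * b \<le> M div b * b" by (intro mult_right_mono) auto
    also have "\<dots> \<le> M" by simp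
    finally show "k * b + r < M" using assms(2) by (simp add: algebra_simps)
  qed
  have inj: "inj (\<lambda>k. k * b + r)" using assms by (auto intro!: injI)
  show "card {x. x < M \<and> x mod b = r} \<ge> M div b"
    using card_mono[OF _ sub] card_image[OF inj_on_subset[OF inj subset_UNIV], of "{..< M div b}"] by simp
  have sup: "{x. x < M \<and> x mod b = r} \<subseteq> (\<lambda>k. k * b + r) ` {..M div b}"
  proof
    fix x assume x: "x \<in> {x. x < M \<and> x mod b = r}"
    then have "x = (x div b) * b + r" by (metis (mono_tags) div_mult_mod_eq mem_Collect_eq)
    moreover have "x div b \<le> M div b" using x by (auto intro: div_le_mono)
    ultimately show "x \<in> (\<lambda>k. k * b + r) ` {..M div b}" by blast
  qed
  show "card {x. x < M \<and> x mod b = r} \<le> M div b + 1"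
    using card_mono[OF _ sup] card_image_le[of "{..M div b}" "\<lambda>k. k * b + r"] by simp
qed

text \<open>Reducing a uniform word modulo \<open>b\<close> is not uniform when \<open>b\<close>
  does not divide \<open>2 ^ w\<close>. Each residue has \<open>2 ^ w div b\<close> preimages or one
  more, and since \<open>b \<le> 2 ^ w\<close> this distorts probabilities by at most a factor 2,
  here upwards and in the next lemma downwards.\<close>

lemma prob_word_mod_le:
  assumes b: "0 < b" "b \<le> 2 ^ w"
  shows "measure_pmf.prob (word_pmf w) {x. x mod b \<in> B} \<le> 2 * real (card (B \<inter> {..<b})) / real b"
proof -
  let ?M = "2 ^ w :: nat"
  have eq: "{x. x mod b \<in> B} \<inter> {..<?M} = (\<Union>r\<in>B \<inter> {..<b}. {x. x < ?M \<and> x mod b = r})" using b by auto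
  have "card ({x. x mod b \<in> B} \<inter> {..<?M}) \<le> (\<Sum>r\<in>B \<inter> {..<b}. card {x. x < ?M \<and> x mod b = r})"
    unfolding eq by (rule card_UN_le) simp
  also have "\<dots> \<le> (\<Sum>r\<in>B \<inter> {..<b}. ?M div b + 1)" by (intro sum_mono card_residue(2)) (use b in auto)
  also have "\<dots> = card (B \<inter> {..<b}) * (?M div b + 1)" by simp
  also have "\<dots> \<le> card (B \<inter> {..<b}) * (2 * (?M div b))"
    using b by (intro mult_left_mono) (auto simp: div_greater_zero_iff Suc_le_eq)
  finally have "real (card ({x. x mod b \<in> B} \<inter> {..<?M})) \<le> real (card (B \<inter> {..<b})) * 2 * real (?M div b)"
    by (metis (no_types, lifting) mult.assoc of_nat_le_iff of_nat_mult of_nat_numeral)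
  also have "\<dots> \<le> real (card (B \<inter> {..<b})) * 2 * (real ?M / real b)"
  proof (intro mult_left_mono)
    have "real (?M div b * b) \<le> real ?M" by (intro of_nat_mono) simp
    then show "real (?M div b) \<le> real ?M / real b" using b by (simp add: field_simps)
  qed auto
  finally show ?thesis unfolding prob_word_pmf using b by (simp add: field_simps)
qed

lemma prob_word_mod_ge:
  assumes b: "0 < b" "b \<le> 2 ^ w"
  shows "measure_pmf.prob (word_pmf w) {x. x mod b \<in> B} \<ge> real (card (B \<inter> {..<b})) / (2 * real b)"
proof -
  let ?M = "2 ^ w :: nat"
  have eq: "{x. x mod b \<in> B} \<inter> {..<?M} = (\<Union>r\<in>B \<inter> {..<b}. {x. x < ?M \<and> x mod b = r})" using b by auto
  have "card ({x. x mod b \<in> B} \<inter> {..<?M}) = (\<Sum>r\<in>B \<inter> {..<b}. card {x. x < ?M \<and> x mod b = r})"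
    unfolding eq by (rule card_UN_disjoint) auto
  also have "\<dots> \<ge> (\<Sum>r\<in>B \<inter> {..<b}. ?M div b)" by (intro sum_mono card_residue(1)) (use b in auto)
  finally have c: "card (B \<inter> {..<b}) * (?M div b) \<le> card ({x. x mod b \<in> B} \<inter> {..<?M})" by simp
  have "?M = ?M div b * b + ?M mod b" by simp
  also have "\<dots> \<le> ?M div b * b + ?M div b * b"
  proof (intro add_left_mono)
    have "?M mod b \<le> 1 * b" using b by simp
    also have "\<dots> \<le> ?M div b * b" using b by (intro mult_right_mono) (auto simp: div_greater_zero_iff Suc_le_eq)
    finally show "?M mod b \<le> ?M div b * b" .
  qed
  finally have "?M \<le> 2 * b * (?M div b)" by (simp add: algebra_simps)
  then have "card (B \<inter> {..<b}) * ?M \<le> card (B \<inter> {..<b}) * (2 * b * (?M div b))" by (rule mult_left_mono) simp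
  also have "\<dots> \<le> 2 * b * card ({x. x mod b \<in> B} \<inter> {..<?M})" using mult_left_mono[OF c, of "2*b"] by (simp add: algebra_simps)
  finally have "real (card (B \<inter> {..<b})) * real ?M \<le> 2 * real b * real (card ({x. x mod b \<in> B} \<inter> {..<?M}))"
    by (metis (mono_tags) of_nat_le_iff of_nat_mult of_nat_numeral)
  then show ?thesis unfolding prob_word_pmf using b by (simp add: field_simps)
qed

section \<open>Random primes by rejection sampling, jittered samples, and residue counting\<close>

definition cand :: "nat \<Rightarrow> nat \<Rightarrow> (nat \<Rightarrow> nat) \<Rightarrow> nat \<Rightarrow> nat" where
  "cand Y b u t = Y + u t mod b"

text \<open>Rejection sampling without early exit: all \<open>k\<close> draws are read and the last
  prime one wins. If none is prime the value is \<open>Y\<close>, possibly composite, so the result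
  always lies in the intended range.\<close>

primrec pick :: "nat \<Rightarrow> nat \<Rightarrow> (nat \<Rightarrow> nat) \<Rightarrow> nat \<Rightarrow> nat" where
  "pick Y b u 0 = Y"
| "pick Y b u (Suc t) = (if prime (cand Y b u t) then cand Y b u t else pick Y b u t)"

lemma pick_cases:
  "(\<exists>t<k. prime (cand Y b u t) \<and> pick Y b u k = cand Y b u t) \<or> ((\<forall>t<k. \<not> prime (cand Y b u t)) \<and> pick Y b u k = Y)"
  by (induction k) (auto simp: less_Suc_eq)

lemma pick_bounds: "0 < b \<Longrightarrow> Y \<le> pick Y b u k \<and> pick Y b u k < Y + b"
  by (induction k) (auto simp: cand_def)

lemma pick_cong: "(\<And>t. t < k \<Longrightarrow> u t = u' t) \<Longrightarrow> pick Y b u k = pick Y b u' k"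
  by (induction k) (auto simp: cand_def)

text \<open>The distribution of the chosen prime is never computed. If the result divides
  \<open>N\<close>, then either some draw is one of the at most \<open>r\<close> prime divisors of
  \<open>N\<close>, or no draw was prime; the union bound over draws costs only the factor
  \<open>k\<close>.\<close>

lemma prob_pick_dvd:
  fixes off :: nat
  assumes fin: "finite A" and sub: "(\<lambda>t. off + t) ` {..<k} \<subseteq> A"
    and b: "0 < b" "b \<le> 2 ^ w" and N: "0 < N" "N < 2 ^ r"
    and dens: "real (card {x. prime x \<and> Y \<le> x \<and> x < Y + b}) \<ge> \<rho> * real b" "\<rho> > 0"
  shows "measure_pmf.prob (Pi_pmf A 0 (\<lambda>_. word_pmf w)) {f. pick Y b (\<lambda>t. f (off + t)) k dvd N}
     \<le> 2 * real r * real k / real b + exp (- \<rho> * real k / 2)"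
proof -
  let ?P = "measure_pmf.prob (Pi_pmf A 0 (\<lambda>_. word_pmf w))"
  define Bad where "Bad = {x. prime (Y + x) \<and> Y + x dvd N}"
  define Pr where "Pr = {x. prime (Y + x)}"
  have cb: "card (Bad \<inter> {..<b}) \<le> r"
  proof -
    have "card (Bad \<inter> {..<b}) = card ((\<lambda>x. Y + x) ` (Bad \<inter> {..<b}))" by (simp add: card_image)
    also have "\<dots> \<le> card {x. prime x \<and> x dvd N}"
      by (intro card_mono card_prime_divisors_le(1)[OF N]) (auto simp: Bad_def)
    also have "\<dots> \<le> r" by (rule card_prime_divisors_le(2)[OF N])
    finally show ?thesis .
  qed
  have cp: "real (card (Pr \<inter> {..<b})) \<ge> \<rho> * real b"
  proof -
    have "x \<in> (\<lambda>x. Y + x) ` (Pr \<inter> {..<b})" if "prime x" "Y \<le> x" "x < Y + b" for x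
      using that by (intro image_eqI[of _ _ "x - Y"]) (auto simp: Pr_def)
    then have "{x. prime x \<and> Y \<le> x \<and> x < Y + b} = (\<lambda>x. Y + x) ` (Pr \<inter> {..<b})"
      by (auto simp: Pr_def)
    then show ?thesis using dens(1) by (simp add: card_image)
  qed
  have "{f. pick Y b (\<lambda>t. f (off + t)) k dvd N} \<subseteq>
     (\<Union>t<k. {f. f (off + t) \<in> {x. x mod b \<in> Bad}}) \<union> Pi ((\<lambda>t. off + t) ` {..<k}) (\<lambda>_. {x. x mod b \<in> - Pr})" (is "?E \<subseteq> ?U \<union> ?V")
  proof
    fix f assume f: "f \<in> ?E"
    show "f \<in> ?U \<union> ?V"
      using pick_cases[of k Y b "\<lambda>t. f (off + t)"] f
      by (auto simp: Bad_def Pr_def cand_def)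
  qed
  then have "?P ?E \<le> ?P (?U \<union> ?V)" by (intro measure_pmf.finite_measure_mono) auto
  also have "\<dots> \<le> ?P ?U + ?P ?V" by (intro measure_Un_le) auto
  also have "?P ?U \<le> (\<Sum>t<k. ?P {f. f (off + t) \<in> {x. x mod b \<in> Bad}})"
    by (intro measure_UNION_le) auto
  also have "\<dots> \<le> (\<Sum>t<k. 2 * real r / real b)"
  proof (intro sum_mono)
    fix t assume "t \<in> {..<k}"
    then have t: "off + t \<in> A" using sub by auto
    have "?P {f. f (off + t) \<in> {x. x mod b \<in> Bad}} = measure_pmf.prob (word_pmf w) {x. x mod b \<in> Bad}"
      by (rule prob_component_in[OF fin t])
    also have "\<dots> \<le> 2 * real (card (Bad \<inter> {..<b})) / real b" by (rule prob_word_mod_le[OF b])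
    also have "\<dots> \<le> 2 * real r / real b" using cb by (intro divide_right_mono) auto
    finally show "?P {f. f (off + t) \<in> {x. x mod b \<in> Bad}} \<le> 2 * real r / real b" .
  qed
  also have "\<dots> = 2 * real r * real k / real b" by simp
  also have "?P ?V = ?P {f. f \<in> ?V}" by simp
  also have "?P {f. f \<in> ?V} \<le> exp (- \<rho> * real k / 2)"
  proof (rule prob_Pi_pmf_le[OF fin sub])
    fix g
    let ?A = "(\<lambda>t. off + t) ` {..<k}"
    let ?Q = "measure_pmf.prob (Pi_pmf ?A 0 (\<lambda>_. word_pmf w))"
    have "?Q {f. (\<lambda>x. if x \<in> ?A then f x else g x) \<in> Pi ?A (\<lambda>_. {x. x mod b \<in> - Pr})} = ?Q (Pi ?A (\<lambda>_. {x. x mod b \<in> - Pr}))"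
      by (intro arg_cong[of _ _ ?Q]) (auto simp: Pi_def)
    also have "\<dots> = (\<Prod>x\<in>?A. measure_pmf.prob (word_pmf w) {x. x mod b \<in> - Pr})"
      by (rule measure_Pi_pmf_Pi) simp
    also have "\<dots> = measure_pmf.prob (word_pmf w) {x. x mod b \<in> - Pr} ^ k" by (simp add: card_image)
    also have "\<dots> \<le> exp (- \<rho> / 2) ^ k"
    proof (rule power_mono)
      have "measure_pmf.prob (word_pmf w) {x. x mod b \<in> - Pr} = 1 - measure_pmf.prob (word_pmf w) {x. x mod b \<in> Pr}"
        by (subst measure_pmf.prob_compl[symmetric]) (auto intro!: arg_cong2[of _ _ _ _ measure])
      also have "\<dots> \<le> 1 - \<rho> / 2"
      proof -
        have "\<rho> / 2 = \<rho> * real b / (2 * real b)" using b by simp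
        also have "\<dots> \<le> real (card (Pr \<inter> {..<b})) / (2 * real b)" using cp by (intro divide_right_mono) auto
        also have "\<dots> \<le> measure_pmf.prob (word_pmf w) {x. x mod b \<in> Pr}" by (rule prob_word_mod_ge[OF b])
        finally show ?thesis by simp
      qed
      also have "\<dots> \<le> exp (- \<rho> / 2)" using exp_ge_add_one_self[of "- \<rho> / 2"] by simp
      finally show "measure_pmf.prob (word_pmf w) {x. x mod b \<in> - Pr} \<le> exp (- \<rho> / 2)" .
    qed simp
    also have "\<dots> = exp (- \<rho> * real k / 2)" by (simp flip: exp_of_nat_mult)
    finally show "?Q {f. (\<lambda>x. if x \<in> ?A then f x else g x) \<in> Pi ?A (\<lambda>_. {x. x mod b \<in> - Pr})} \<le> exp (- \<rho> * real k / 2)" .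
  qed
  finally show ?thesis by simp
qed

text \<open>The gaps are independent, and gap \<open>k\<close> misses its share \<open>?C k\<close>
  of \<open>C\<close> with probability at most \<open>1 - card (?C k) / (2 * g)\<close>. Bounding
  this by an exponential makes the product over the gaps add up the shares, and the gaps tile the
  range of \<open>C\<close>.\<close>

lemma prob_no_hit:
  fixes off :: nat
  assumes fin: "finite A" and sub: "(\<lambda>k. off + k) ` {..<S} \<subseteq> A"
    and g: "0 < g" "g \<le> 2 ^ w" and C: "C \<subseteq> {..<S * g}"
  shows "measure_pmf.prob (Pi_pmf A 0 (\<lambda>_. word_pmf w)) {f. \<forall>k<S. k * g + f (off + k) mod g \<notin> C}
     \<le> exp (- real (card C) / (2 * real g))"
proof (rule prob_Pi_pmf_le[OF fin sub])
  fix h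
  let ?A = "(\<lambda>k. off + k) ` {..<S}"
  let ?Q = "measure_pmf.prob (Pi_pmf ?A 0 (\<lambda>_. word_pmf w))"
  let ?C = "\<lambda>k. {r. r < g \<and> k * g + r \<in> C}"
  have eq: "{f. \<forall>k<S. k * g + (if off + k \<in> ?A then f (off + k) else h (off + k)) mod g \<notin> C}
      = Pi ?A (\<lambda>x. {u. u mod g \<in> - ?C (x - off)})"
    using g by (auto simp: Pi_def)
  have "?Q (Pi ?A (\<lambda>x. {u. u mod g \<in> - ?C (x - off)}))
      = (\<Prod>x\<in>?A. measure_pmf.prob (word_pmf w) {u. u mod g \<in> - ?C (x - off)})"
    by (rule measure_Pi_pmf_Pi) simp
  also have "\<dots> = (\<Prod>k<S. measure_pmf.prob (word_pmf w) {u. u mod g \<in> - ?C k})"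
    by (subst prod.reindex) (auto simp: inj_on_def)
  also have "\<dots> \<le> (\<Prod>k<S. exp (- real (card (?C k)) / (2 * real g)))"
  proof (intro prod_mono conjI)
    fix k
    have "measure_pmf.prob (word_pmf w) {x. x mod g \<in> - ?C k} = 1 - measure_pmf.prob (word_pmf w) {x. x mod g \<in> ?C k}"
      by (subst measure_pmf.prob_compl[symmetric]) (auto intro!: arg_cong2[of _ _ _ _ measure])
    also have "\<dots> \<le> 1 + - real (card (?C k)) / (2 * real g)"
    proof -
      have "?C k \<inter> {..<g} = ?C k" by auto
      then show ?thesis using prob_word_mod_ge[OF g, of "?C k"] by simp
    qed
    also have "\<dots> \<le> exp (- real (card (?C k)) / (2 * real g))" by (rule exp_ge_add_one_self)
    finally show "measure_pmf.prob (word_pmf w) {x. x mod g \<in> - ?C k} \<le> exp (- real (card (?C k)) / (2 * real g))" .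
  qed simp
  also have "\<dots> = exp (- real (\<Sum>k<S. card (?C k)) / (2 * real g))"
    by (simp add: exp_sum[symmetric] sum_divide_distrib sum_negf)
  also have "(\<Sum>k<S. card (?C k)) = card C"
  proof -
    have "(\<Sum>k<S. card (?C k)) = card (SIGMA k:{..<S}. ?C k)" by (simp add: card_SigmaI)
    also have "\<dots> = card C"
    proof (rule bij_betw_same_card[of "\<lambda>(k, r). k * g + r"], rule bij_betwI[where g = "\<lambda>c. (c div g, c mod g)"])
      show "(\<lambda>c. (c div g, c mod g)) \<in> C \<rightarrow> (SIGMA k:{..<S}. ?C k)"
        using C g by (auto simp: less_mult_imp_div_less subset_iff)
    qed (use g in auto)
    finally show ?thesis .
  qed
  finally show "?Q {f. \<forall>k<S. k * g + (if off + k \<in> ?A then f (off + k) else h (off + k)) mod g \<notin> C}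
      \<le> exp (- real (card C) / (2 * real g))" unfolding eq .
qed

text \<open>Markov's inequality for the number of events that occur.\<close>

lemma prob_card_ge:
  fixes M :: "'a pmf" and t :: real
  assumes "finite Z" "t > 0" and p: "\<And>z. z \<in> Z \<Longrightarrow> measure_pmf.prob M {f. E z f} \<le> \<epsilon>"
  shows "measure_pmf.prob M {f. t \<le> real (card {z \<in> Z. E z f})} \<le> real (card Z) * \<epsilon> / t"
proof -
  have "ennreal t * emeasure (measure_pmf M) {f. t \<le> real (card {z \<in> Z. E z f})}
      = (\<integral>\<^sup>+ f. ennreal t * indicator {f. t \<le> real (card {z \<in> Z. E z f})} f \<partial>measure_pmf M)"
    by (simp add: nn_integral_cmult)
  also have "\<dots> \<le> (\<integral>\<^sup>+ f. (\<Sum>z\<in>Z. indicator {f. E z f} f) \<partial>measure_pmf M)"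
  proof (rule nn_integral_mono)
    fix f
    have "(\<Sum>z\<in>Z. indicator {f. E z f} f :: ennreal) = ennreal (real (card {z \<in> Z. E z f}))"
      using assms(1) by (simp add: indicator_def sum.If_cases Int_def flip: ennreal_of_nat_eq_real_of_nat)
    then show "ennreal t * indicator {f. t \<le> real (card {z \<in> Z. E z f})} f \<le> (\<Sum>z\<in>Z. indicator {f. E z f} f)"
      by (auto simp: indicator_def intro: ennreal_leI)
  qed
  also have "\<dots> = (\<Sum>z\<in>Z. emeasure (measure_pmf M) {f. E z f})" by (subst nn_integral_sum) auto
  also have "\<dots> = ennreal (\<Sum>z\<in>Z. measure_pmf.prob M {f. E z f})"
    by (simp add: measure_pmf.emeasure_eq_measure)
  also have "\<dots> \<le> ennreal (real (card Z) * \<epsilon>)"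
    using sum_mono[OF p, of Z "\<lambda>z. z"] by (intro ennreal_leI) simp
  finally have "ennreal (t * measure_pmf.prob M {f. t \<le> real (card {z \<in> Z. E z f})}) \<le> ennreal (real (card Z) * \<epsilon>)"
    using assms(2) by (simp add: measure_pmf.emeasure_eq_measure ennreal_mult')
  moreover have "real (card Z) * \<epsilon> \<ge> 0"
  proof (cases "Z = {}")
    case False
    then obtain z where "z \<in> Z" by auto
    then show ?thesis using p[of z] measure_nonneg[of "measure_pmf M" "{f. E z f}"] by (intro mult_nonneg_nonneg) linarith+
  qed simp
  ultimately have "t * measure_pmf.prob M {f. t \<le> real (card {z \<in> Z. E z f})} \<le> real (card Z) * \<epsilon>"
    by (simp add: ennreal_le_iff)
  then show ?thesis using assms(2) by (simp add: field_simps)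
qed

text \<open>Positions whose residue does not occur at a smaller position have distinct residues;
  every other position is charged to a colliding pair. The pairs are counted in all of
  \<open>J\<close>, so the bad event bounded later depends neither on the shift \<open>r\<close> nor
  on the subset \<open>J0\<close>.\<close>

lemma card_residues_ge:
  fixes J :: "nat set"
  assumes "finite J" "J0 \<subseteq> J"
  shows "card J0 \<le> card ((\<lambda>j. (j + r) mod q) ` J0) + card {(a, b) \<in> {(a, b). a \<in> J \<and> b \<in> J \<and> a < b}. q dvd (b - a)}"
proof -
  let ?f = "\<lambda>j. (j + r) mod q"
  let ?X = "{(a, b) \<in> {(a, b). a \<in> J \<and> b \<in> J \<and> a < b}. q dvd (b - a)}"
  define B where "B = {b \<in> J0. \<exists>a\<in>J0. a < b \<and> ?f a = ?f b}"
  have fin: "finite J0" using assms finite_subset by auto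
  have finX: "finite ?X" by (rule finite_subset[of _ "J \<times> J"]) (use assms in auto)
  have "inj_on ?f (J0 - B)"
    by (rule linorder_inj_onI) (auto simp: B_def)
  then have "card (J0 - B) = card (?f ` (J0 - B))" by (simp add: card_image)
  also have "\<dots> \<le> card (?f ` J0)" using fin by (intro card_mono) auto
  finally have 1: "card (J0 - B) \<le> card (?f ` J0)" .
  have "B \<subseteq> snd ` ?X"
  proof
    fix b assume "b \<in> B"
    then obtain a where a: "a \<in> J0" "b \<in> J0" "a < b" "?f a = ?f b" by (auto simp: B_def)
    have "q dvd ((b + r) - (a + r))" using a by (intro mod_eq_dvd_iff_nat[THEN iffD1]) auto
    then have "(a, b) \<in> ?X" using a assms by auto
    then show "b \<in> snd ` ?X" by force
  qed
  then have "card B \<le> card (snd ` ?X)" using finX by (intro card_mono) auto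
  also have "\<dots> \<le> card ?X" using finX by (rule card_image_le)
  finally have 2: "card B \<le> card ?X" .
  have "card J0 = card (J0 - B) + card B"
  proof -
    have "B \<subseteq> J0" by (auto simp: B_def)
    then show ?thesis using fin card_mono[of J0 B] finite_subset[of B J0] by (simp add: card_Diff_subset)
  qed
  then show ?thesis using 1 2 by simp
qed

section \<open>Total-correctness rules for deterministic programs, with running time\<close>

lemma tick_sel [simp]: "reg (tick t s) = reg s" "mem (tick t s) = mem s"
  "reported (tick t s) = reported s" "clock (tick t s) = clock s + t"
  by (simp_all add: tick_def)

lemma tick_upd [simp]: "tick t (s\<lparr>reg := r\<rparr>) = (tick t s)\<lparr>reg := r\<rparr>"
  "tick t (s\<lparr>mem := m\<rparr>) = (tick t s)\<lparr>mem := m\<rparr>"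
  "tick t (s\<lparr>reported := R\<rparr>) = (tick t s)\<lparr>reported := R\<rparr>"
  by (simp_all add: tick_def)

lemma exp_val_tick [simp]: "exp_val I (tick t s) e = exp_val I s e"
  by (induction e) simp_all

text \<open>The run must have a single outcome, reached with probability 1, so the predicate
  expresses termination together with determinism. It serves for every part of the program that
  draws no random word.\<close>

definition wp :: "ram_input \<Rightarrow> com \<Rightarrow> ram_state \<Rightarrow> (ram_state \<Rightarrow> bool) \<Rightarrow> bool" where
  "wp I c s Q \<longleftrightarrow> (\<exists>s'. exec I c s = return_spmf s' \<and> Q s')"

lemma wp_Skip [simp]: "wp I Skip s Q \<longleftrightarrow> Q (tick 1 s)"
  by (simp add: wp_def)

lemma wp_Assign [simp]:
  "wp I (Assign r e) s Q \<longleftrightarrow> Q ((tick (1 + cost e) s)\<lparr>reg := (reg s)(r := exp_val I s e)\<rparr>)"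
  by (simp add: wp_def)

lemma wp_Store [simp]:
  "wp I (Store a e) s Q \<longleftrightarrow> Q ((tick (1 + cost a + cost e) s)\<lparr>mem := (mem s)(exp_val I s a := exp_val I s e)\<rparr>)"
  by (simp add: wp_def)

lemma wp_Report [simp]:
  "wp I (Report e) s Q \<longleftrightarrow> Q ((tick (1 + cost e) s)\<lparr>reported := insert (exp_val I s e) (reported s)\<rparr>)"
  by (simp add: wp_def)

lemma wp_Seq: "wp I c1 s (\<lambda>s'. wp I c2 s' Q) \<Longrightarrow> wp I (Seq c1 c2) s Q"
  by (auto simp: wp_def)

lemma wp_Cond [simp]:
  "wp I (Cond b c1 c2) s Q \<longleftrightarrow>
     (if exp_val I s b \<noteq> 0 then wp I c1 (tick (1 + cost b) s) Q else wp I c2 (tick (1 + cost b) s) Q)"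
  by (simp add: wp_def Let_def)

lemma wp_mono: "wp I c s Q \<Longrightarrow> (\<And>s'. Q s' \<Longrightarrow> Q' s') \<Longrightarrow> wp I c s Q'"
  by (auto simp: wp_def)

text \<open>The number \<open>N\<close> of iterations is given in advance, which makes the rule total.\<close>

lemma wp_While:
  assumes init: "J 0 s"
    and guard: "\<And>k s. k < N \<Longrightarrow> J k s \<Longrightarrow> exp_val I s b \<noteq> 0"
    and body: "\<And>k s. k < N \<Longrightarrow> J k s \<Longrightarrow> wp I c s (\<lambda>s'. J (Suc k) s' \<and> clock s' \<le> clock s + t k)"
    and stop: "\<And>s. J N s \<Longrightarrow> exp_val I s b = 0"
    and tick: "\<And>k s x. J k s \<Longrightarrow> J k (tick x s)"
    and post: "\<And>s'. J N s' \<Longrightarrow> clock s' \<le> clock s + (\<Sum>k<N. t k + cost b + 1) + cost b + 1 \<Longrightarrow> Q s'"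
  shows "wp I (While b c) s Q"
proof -
  let ?w = "while_spmf (\<lambda>s. exp_val I s b \<noteq> 0) (\<lambda>s. exec I c (tick (1 + cost b) s))"
  have "\<exists>s'. ?w s1 = return_spmf s' \<and> J N s' \<and> clock s' \<le> clock s1 + (\<Sum>k=j..<N. t k + cost b + 1)"
    if "j \<le> N" "J j s1" for j s1
    using that
  proof (induction "N - j" arbitrary: j s1)
    case 0
    then have "j = N" by simp
    with 0 stop show ?case by (subst while_spmf.simps) simp
  next
    case (Suc d)
    then have jN: "j < N" by simp
    obtain s2 where s2: "exec I c (tick (1 + cost b) s1) = return_spmf s2" "J (Suc j) s2"
        "clock s2 \<le> clock s1 + (1 + cost b) + t j"
      using body[OF jN tick[OF Suc.prems(2), of "1 + cost b"]] by (auto simp: wp_def)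
    have "d = N - Suc j" "Suc j \<le> N" using Suc.hyps(2) jN by auto
    from Suc.hyps(1)[OF this s2(2)] obtain s' where s': "?w s2 = return_spmf s'" "J N s'"
      "clock s' \<le> clock s2 + (\<Sum>k=Suc j..<N. t k + cost b + 1)" by blast
    have "?w s1 = ?w s2"
      using guard[OF jN Suc.prems(2)] by (subst while_spmf.simps) (simp add: s2(1)[simplified])
    moreover have "(\<Sum>k=j..<N. t k + cost b + 1) = (t j + cost b + 1) + (\<Sum>k=Suc j..<N. t k + cost b + 1)"
      using jN by (rule sum.atLeast_Suc_lessThan)
    ultimately show ?case using s' s2(3) by (intro exI[of _ s']) simp
  qed
  from this[of 0 s] init obtain s' where
    "?w s = return_spmf s'" "J N s'" "clock s' \<le> clock s + (\<Sum>k=0..<N. t k + cost b + 1)" by auto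
  then show ?thesis unfolding wp_def
    by (intro exI[of _ "tick (1 + cost b) s'"]) (auto intro!: post tick simp: atLeast0LessThan)
qed

definition For :: "nat \<Rightarrow> expr \<Rightarrow> com \<Rightarrow> com" where
  "For r e c = Seq (Assign r (Const 0))
     (While (Bin Lt (Reg r) e) (Seq c (Assign r (Bin Add (Reg r) (Const 1)))))"

text \<open>The counter belongs to the rule: the body must leave register \<open>r\<close> at
  \<open>k\<close>, and \<open>J (Suc k)\<close> is demanded of the state in which the counter has
  already advanced. The test and the increment cost \<open>cost e + 7\<close> per iteration.\<close>

lemma wp_For:
  assumes init: "J 0 (s\<lparr>reg := (reg s)(r := 0)\<rparr>)"
    and w: "word_size I > 0" "N < 2 ^ word_size I"
    and bound: "\<And>k s. J k s \<Longrightarrow> exp_val I s e = N"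
    and body: "\<And>k s. k < N \<Longrightarrow> J k s \<Longrightarrow> reg s r = k \<Longrightarrow>
       wp I c s (\<lambda>s'. J (Suc k) (s'\<lparr>reg := (reg s')(r := Suc k)\<rparr>) \<and> reg s' r = k \<and> clock s' \<le> clock s + t k)"
    and tick: "\<And>k s x. J k s \<Longrightarrow> J k (tick x s)"
    and post: "\<And>s'. J N s' \<Longrightarrow> clock s' \<le> clock s + (\<Sum>k<N. t k + cost e + 7) + cost e + 5 \<Longrightarrow> Q s'"
  shows "wp I (For r e c) s Q"
  unfolding For_def
proof (rule wp_Seq, simp only: wp_Assign, rule wp_While[where J = "\<lambda>k s. J k s \<and> reg s r = k" and N = N and t = "\<lambda>k. t k + 4"], goal_cases)
  case 1
  show ?case using tick[OF init, of "Suc (Suc 0)"] by simp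
next
  case (2 k s) then show ?case using bound[of k s] by simp
next
  case (3 k s)
  have "wp I c s (\<lambda>s'. J (Suc k) (s'\<lparr>reg := (reg s')(r := Suc k)\<rparr>) \<and> reg s' r = k \<and> clock s' \<le> clock s + t k)"
    using body 3 by simp
  then show ?case
  proof (intro wp_Seq, elim wp_mono, goal_cases)
    case (1 s')
    have "k + 1 < 2 ^ word_size I" using 3 w by simp
    then have [simp]: "take_bit (word_size I) (Suc k) = Suc k" by (simp add: take_bit_nat_eq_self)
    show ?case using 1 tick[of "Suc k" "s'\<lparr>reg := (reg s')(r := Suc k)\<rparr>"] w(1) by simp
  qed
next
  case (4 s) then show ?case using bound[of N s] by simp
next
  case (5 k s x) then show ?case using tick by simp
next
  case (6 s')
  then show ?case using post[of s'] by (simp add: algebra_simps)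
qed

lemma take_bit_self [simp]: "x < 2 ^ w \<Longrightarrow> take_bit w x = (x::nat)"
  by (simp add: take_bit_nat_eq_self)

lemma apply_op_Sub: "y \<le> x \<Longrightarrow> x < 2 ^ w \<Longrightarrow> apply_op w Sub x y = x - y"
proof -
  assume a: "y \<le> x" "x < 2 ^ w"
  then have "2 ^ w + x - y = 2 ^ w + (x - y)" by simp
  then have "apply_op w Sub x y = take_bit w (x - y)" by (simp add: take_bit_eq_mod)
  then show ?thesis using a by simp
qed

section \<open>Encoding sequences of words as numbers\<close>

text \<open>The words are digits in base \<open>2 ^ w\<close>, the first one most significant. A
  fingerprint is this number modulo \<open>pm\<close>, and appending a word is one Horner
  step.\<close>

definition enc :: "nat \<Rightarrow> nat list \<Rightarrow> nat" where
  "enc w xs = foldl (\<lambda>h x. h * 2 ^ w + x) 0 xs"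

lemma enc_Nil [simp]: "enc w [] = 0"
  by (simp add: enc_def)

lemma enc_snoc [simp]: "enc w (xs @ [x]) = enc w xs * 2 ^ w + x"
  by (simp add: enc_def)

lemma enc_append: "enc w (xs @ ys) = enc w xs * 2 ^ (w * length ys) + enc w ys"
  by (induction ys rule: rev_induct)
     (simp_all add: enc_def algebra_simps power_add flip: append_assoc)

lemma enc_less: "(\<And>x. x \<in> set xs \<Longrightarrow> x < 2 ^ w) \<Longrightarrow> enc w xs < 2 ^ (w * length xs)"
proof (induction xs rule: rev_induct)
  case (snoc x xs)
  have "enc w xs + 1 \<le> 2 ^ (w * length xs)" using snoc by (simp add: Suc_le_eq)
  then have "(enc w xs + 1) * 2 ^ w \<le> 2 ^ (w * length xs) * 2 ^ w" by (rule mult_right_mono) simp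
  moreover have "x < 2 ^ w" using snoc.prems by simp
  ultimately show ?case by (simp add: algebra_simps power_add)
qed simp

lemma enc_inj:
  "length xs = length ys \<Longrightarrow> (\<And>x. x \<in> set xs \<union> set ys \<Longrightarrow> x < 2 ^ w) \<Longrightarrow> enc w xs = enc w ys \<Longrightarrow> xs = ys"
proof (induction xs arbitrary: ys rule: rev_induct)
  case (snoc x xs)
  then obtain y ys' where ys: "ys = ys' @ [y]" by (cases ys rule: rev_cases) auto
  have lt: "x < 2 ^ w" "y < 2 ^ w" using snoc.prems(2) ys by auto
  have e: "enc w xs * 2 ^ w + x = enc w ys' * 2 ^ w + y" using snoc.prems(3) ys by simp
  have "x = y" using arg_cong[OF e, of "\<lambda>z. z mod 2 ^ w"] lt by simp
  moreover have "enc w xs = enc w ys'" using arg_cong[OF e, of "\<lambda>z. z div 2 ^ w"] lt by simp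
  moreover have "xs = ys'"
    by (rule snoc.IH) (use snoc.prems ys calculation in auto)
  ultimately show ?case using ys by simp
qed simp

section \<open>Parameters of the algorithm and geometry of the samples\<close>

text \<open>\<open>l\<close> is the bit length of \<open>n\<close>. \<open>D\<close> and
  \<open>L\<close> are the powers of two just below \<open>\<delta> * m\<close> and
  \<open>(\<delta> * n)^(1/3)\<close>, or 1 when these are smaller than 1. The bound
  \<open>l ^ 60 \<le> n\<close> lets powers of \<open>l\<close> be absorbed where values are
  compared with \<open>n\<close>.\<close>

locale par =
  fixes w n m l D L :: nat and T P :: "nat list" and \<delta> :: real
  assumes lenT: "length T = n" and lenP: "length P = m" and m1: "1 \<le> m" and mn: "m \<le> n"
    and T_lt: "\<And>x. x \<in> set T \<Longrightarrow> x < 2 ^ w" and P_lt: "\<And>x. x \<in> set P \<Longrightarrow> x < 2 ^ w"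
    and d0: "\<delta> > 0" and d1: "\<delta> < 1"
    and l1: "n < 2 ^ l" and l2: "2 ^ l \<le> 2 * n"
    and Dpow: "\<exists>k. D = 2 ^ k" and Dlow: "D = 1 \<or> real D \<le> \<delta> * real m" and Dup: "\<delta> * real m < 2 * real D"
    and Lpow: "\<exists>k. L = 2 ^ k" and Llow: "L = 1 \<or> real (L ^ 3) \<le> \<delta> * real n" and Lup: "\<delta> * real n < 8 * real (L ^ 3)"
    and big: "l ^ 60 \<le> n" and l1000: "1000 \<le> l" and wl: "w \<le> l ^ 2" and wn: "n ^ 8 \<le> 2 ^ w"
begin

text \<open>The block length \<open>H\<close> is about \<open>mu / 4\<close>. Bounding it by
  \<open>D\<close> keeps the loss at the window ends small; bounding \<open>mu\<close> by
  \<open>L\<close> keeps the pattern work, about \<open>L * mu * (m / D)\<close>, below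
  \<open>L^2 * (m / D)\<close>. A round makes about \<open>n / H\<close> bucket queries, hence
  \<open>n / D + n / L\<close>.\<close>

definition "mu = min D L"
definition "H = max 1 (mu div 4)"
text \<open>With gaps shorter than \<open>D\<close> by a factor \<open>l ^ 2\<close>, missing
  \<open>D / 4\<close> residues has probability exponentially small in \<open>l ^ 2\<close>. The
  summand 1 keeps the gap positive when \<open>D\<close> is small.\<close>

definition "g = D div l ^ 2 + 1"
text \<open>The product \<open>Q * p\<close> should be about \<open>L * D\<close>, so that a fixed
  difference is a multiple of it with probability about \<open>1 / (L * D)\<close>. The split gives
  \<open>p\<close>, the number of chains, the share \<open>D / mu\<close>: chains of length about
  \<open>n / D\<close> then cost \<open>n / mu\<close> altogether.\<close>

definition "YQ = L * mu * l ^ 3"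
definition "Yp = (D div mu) * l ^ 3"
text \<open>A window code has about \<open>l ^ 2 * (m / D)\<close> words of at most
  \<open>l ^ 2\<close> bits, which bounds its prime divisors; one factor \<open>l\<close> pays for
  the draws of the prime, the last one absorbs constants, and \<open>L\<close> is the desired
  inverse collision probability.\<close>

definition "Yi = L * (m div D + 1) * l ^ 6"
text \<open>Words of randomness per round: three times \<open>l ^ 3\<close> draws for the primes and
  at most \<open>4 * L * l ^ 12\<close> jitter values.\<close>

definition "tb = L * l ^ 13"

definition "SS Q p = Q * p div g"
definition "vv u k = k * g + u k mod g"
text \<open>The \<open>S = SS Q p\<close> gaps cover only the first \<open>S * g\<close> positions
  of each period; the remainder \<open>q mod g\<close> of the period carries no sample.\<close>

definition "zs Q p u a = (a div SS Q p) * (Q * p) + vv u (a mod SS Q p)"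
text \<open>The samples from \<open>st\<close> up to \<open>en\<close> lie in
  \<open>[h * H + H - 1, h * H + m)\<close>, the intersection of the \<open>H\<close> windows of
  length \<open>m\<close> that start at \<open>h * H + y\<close> with \<open>y < H\<close>. The same
  samples therefore serve every \<open>y\<close> of the block.\<close>

definition "st Q p u h = (LEAST a. h * H + H - 1 \<le> zs Q p u a)"
definition "en Q p u h = (LEAST a. h * H + m \<le> zs Q p u a)"
definition "tx i = (if i < n then T ! i else 0)"
definition "px j = (if j < m then P ! j else 0)"
definition "tcode Q p u c h = enc w (map (\<lambda>a. tx (c * Q + zs Q p u a)) [st Q p u h..<en Q p u h])"
definition "pcode Q p u h y = enc w (map (\<lambda>a. px (zs Q p u a - h * H - y)) [st Q p u h..<en Q p u h])"
definition "hit Q p pm u i \<longleftrightarrow>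
   tcode Q p u (i div Q) (i mod Q div H) mod pm = pcode Q p u (i mod Q div H) (i mod Q mod H) mod pm"

lemma D_ge1: "1 \<le> D" using Dpow by auto
lemma L_ge1: "1 \<le> L" using Lpow by auto
lemma mu_ge1: "1 \<le> mu" using D_ge1 L_ge1 by (simp add: mu_def)
lemma mu_le: "mu \<le> D" "mu \<le> L" by (simp_all add: mu_def)
lemma H_ge1: "1 \<le> H" by (simp add: H_def)
lemma g_ge1: "1 \<le> g" by (simp add: g_def)
lemma D_le_m: "D \<le> m"
proof (cases "D = 1")
  case False
  then have "real D \<le> \<delta> * real m" using Dlow by simp
  also have "\<dots> \<le> real m" using d1 by (simp add: mult_left_le_one_le d0 less_imp_le)
  finally show ?thesis by simp
qed (use m1 in simp)
lemma L3_le_n: "L ^ 3 \<le> n"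
proof (cases "L = 1")
  case False
  then have "real (L ^ 3) \<le> \<delta> * real n" using Llow by simp
  also have "\<dots> \<le> real n" using d1 by (simp add: mult_left_le_one_le d0 less_imp_le)
  finally show ?thesis by linarith
qed (use m1 mn in simp)
lemma H_le: "4 * (H - 1) \<le> D" "H \<le> mu"
  using mu_le mu_ge1 by (auto simp: H_def)
lemma mu_dvd_D: "mu dvd D"
  using Dpow Lpow by (auto simp: mu_def min_def intro: le_imp_power_dvd)
text \<open>The split of \<open>L * D\<close> between the two ranges is exact because
  \<open>mu\<close> divides \<open>D\<close>, both being powers of two.\<close>

lemma YQYp: "YQ * Yp = L * D * l ^ 6"
proof -
  have "mu * (D div mu) = D" using mu_dvd_D by simp
  then have "L * (mu * (D div mu)) * (l ^ 3 * l ^ 3) = L * D * l ^ 6" by (simp flip: power_add)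
  then show ?thesis by (simp add: YQ_def Yp_def mult_ac)
qed
lemma n_pos: "0 < n" using m1 mn by simp
lemma l_pos: "0 < l" using l1000 by simp
lemma Y_pos: "0 < YQ" "0 < Yp" "0 < Yi" "1 < YQ" "1 < Yp" "1 < Yi"
proof -
  have d: "1 \<le> D div mu" using mu_le mu_ge1 by (simp add: div_greater_zero_iff Suc_le_eq)
  have l36: "1 < l ^ 3" "1 < l ^ 6" using one_less_power[of l 3] one_less_power[of l 6] l1000 by auto
  have "1 \<le> L * mu" "1 \<le> L * (m div D + 1)" using L_ge1 mu_ge1 by auto
  then have "1 * l ^ 3 \<le> YQ" "1 * l ^ 3 \<le> Yp" "1 * l ^ 6 \<le> Yi"
    unfolding YQ_def Yp_def Yi_def using d by (intro mult_right_mono; simp)+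
  then show "0 < YQ" "0 < Yp" "0 < Yi" "1 < YQ" "1 < Yp" "1 < Yi"
    using l36 by linarith+
qed

end

text \<open>One round with its random choices fixed. Only ranges are demanded of \<open>Q\<close>,
  \<open>p\<close> and \<open>pm\<close>, so what is proved here holds for every tape; primality
  enters through the probability bounds for \<open>pick\<close>.\<close>

locale inst = par +
  fixes Q p pm :: nat and u :: "nat \<Rightarrow> nat"
  assumes Qb: "YQ \<le> Q" "Q < YQ + l ^ 2 * YQ"
    and pb: "Yp \<le> p" "p < Yp + l ^ 2 * Yp"
    and ib: "Yi \<le> pm" "pm < Yi + l ^ 2 * Yi"
begin

abbreviation "q \<equiv> Q * p"
abbreviation "S \<equiv> SS Q p"
abbreviation "zz \<equiv> zs Q p u"
abbreviation "ss \<equiv> st Q p u"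
abbreviation "ee \<equiv> en Q p u"

lemma Q_pos: "0 < Q" "0 < p" "0 < pm" using Qb pb ib Y_pos by auto

lemma g_le_q: "g \<le> q"
proof -
  have "g \<le> D + 1" unfolding g_def by simp
  also have "\<dots> \<le> L * D * l ^ 6"
  proof -
    have "1 * 2 \<le> L * l ^ 6" using L_ge1 l1000 self_le_power[of l 6] by (intro mult_mono) auto
    then have "D * (1 * 2) \<le> D * (L * l ^ 6)" by (rule mult_left_mono) simp
    then have "2 * D \<le> L * D * l ^ 6" by (simp add: mult_ac)
    then show ?thesis using D_ge1 by linarith
  qed
  also have "\<dots> = YQ * Yp" by (rule YQYp[symmetric])
  also have "\<dots> \<le> q" using Qb pb by (intro mult_mono) auto
  finally show ?thesis .
qed

lemma S_pos: "0 < S" using g_le_q g_ge1 by (simp add: SS_def div_greater_zero_iff)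

lemma Sg_le: "S * g \<le> q" by (simp add: SS_def)

text \<open>The left end of the gap that holds sample \<open>a\<close>. Spacing facts are proved for
  it and transferred to \<open>zz\<close>, whose jitter stays inside the gap.\<close>

definition "bs a = (a div S) * q + (a mod S) * g"

lemma vv_bounds: "k * g \<le> vv u k" "vv u k < k * g + g"
  using g_ge1 by (auto simp: vv_def)

lemma vv_less_q: "k < S \<Longrightarrow> vv u k < q"
proof -
  assume "k < S"
  then have "k * g + g \<le> S * g" by (metis Suc_leI add.commute mult_Suc mult_le_mono1)
  then show ?thesis using vv_bounds[of k] Sg_le by linarith
qed

lemma bs_zs: "bs a \<le> zz a" "zz a < bs a + g"
  using vv_bounds[of "a mod S"] by (auto simp: bs_def zs_def)

lemma bs_Suc: "bs a + g \<le> bs (Suc a)"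
proof (cases "Suc (a mod S) = S")
  case True
  then have "Suc a mod S = 0" "Suc a div S = Suc (a div S)" by (simp_all add: mod_Suc div_Suc)
  moreover have "(a mod S) * g + g \<le> q" using True Sg_le by (metis add.commute mult_Suc)
  ultimately show ?thesis by (simp add: bs_def)
next
  case False
  then have "Suc a mod S = Suc (a mod S)" "Suc a div S = a div S" by (simp_all add: mod_Suc div_Suc)
  then show ?thesis by (simp add: bs_def)
qed

lemma bs_add: "bs a + k * g \<le> bs (a + k)"
proof (induction k)
  case (Suc k) then show ?case using bs_Suc[of "a + k"] by simp
qed simp

lemma zs_add: "zz a + k * g < zz (a + k) + g"
  using bs_zs(2)[of a] bs_add[of a k] bs_zs(1)[of "a + k"] by linarith

lemma zs_Suc: "zz a < zz (Suc a)"
  using bs_zs(2)[of a] bs_Suc[of a] bs_zs(1)[of "Suc a"] by linarith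

lemma zs_mono: "strict_mono zz"
  using zs_Suc by (rule strict_monoI_Suc)

lemma zs_ge: "a * g \<le> zz a" "a \<le> zz a"
proof -
  have "bs 0 + a * g \<le> bs (0 + a)" by (rule bs_add)
  then show 1: "a * g \<le> zz a" using bs_zs(1)[of a] by simp
  have "a * 1 \<le> a * g" using g_ge1 by (intro mult_left_mono) auto
  then show "a \<le> zz a" using 1 by linarith
qed

lemma zs_shift: "zz (a + e * S) = zz a + e * q"
  using S_pos by (simp add: zs_def algebra_simps)

lemma zs_row: "k < S \<Longrightarrow> zz (b * S + k) = b * q + vv u k"
  using S_pos by (simp add: zs_def)

lemma ex_sample: "k < S \<Longrightarrow> z mod q = vv u k \<Longrightarrow> \<exists>a. zz a = z"
  using zs_row[of k "z div q"] div_mult_mod_eq[of z q] by metis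

text \<open>Strict monotonicity of the samples turns the \<open>LEAST\<close> into a threshold,
  which is how the scanning loop of the program tests it.\<close>

lemma less_st: "a < ss h \<longleftrightarrow> zz a < h * H + H - 1"
proof
  assume "a < ss h" then show "zz a < h * H + H - 1" unfolding st_def using not_less_Least by fastforce
next
  assume "zz a < h * H + H - 1"
  moreover have "h * H + H - 1 \<le> zz (ss h)" unfolding st_def by (rule LeastI[of _ "h * H + H - 1"]) (rule zs_ge)
  ultimately have "zz a < zz (ss h)" by simp
  then show "a < ss h" using zs_mono by (simp add: strict_mono_less)
qed

lemma less_en: "a < ee h \<longleftrightarrow> zz a < h * H + m"
proof
  assume "a < ee h" then show "zz a < h * H + m" unfolding en_def using not_less_Least by fastforce
next
  assume "zz a < h * H + m"
  moreover have "h * H + m \<le> zz (ee h)" unfolding en_def by (rule LeastI[of _ "h * H + m"]) (rule zs_ge)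
  ultimately have "zz a < zz (ee h)" by simp
  then show "a < ee h" using zs_mono by (simp add: strict_mono_less)
qed

lemma H_le_m: "H \<le> m" using H_le mu_le D_le_m by linarith

lemma st_le_en: "ss h \<le> ee h"
proof (rule ccontr)
  assume "\<not> ss h \<le> ee h"
  then have "zz (ee h) < h * H + H - 1" using less_st[of "ee h" h] by linarith
  then have "zz (ee h) < h * H + m" using H_le_m by simp
  then show False using less_en by blast
qed

lemma st_le: "ss h \<le> (h * H + H) div g + 1"
proof (rule ccontr)
  assume "\<not> ?thesis"
  then have "zz ((h * H + H) div g + 1) < h * H + H - 1"
    using less_st[of "(h * H + H) div g + 1" h] by linarith
  moreover have "((h * H + H) div g + 1) * g \<le> zz ((h * H + H) div g + 1)" by (rule zs_ge)
  moreover have "h * H + H < ((h * H + H) div g + 1) * g" using g_ge1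
    by (metis Suc_eq_plus1 dividend_less_div_times less_le_trans mult_Suc zero_less_one add.commute)
  ultimately show False by linarith
qed

text \<open>Jitter brings two samples closer by less than one gap, so samples \<open>k\<close> apart
  in index are more than \<open>(k - 1) * g\<close> apart in position.\<close>

lemma len_le: "ee h - ss h \<le> m div g + 2"
proof (cases "ee h \<le> ss h")
  case False
  define k where "k = ee h - 1 - ss h"
  have e: "ee h - 1 = ss h + k" using False by (simp add: k_def)
  have "zz (ss h + k) < h * H + m" using less_en[of "ss h + k" h] e False by linarith
  moreover have "h * H + H - 1 \<le> zz (ss h)" using less_st[of "ss h" h] by simp
  moreover have "zz (ss h) + k * g < zz (ss h + k) + g" by (rule zs_add)
  ultimately have "k * g < m + g" using H_ge1 by linarith
  then have "k * g div g \<le> (m + g) div g" by (intro div_le_mono) simp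
  then have "k \<le> m div g + 1" using g_ge1 by simp
  then show ?thesis using k_def by linarith
qed simp

lemma window:
  assumes "ss h \<le> a" "a < ee h"
  shows "h * H + H - 1 \<le> zz a" "zz a < h * H + m"
  using assms less_st[of a h] less_en[of a h] by linarith+

lemma decomp: "i = i div Q * Q + i mod Q div H * H + i mod Q mod H" "i mod Q mod H < H"
  using H_ge1 by (simp_all add: div_mult_mod_eq add.assoc)

text \<open>The window starts at \<open>h * H + H - 1\<close> and not at \<open>h * H\<close>; hence
  the natural subtraction of \<open>h * H + y\<close> is exact for each
  \<open>y < H\<close>.\<close>

lemma px_arg:
  assumes "ss h \<le> a" "a < ee h" "y < H"
  shows "zz a - h * H - y + h * H + y = zz a" "zz a - h * H - y < m"
  using window[OF assms(1,2)] assms(3) by linarith+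

lemma tx_lt: "tx i < 2 ^ w"
  using T_lt lenT by (auto simp: tx_def)

lemma px_lt: "px i < 2 ^ w"
  using P_lt lenP by (auto simp: px_def)

text \<open>The two codes agree digit by digit before any reduction, so an exact occurrence survives
  whatever the random choices are.\<close>

lemma hit_exact:
  assumes "i \<in> locations P T" "ham_at P T i = 0"
  shows "hit Q p pm u i"
proof -
  have i: "i + m \<le> n" using assms(1) mn by (auto simp: locations_def lenT lenP)
  have eq: "P ! j = T ! (i + j)" if "j < m" for j
  proof -
    have "finite {j. j < length P \<and> P ! j \<noteq> T ! (i + j)}" by simp
    then have "{j. j < length P \<and> P ! j \<noteq> T ! (i + j)} = {}" using assms(2) unfolding ham_at_def by (simp only: card_0_eq)
    then show ?thesis using that lenP by blast
  qed
  define h where "h = i mod Q div H"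
  define y where "y = i mod Q mod H"
  have y: "y < H" and d: "i = i div Q * Q + h * H + y" using decomp[of i] by (simp_all add: h_def y_def)
  have "tcode Q p u (i div Q) h = pcode Q p u h y"
    unfolding tcode_def pcode_def
  proof (intro arg_cong[of _ _ "enc w"] map_cong refl)
    fix a assume "a \<in> set [ss h..<ee h]"
    then have a: "ss h \<le> a" "a < ee h" by auto
    define j where "j = zz a - h * H - y"
    have j: "j + h * H + y = zz a" "j < m" using px_arg[OF a y] by (simp_all add: j_def)
    then have "i div Q * Q + zz a = i + j" using d by linarith
    then show "tx (i div Q * Q + zz a) = px (zz a - h * H - y)"
      using eq[of j] j i unfolding j_def[symmetric] by (simp add: tx_def px_def)
  qed
  then show ?thesis by (simp add: hit_def h_def y_def)
qed

text \<open>The sample at \<open>j + i mod Q\<close> compares \<open>P ! j\<close> with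
  \<open>T ! (i + j)\<close>; by injectivity of \<open>enc\<close>, equal codes would force these
  two letters to be equal.\<close>

lemma codes_differ:
  assumes i: "i \<in> locations P T" and j: "j < m" "P ! j \<noteq> T ! (i + j)"
    and win: "H - 1 \<le> j + i mod Q mod H" "j + i mod Q mod H < m"
    and k: "k < S" "(j + i mod Q) mod q = vv u k"
  shows "tcode Q p u (i div Q) (i mod Q div H) \<noteq> pcode Q p u (i mod Q div H) (i mod Q mod H)"
proof
  define h where "h = i mod Q div H"
  define y where "y = i mod Q mod H"
  assume "tcode Q p u (i div Q) (i mod Q div H) = pcode Q p u (i mod Q div H) (i mod Q mod H)"
  then have eq: "map (\<lambda>a. tx (i div Q * Q + zz a)) [ss h..<ee h] = map (\<lambda>a. px (zz a - h * H - y)) [ss h..<ee h]"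
    unfolding tcode_def pcode_def h_def[symmetric] y_def[symmetric]
    by (intro enc_inj[where w = w]) (auto simp: tx_lt px_lt)
  have y: "y < H" and d: "i = i div Q * Q + h * H + y" and r: "i mod Q = h * H + y"
    using decomp[of i] div_mult_mod_eq[of "i mod Q" H] by (simp_all add: h_def y_def)
  obtain a where a: "zz a = j + i mod Q" using ex_sample[OF k] by auto
  have win': "H - 1 \<le> j + y" "j + y < m" using win by (simp_all add: y_def)
  have "ss h \<le> a" "a < ee h"
    using less_st[of a h] less_en[of a h] a win' r H_ge1 by linarith+
  then have "tx (i div Q * Q + zz a) = px (zz a - h * H - y)" using eq by (auto simp: map_eq_conv)
  moreover have "i div Q * Q + zz a = i + j" "zz a - h * H - y = j" using a r d by linarith+
  moreover have "i + m \<le> n" using i mn by (auto simp: locations_def lenT lenP)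
  ultimately show False using j by (simp add: tx_def px_def)
qed

lemma tcode_lt: "tcode Q p u c h < 2 ^ (w * (ee h - ss h))"
  unfolding tcode_def by (rule order_less_le_trans[OF enc_less]) (auto simp: tx_lt)

lemma pcode_lt: "pcode Q p u h y < 2 ^ (w * (ee h - ss h))"
  unfolding pcode_def by (rule order_less_le_trans[OF enc_less]) (auto simp: px_lt)

definition "cc c0 b = enc w (map (\<lambda>a. tx (c0 * Q + zz a)) [0..<b])"

lemma cc_0 [simp]: "cc c0 0 = 0" by (simp add: cc_def)
lemma cc_Suc: "cc c0 (Suc b) = cc c0 b * 2 ^ w + tx (c0 * Q + zz b)" by (simp add: cc_def)

text \<open>The starts \<open>c * Q\<close> and \<open>(c mod p) * Q\<close> differ by a multiple of
  the period \<open>Q * p\<close>, so chain \<open>c mod p\<close> visits the same text positions,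
  \<open>c div p * S\<close> samples later. This is why \<open>p\<close> chains of prefix codes
  serve all values of \<open>c\<close>.\<close>

lemma cc_tcode:
  "cc (c mod p) (ee h + c div p * S) = cc (c mod p) (ss h + c div p * S) * 2 ^ (w * (ee h - ss h)) + tcode Q p u c h"
proof -
  let ?o = "c div p * S"
  have "[0..<ee h + ?o] = [0..<ss h + ?o] @ [ss h + ?o..<ee h + ?o]"
    using upt_add_eq_append[of 0 "ss h + ?o" "ee h - ss h"] st_le_en[of h] by (simp add: add.commute)
  moreover have "map (\<lambda>a. tx (c mod p * Q + zz a)) [ss h + ?o..<ee h + ?o] = map (\<lambda>a. tx (c * Q + zz a)) [ss h..<ee h]"
  proof -
    have "[ss h + ?o..<ee h + ?o] = map (\<lambda>a. a + ?o) [ss h..<ee h]"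
      by (rule nth_equalityI) auto
    moreover have "c mod p * Q + zz (a + ?o) = c * Q + zz a" for a
    proof -
      have "c mod p * Q + c div p * q = (c mod p + c div p * p) * Q" by (simp only: ring_distribs mult_ac)
      also have "c mod p + c div p * p = c" by (rule mod_div_mult_eq)
      finally have "c mod p * Q + c div p * q = c * Q" .
      then show ?thesis by (simp add: zs_shift)
    qed
    ultimately show ?thesis by (simp add: o_def)
  qed
  ultimately show ?thesis by (simp add: cc_def tcode_def enc_append)
qed

end

section \<open>Density of primes in the sampling ranges, and sizes of the parameters\<close>

text \<open>Up to \<open>l ^ 2 * Y\<close> about a fraction \<open>1 / (2 * l)\<close> of the
  numbers is prime. Discarding those below \<open>Y\<close> costs at most \<open>Y\<close>, which is
  a fraction \<open>1 / l ^ 2\<close> of the range; hence the width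
  \<open>l ^ 2 * Y\<close>.\<close>

lemma card_window_primes:
  fixes Y l :: nat
  assumes Y: "1 \<le> Y" and l: "8 \<le> l" and b: "l ^ 2 * Y \<le> 2 ^ (2 * l)"
  shows "real (card {x. prime x \<and> Y \<le> x \<and> x < Y + l ^ 2 * Y}) \<ge> 1 / (8 * real l) * real (l ^ 2 * Y)"
proof -
  let ?N = "l ^ 2 * Y"
  let ?C = "{x. prime x \<and> Y \<le> x \<and> x < Y + l ^ 2 * Y}"
  have fin: "finite ?C" by (rule finite_subset[of _ "{..<Y + ?N}"]) auto
  have "{p. prime p \<and> p \<le> ?N} \<subseteq> {..<Y} \<union> ?C" using Y by auto
  then have "card {p. prime p \<and> p \<le> ?N} \<le> card ({..<Y} \<union> ?C)" using fin by (intro card_mono) auto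
  also have "\<dots> \<le> Y + card ?C" using card_Un_le[of "{..<Y}" ?C] by simp
  finally have c: "card {p. prime p \<and> p \<le> ?N} \<le> Y + card ?C" .
  have "?N \<le> 2 * l * card {p. prime p \<and> p \<le> ?N} + 2" by (rule card_primes_ge[OF b])
  also have "\<dots> \<le> 2 * l * (Y + card ?C) + 2" using c by (intro add_right_mono mult_left_mono) auto
  finally have "real ?N \<le> real (2 * l * (Y + card ?C) + 2)" by (rule of_nat_mono)
  then have r: "real l * (real l * real Y) \<le> 2 * real l * real Y + 2 * real l * real (card ?C) + 2"
    by (simp add: power2_eq_square algebra_simps)
  have "8 * (real l * real Y) \<le> real l * (real l * real Y)" using l by (intro mult_right_mono) auto
  moreover have "8 * 1 \<le> real l * real Y" using l Y by (intro mult_mono) auto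
  ultimately have "real l * (real l * real Y) / 4 \<le> 2 * real l * real (card ?C)" using r by linarith
  then have "real l * (real l * real Y / 8) \<le> real l * real (card ?C)" by simp
  then have "real l * real Y / 8 \<le> real (card ?C)" using l by (simp add: mult_le_cancel_left)
  then show ?thesis using l by (simp add: power2_eq_square field_simps)
qed

context par begin

lemma l_le_n: "k \<le> 60 \<Longrightarrow> l ^ k \<le> n"
  using power_increasing[of k 60 l] big l_pos by linarith

text \<open>Origin of the exponent 60: the cube of \<open>L * l ^ 20\<close> is
  \<open>L ^ 3 * l ^ 60\<close>, a product of two factors that are each at most
  \<open>n\<close>.\<close>

lemma Ll_le: "k \<le> 20 \<Longrightarrow> L * l ^ k \<le> n"
proof -
  assume k: "k \<le> 20"
  have "(L * l ^ 20) ^ 3 = L ^ 3 * l ^ 60" by (simp add: power_mult_distrib flip: power_mult)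
  also have "\<dots> \<le> n * n" using L3_le_n big by (rule mult_mono) auto
  also have "\<dots> \<le> n * (n * n)" using n_pos by simp
  also have "\<dots> = n ^ 3" by (simp add: power3_eq_cube)
  finally have "L * l ^ 20 \<le> n" using power_mono_iff[of "L * l ^ 20" n 3] by simp
  moreover have "L * l ^ k \<le> L * l ^ 20" using k l_pos by (intro mult_left_mono power_increasing) auto
  ultimately show ?thesis by linarith
qed

lemma D_le_n: "D \<le> n" using D_le_m mn by simp

lemma YQ_le: "l ^ 2 * YQ \<le> n ^ 2"
proof -
  have "l ^ 2 * YQ = mu * (L * l ^ 5)" by (simp add: YQ_def eval_nat_numeral algebra_simps)
  also have "\<dots> \<le> n * n" using mu_le D_le_n Ll_le[of 5] by (intro mult_mono) auto
  finally show ?thesis by (simp add: power2_eq_square)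
qed

lemma Yp_le: "l ^ 2 * Yp \<le> n ^ 2"
proof -
  have "l ^ 2 * Yp = (D div mu) * l ^ 5" by (simp add: Yp_def eval_nat_numeral algebra_simps)
  also have "\<dots> \<le> n * n" using D_le_n l_le_n[of 5] le_trans[OF div_le_dividend[of D mu]] by (intro mult_mono) auto
  finally show ?thesis by (simp add: power2_eq_square)
qed

lemma Yi_le: "l ^ 2 * Yi \<le> n ^ 2"
proof -
  have "m div D + 1 \<le> n + 1" using mn div_le_dividend[of m D] by linarith
  also have "\<dots> \<le> l * n" using l1000 n_pos mult_le_mono1[of 2 l n] by linarith
  finally have "l ^ 2 * Yi \<le> l ^ 2 * (L * (l * n) * l ^ 6)" unfolding Yi_def
    by (intro mult_left_mono mult_right_mono) auto
  also have "\<dots> = (L * l ^ 9) * n" by (simp add: eval_nat_numeral algebra_simps)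
  also have "\<dots> \<le> n * n" using Ll_le[of 9] by (intro mult_mono) auto
  finally show ?thesis by (simp add: power2_eq_square)
qed

lemma n_pow_le_w: "k \<le> 8 \<Longrightarrow> n ^ k \<le> 2 ^ w"
  using power_increasing[of k 8 n] n_pos wn by linarith

lemma n2_le: "n ^ 2 \<le> 2 ^ (2 * l)"
  using power_mono[of n "2 ^ l" 2] l1 by (simp add: power_mult mult.commute flip: power_mult)

text \<open>One quantity bounds two failures: \<open>l ^ 3\<close> draws at prime density
  \<open>1 / (8 * l)\<close> all fail, and the jitter over gaps of length at most
  \<open>2 * D / l ^ 2\<close> misses \<open>D / 4\<close> residues. Both exponents come out as
  \<open>l ^ 2 / 16\<close>.\<close>

definition "eps = exp (- (real l)\<^sup>2 / 16)"

lemma eps_le: "eps \<le> 1 / real n ^ 4"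
proof -
  have "4 * real l \<le> (real l)\<^sup>2 / 16" using l1000 mult_right_mono[of 64 "real l" "real l"] by (simp add: power2_eq_square)
  then have "eps \<le> exp (- (4 * real l))" by (simp add: eps_def)
  also have "\<dots> = 1 / exp (real l) ^ 4" by (simp add: exp_minus field_simps flip: exp_of_nat_mult)
  also have "\<dots> \<le> 1 / real n ^ 4"
  proof -
    have "real n \<le> 2 ^ l" using l1 by (metis less_imp_le of_nat_le_iff of_nat_numeral of_nat_power)
    also have "\<dots> \<le> exp 1 ^ l" using exp_ge_add_one_self[of 1] by (intro power_mono) auto
    also have "\<dots> = exp (real l)" by (simp flip: exp_of_nat_mult)
    finally show ?thesis using n_pos by (intro divide_left_mono power_mono) auto
  qed
  finally show ?thesis .
qed

lemma eps_le_Y: "l ^ 2 * Y \<le> n ^ 2 \<Longrightarrow> 0 < Y \<Longrightarrow> eps \<le> (real l)\<^sup>2 / real Y"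
proof -
  assume Y: "l ^ 2 * Y \<le> n ^ 2" "0 < Y"
  have "1 * Y \<le> l ^ 2 * Y" using l_pos by (intro mult_right_mono) auto
  then have "Y \<le> n ^ 2" using Y by linarith
  also have "\<dots> \<le> n ^ 4" using n_pos by (intro power_increasing) auto
  finally have "real Y \<le> real n ^ 4" by (metis of_nat_le_iff of_nat_power)
  then have "1 / real n ^ 4 \<le> 1 / real Y" using Y n_pos by (intro divide_left_mono) auto
  also have "\<dots> \<le> (real l)\<^sup>2 / real Y" using l1000 by (intro divide_right_mono) (auto simp: one_le_power)
  finally show ?thesis using eps_le by linarith
qed

lemma eps_le_L: "eps \<le> 1 / (16 * real L)"
proof -
  have "16 * L \<le> L * l" using l1000 by simp
  also have "\<dots> \<le> n" using Ll_le[of 1] by simp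
  also have "\<dots> \<le> n ^ 4" using n_pos by (simp add: self_le_power)
  finally have "16 * real L \<le> real n ^ 4" by (metis (mono_tags) of_nat_le_iff of_nat_power of_nat_mult of_nat_numeral)
  then have "1 / real n ^ 4 \<le> 1 / (16 * real L)" using L_ge1 n_pos by (intro divide_left_mono) auto
  then show ?thesis using eps_le by linarith
qed

lemma prob_pick:
  assumes fin: "finite A" and sub: "(\<lambda>t. off + t) ` {..<l ^ 3} \<subseteq> A"
    and Y: "0 < Y" "l ^ 2 * Y \<le> n ^ 2" and N: "0 < N" "N < 2 ^ r"
  shows "measure_pmf.prob (Pi_pmf A 0 (\<lambda>_. word_pmf w)) {f. pick Y (l ^ 2 * Y) (\<lambda>t. f (off + t)) (l ^ 3) dvd N}
     \<le> 2 * real r * real l / real Y + eps"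
proof -
  have "measure_pmf.prob (Pi_pmf A 0 (\<lambda>_. word_pmf w)) {f. pick Y (l ^ 2 * Y) (\<lambda>t. f (off + t)) (l ^ 3) dvd N}
     \<le> 2 * real r * real (l ^ 3) / real (l ^ 2 * Y) + exp (- (1 / (8 * real l)) * real (l ^ 3) / 2)"
  proof (rule prob_pick_dvd[OF fin sub _ _ N])
    show "0 < l ^ 2 * Y" using Y l_pos by simp
    show "l ^ 2 * Y \<le> 2 ^ w" using Y n_pow_le_w[of 2] by linarith
    show "1 / (8 * real l) * real (l ^ 2 * Y) \<le> real (card {x. prime x \<and> Y \<le> x \<and> x < Y + l ^ 2 * Y})"
      using Y l1000 n2_le by (intro card_window_primes) auto
    show "0 < 1 / (8 * real l)" using l_pos by simp
  qed
  also have "2 * real r * real (l ^ 3) / real (l ^ 2 * Y) = 2 * real r * real l / real Y"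
    using l_pos by (simp add: eval_nat_numeral)
  also have "exp (- (1 / (8 * real l)) * real (l ^ 3) / 2) = eps"
    using l_pos by (simp add: eps_def eval_nat_numeral)
  finally show ?thesis .
qed

text \<open>Round \<open>\<kappa>\<close> reads its own block of \<open>tb\<close> tape words: three
  runs of \<open>l ^ 3\<close> draws, then the jitter. Cutting \<open>uk\<close> off at the end of
  the block makes a round depend on that block alone.\<close>

definition "Qk \<omega> \<kappa> = pick YQ (l ^ 2 * YQ) (\<lambda>t. \<omega> (\<kappa> * tb + t)) (l ^ 3)"
definition "pk \<omega> \<kappa> = pick Yp (l ^ 2 * Yp) (\<lambda>t. \<omega> (\<kappa> * tb + l ^ 3 + t)) (l ^ 3)"
definition "ik \<omega> \<kappa> = pick Yi (l ^ 2 * Yi) (\<lambda>t. \<omega> (\<kappa> * tb + 2 * l ^ 3 + t)) (l ^ 3)"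
definition "uk \<omega> \<kappa> k = (if k < tb - 3 * l ^ 3 then \<omega> (\<kappa> * tb + 3 * l ^ 3 + k) else 0)"
definition "hitk \<omega> \<kappa> i \<longleftrightarrow> hit (Qk \<omega> \<kappa>) (pk \<omega> \<kappa>) (ik \<omega> \<kappa>) (uk \<omega> \<kappa>) i"

lemma inst_k: "inst w n m l D L T P \<delta> (Qk \<omega> \<kappa>) (pk \<omega> \<kappa>) (ik \<omega> \<kappa>)"
  using pick_bounds[of "l ^ 2 * YQ" YQ] pick_bounds[of "l ^ 2 * Yp" Yp] pick_bounds[of "l ^ 2 * Yi" Yi] Y_pos l_pos
  by unfold_locales (auto simp: Qk_def pk_def ik_def)

definition "pairs J = {(a, b). a \<in> J \<and> b \<in> J \<and> a < (b::nat)}"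
definition "coll J q = {z \<in> pairs J. q dvd (snd z - fst z)}"

end

context inst begin

text \<open>\<open>J0\<close> keeps the mismatches inside the common window, and \<open>Cl\<close>
  their residues in the sampled part of the period: the set that the jitter has to hit.\<close>

definition "J0 J i = {j \<in> J. H - 1 \<le> j + i mod Q mod H \<and> j + i mod Q mod H < m}"
definition "Cl J i = (\<lambda>j. (j + i mod Q) mod q) ` J0 J i \<inter> {..<S * g}"

lemma hit_cases:
  assumes "i \<in> locations P T" "J \<subseteq> {j. j < m \<and> P ! j \<noteq> T ! (i + j)}" "k < S" "vv u k \<in> Cl J i"
  shows "tcode Q p u (i div Q) (i mod Q div H) \<noteq> pcode Q p u (i mod Q div H) (i mod Q mod H)"
proof -
  obtain j where j: "j \<in> J0 J i" "vv u k = (j + i mod Q) mod q" using assms(4) by (auto simp: Cl_def)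
  then show ?thesis using assms by (intro codes_differ[of i j k]) (auto simp: J0_def)
qed

text \<open>Three kinds of loss, each at most a quarter of \<open>D\<close>: positions at the window
  ends, positions with a repeated residue, and residues beyond the last whole gap.\<close>

lemma card_Cl:
  assumes J: "J \<subseteq> {..<m}" "card J = D" and c: "4 * card (coll J q) < D"
  shows "D \<le> 4 * card (Cl J i)"
proof -
  have fin: "finite J" using J finite_subset by auto
  let ?f = "\<lambda>j. (j + i mod Q) mod q"
  define y where "y = i mod Q mod H"
  have y: "y < H" unfolding y_def using H_ge1 by simp
  \<comment> \<open>The left end loses \<open>H - 1 - y\<close> positions and the right end
    \<open>y\<close>; the total does not depend on \<open>y\<close>.\<close>
  have lost: "J - J0 J i \<subseteq> {..<H - 1 - y} \<union> {m - y..<m}" using J(1) by (auto simp: J0_def y_def)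
  have "card J - card (J0 J i) \<le> card (J - J0 J i)" using fin by (intro diff_card_le_card_Diff) (auto simp: J0_def)
  also have "\<dots> \<le> card ({..<H - 1 - y} \<union> {m - y..<m})" using lost by (intro card_mono) auto
  also have "\<dots> \<le> (H - 1 - y) + y" using card_Un_le[of "{..<H - 1 - y}" "{m - y..<m}"] by simp
  also have "\<dots> = H - 1" using y by simp
  finally have 1: "D \<le> card (J0 J i) + (H - 1)" using J by linarith
  have "coll J q = {(a, b) \<in> {(a, b). a \<in> J \<and> b \<in> J \<and> a < b}. q dvd (b - a)}"
    by (auto simp: coll_def pairs_def)
  then have 2: "card (J0 J i) \<le> card (?f ` J0 J i) + card (coll J q)"
    using card_residues_ge[OF fin, of "J0 J i" "i mod Q" q] by (auto simp: J0_def)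
  have finI: "finite (?f ` J0 J i)" using fin by (simp add: J0_def)
  have "?f ` J0 J i \<subseteq> Cl J i \<union> {S * g..<q}" using Q_pos by (auto simp: Cl_def)
  then have "card (?f ` J0 J i) \<le> card (Cl J i \<union> {S * g..<q})" using finI by (intro card_mono) (auto simp: Cl_def)
  also have "\<dots> \<le> card (Cl J i) + (q - S * g)" using card_Un_le[of "Cl J i" "{S * g..<q}"] by simp
  finally have 3: "card (?f ` J0 J i) \<le> card (Cl J i) + (q - S * g)" .
  \<comment> \<open>The uncovered remainder is \<open>q mod g\<close>: zero for
    \<open>g = 1\<close>, and otherwise below \<open>g\<close>, which is much smaller than
    \<open>D\<close>.\<close>
  have 4: "4 * (q - S * g) \<le> D"
  proof (cases "g = 1")
    case True then show ?thesis by (simp add: SS_def)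
  next
    case False
    have "q - S * g = q mod g" by (simp add: SS_def minus_div_mult_eq_mod)
    then have "q - S * g < g" using g_ge1 by simp
    moreover have "1 \<le> D div l ^ 2" using False by (simp add: g_def Suc_le_eq)
    moreover have "8 * (D div l ^ 2) \<le> D"
    proof -
      have "8 \<le> l ^ 2" using l1000 self_le_power[of l 2] by linarith
      then have "8 * (D div l ^ 2) \<le> l ^ 2 * (D div l ^ 2)" by (rule mult_right_mono) simp
      also have "\<dots> \<le> D" by simp
      finally show ?thesis .
    qed
    ultimately show ?thesis by (simp add: g_def)
  qed
  show ?thesis using 1 2 3 4 c H_le(1) by linarith
qed

end

section \<open>Probability that a distant location survives a round, and all rounds\<close>

context par begin

abbreviation "tape A \<equiv> Pi_pmf A (0::nat) (\<lambda>_. word_pmf w)"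

definition "block \<kappa> = {\<kappa> * tb..<\<kappa> * tb + tb}"

lemma L3_le: "3 * l ^ 3 + 4 * L * l ^ 12 \<le> tb"
proof -
  have "3 * l ^ 3 \<le> 3 * (L * l ^ 12)"
    using L_ge1 l_pos mult_mono[of 1 L "l ^ 3" "l ^ 12"] power_increasing[of 3 12 l] by simp
  moreover have "7 * (L * l ^ 12) \<le> l * (L * l ^ 12)" using l1000 by (intro mult_right_mono) auto
  moreover have "l * (L * l ^ 12) = tb" by (simp add: tb_def eval_nat_numeral algebra_simps)
  ultimately show ?thesis by linarith
qed

end

context inst begin

lemma Q_le: "Q \<le> 2 * l ^ 2 * YQ" and p_le: "p \<le> 2 * l ^ 2 * Yp" and pm_le: "pm \<le> 2 * l ^ 2 * Yi"
proof -
  have "Y + l ^ 2 * Y \<le> 2 * l ^ 2 * Y" for Y using l_pos by simp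
  then show "Q \<le> 2 * l ^ 2 * YQ" "p \<le> 2 * l ^ 2 * Yp" "pm \<le> 2 * l ^ 2 * Yi"
    using Qb pb ib by (meson less_imp_le order_trans)+
qed

lemma D_le_g: "D \<le> l ^ 2 * g"
proof -
  have "D = D div l ^ 2 * l ^ 2 + D mod l ^ 2" by (rule div_mult_mod_eq[symmetric])
  also have "\<dots> \<le> D div l ^ 2 * l ^ 2 + l ^ 2" using l_pos by (intro add_left_mono less_imp_le) simp
  finally show ?thesis by (simp add: g_def algebra_simps)
qed

lemma q_le: "q \<le> 4 * l ^ 10 * L * D"
proof -
  have "q \<le> (2 * l ^ 2 * YQ) * (2 * l ^ 2 * Yp)" using Q_le p_le by (rule mult_mono) auto
  also have "\<dots> = 4 * l ^ 4 * (YQ * Yp)" by (simp add: eval_nat_numeral algebra_simps)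
  also have "\<dots> = 4 * l ^ 10 * L * D" unfolding YQYp by (simp add: eval_nat_numeral algebra_simps)
  finally show ?thesis .
qed

lemma S_le: "S \<le> 4 * L * l ^ 12"
proof -
  have "q \<le> (4 * l ^ 10 * L) * (l ^ 2 * g)" using q_le mult_left_mono[OF D_le_g, of "4 * l ^ 10 * L"] by linarith
  also have "\<dots> = (4 * L * l ^ 12) * g" by (simp add: eval_nat_numeral algebra_simps)
  finally have "q div g \<le> (4 * L * l ^ 12) * g div g" by (rule div_le_mono)
  then show ?thesis using g_ge1 by (simp add: SS_def)
qed

lemma len_le2: "ee h - ss h \<le> 2 * l ^ 2 * (m div D + 1)"
proof -
  have "m div g \<le> l ^ 2 * (m div D + 1)"
  proof -
    have "m mod D < D" using D_ge1 by simp
    then have "m \<le> (m div D + 1) * D"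
      using div_mult_mod_eq[of m D] unfolding ring_distribs by linarith
    also have "\<dots> \<le> (m div D + 1) * (l ^ 2 * g)" using D_le_g by (rule mult_left_mono) simp
    also have "\<dots> = (l ^ 2 * (m div D + 1)) * g" by (simp add: algebra_simps)
    finally have "m div g \<le> (l ^ 2 * (m div D + 1)) * g div g" by (rule div_le_mono)
    then show ?thesis using g_ge1 by simp
  qed
  moreover have "2 * 1 \<le> l ^ 2 * (m div D + 1)" using l1000 self_le_power[of l 2] by (intro mult_mono) auto
  ultimately show ?thesis using len_le[of h] by linarith
qed

text \<open>The case \<open>g = 1\<close> is separate because \<open>g\<close> is then not bounded
  by \<open>2 * D / l ^ 2\<close>. Without jitter every residue below \<open>S\<close> is sampled,
  so a nonempty \<open>Cl\<close> is hit with certainty.\<close>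

lemma no_hit_bound:
  assumes "D \<le> 4 * card (Cl J i)" and A: "finite A" "(\<lambda>k. off + k) ` {..<S} \<subseteq> A"
  shows "measure_pmf.prob (tape A) {f. \<forall>k<S. vv (\<lambda>k. f (off + k)) k \<notin> Cl J i} \<le> eps"
proof (cases "g = 1")
  case True
  have "Cl J i \<noteq> {}" using assms(1) D_ge1 by auto
  moreover have "Cl J i \<subseteq> {..<S}" using True by (auto simp: Cl_def)
  ultimately have "\<exists>k<S. vv (\<lambda>k. f (off + k)) k \<in> Cl J i" for f using True by (auto simp: vv_def)
  then have "{f. \<forall>k<S. vv (\<lambda>k. f (off + k)) k \<notin> Cl J i} = {}" by auto
  then show ?thesis by (simp only: measure_empty) (simp add: eps_def)
next
  case False
  have "measure_pmf.prob (tape A) {f. \<forall>k<S. k * g + f (off + k) mod g \<notin> Cl J i} \<le> exp (- real (card (Cl J i)) / (2 * real g))"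
  proof (rule prob_no_hit[OF A])
    have "g \<le> 2 * n" using D_le_n g_ge1 n_pos div_le_dividend[of D "l ^ 2"] unfolding g_def by linarith
    also have "\<dots> \<le> n ^ 2" using l_le_n[of 1] l1000 by (simp add: power2_eq_square)
    also have "\<dots> \<le> 2 ^ w" by (rule n_pow_le_w) simp
    finally show "g \<le> 2 ^ w" .
  qed (use g_ge1 in \<open>auto simp: Cl_def\<close>)
  also have "\<dots> \<le> eps"
  proof -
    have "1 \<le> D div l ^ 2" using False by (simp add: g_def Suc_le_eq)
    then have "g \<le> 2 * (D div l ^ 2)" by (simp add: g_def)
    then have "l ^ 2 * g \<le> l ^ 2 * (2 * (D div l ^ 2))" by (rule mult_left_mono) simp
    also have "\<dots> = 2 * (l ^ 2 * (D div l ^ 2))" by simp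
    also have "\<dots> \<le> 2 * D" by (intro mult_left_mono) simp_all
    also have "\<dots> \<le> 8 * card (Cl J i)" using assms(1) by simp
    finally have "real (l ^ 2 * g) \<le> real (8 * card (Cl J i))" by (rule of_nat_mono)
    then have "(real l)\<^sup>2 * real g \<le> 8 * real (card (Cl J i))" by simp
    then have "(real l)\<^sup>2 / 16 \<le> real (card (Cl J i)) / (2 * real g)" using g_ge1 by (simp add: field_simps)
    then show ?thesis by (simp add: eps_def)
  qed
  finally show ?thesis by (simp add: vv_def)
qed

end

context par begin

text \<open>A colliding difference is divisible by both \<open>Q\<close> and \<open>p\<close>, which
  read disjoint parts of the tape, so the two bounds multiply to about \<open>1 / (L * D)\<close>.
  Markov's inequality over at most \<open>D ^ 2\<close> pairs with threshold \<open>D / 4\<close>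
  leaves order \<open>1 / L\<close>.\<close>

lemma prob_coll:
  assumes fin: "finite A" and A: "block \<kappa> \<subseteq> A" and J: "J \<subseteq> {..<m}" "card J = D"
  shows "measure_pmf.prob (tape A) {f. D \<le> 4 * card (coll J (Qk f \<kappa> * pk f \<kappa>))} \<le> 1 / (8 * real L)"
proof -
  let ?P = "measure_pmf.prob (tape A)"
  let ?BQ = "(\<lambda>t. \<kappa> * tb + t) ` {..<l ^ 3}" and ?Bp = "(\<lambda>t. \<kappa> * tb + l ^ 3 + t) ` {..<l ^ 3}"
  have subQ: "?BQ \<subseteq> A" and subp: "?Bp \<subseteq> A" using A L3_le by (auto simp: block_def)
  have finJ: "finite J" using J finite_subset by auto
  have bnd: "?P {f. Qk f \<kappa> * pk f \<kappa> dvd N} \<le> 9 / (real L * real D * (real l)\<^sup>2)" if N: "0 < N" "N < n" for N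
  proof -
    have N2: "N < 2 ^ l" using N l1 by simp
    have b1: "measure_pmf.prob (tape ?BQ) {f. Qk (\<lambda>x. if x \<in> ?BQ then f x else g' x) \<kappa> dvd N} \<le> 3 * (real l)\<^sup>2 / real YQ" for g'
    proof -
      have "Qk (\<lambda>x. if x \<in> ?BQ then f x else g' x) \<kappa> = Qk f \<kappa>" for f
        unfolding Qk_def by (rule pick_cong) auto
      then have "measure_pmf.prob (tape ?BQ) {f. Qk (\<lambda>x. if x \<in> ?BQ then f x else g' x) \<kappa> dvd N} \<le> 2 * real l * real l / real YQ + eps"
        using prob_pick[of ?BQ "\<kappa> * tb" YQ N l] Y_pos YQ_le N(1) N2 by (simp add: Qk_def)
      also have "\<dots> \<le> 3 * (real l)\<^sup>2 / real YQ" using eps_le_Y[OF YQ_le] Y_pos by (simp add: power2_eq_square field_simps)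
      finally show ?thesis .
    qed
    have b2: "?P {f. pk f \<kappa> dvd N} \<le> 3 * (real l)\<^sup>2 / real Yp"
    proof -
      have "?P {f. pk f \<kappa> dvd N} \<le> 2 * real l * real l / real Yp + eps"
        using prob_pick[OF fin subp Y_pos(2) Yp_le N(1) N2] by (simp add: pk_def)
      also have "\<dots> \<le> 3 * (real l)\<^sup>2 / real Yp" using eps_le_Y[OF Yp_le] Y_pos by (simp add: power2_eq_square field_simps)
      finally show ?thesis .
    qed
    have "?P {f. Qk f \<kappa> * pk f \<kappa> dvd N} \<le> ?P {f. Qk f \<kappa> dvd N \<and> pk f \<kappa> dvd N}"
      by (intro measure_pmf.finite_measure_mono) (auto dest: dvd_mult_left dvd_mult_right)
    \<comment> \<open>Independence: the draws of \<open>Q\<close> are fresh once the event about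
      \<open>p\<close>, which does not read them, is fixed.\<close>
    also have "\<dots> \<le> 3 * (real l)\<^sup>2 / real YQ * ?P {f. pk f \<kappa> dvd N}"
    proof (rule prob_Pi_pmf_cond[OF fin subQ b1])
      fix f f' :: "nat \<Rightarrow> nat"
      assume "\<And>x. x \<in> A - ?BQ \<Longrightarrow> f x = f' x" "\<And>x. x \<notin> A \<Longrightarrow> f x = f' x" and d: "pk f \<kappa> dvd N"
      then have e: "f x = f' x" if "x \<notin> ?BQ" for x using that by blast
      have "f (\<kappa> * tb + l ^ 3 + t) = f' (\<kappa> * tb + l ^ 3 + t)" for t by (rule e) auto
      then have "pk f \<kappa> = pk f' \<kappa>" unfolding pk_def by (intro pick_cong)
      then show "pk f' \<kappa> dvd N" using d by simp
    qed
    also have "\<dots> \<le> 3 * (real l)\<^sup>2 / real YQ * (3 * (real l)\<^sup>2 / real Yp)"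
      by (intro mult_left_mono b2) auto
    also have "\<dots> = 9 * real l ^ 4 / real (YQ * Yp)" by (simp add: power2_eq_square eval_nat_numeral)
    also have "\<dots> = 9 / (real L * real D * (real l)\<^sup>2)"
      unfolding YQYp using l_pos L_ge1 D_ge1 by (simp add: eval_nat_numeral)
    finally show ?thesis .
  qed
  have finP: "finite (pairs J)" by (rule finite_subset[of _ "J \<times> J"]) (use finJ in \<open>auto simp: pairs_def\<close>)
  have cP: "card (pairs J) \<le> D ^ 2"
    using card_mono[of "J \<times> J" "pairs J"] finJ J by (auto simp: pairs_def card_cartesian_product power2_eq_square)
  have "?P {f. D \<le> 4 * card (coll J (Qk f \<kappa> * pk f \<kappa>))}
      = ?P {f. real D / 4 \<le> real (card {z \<in> pairs J. Qk f \<kappa> * pk f \<kappa> dvd (snd z - fst z)})}"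
  proof -
    have "D \<le> 4 * c \<longleftrightarrow> real D / 4 \<le> real c" for c by linarith
    then show ?thesis by (simp add: coll_def)
  qed
  also have "\<dots> \<le> real (card (pairs J)) * (9 / (real L * real D * (real l)\<^sup>2)) / (real D / 4)"
  proof (rule prob_card_ge[OF finP])
    fix z assume "z \<in> pairs J"
    then have "0 < snd z - fst z" "snd z - fst z < n" using J mn by (auto simp: pairs_def)
    then show "?P {f. Qk f \<kappa> * pk f \<kappa> dvd (snd z - fst z)} \<le> 9 / (real L * real D * (real l)\<^sup>2)" by (rule bnd)
  qed (use D_ge1 in simp)
  also have "\<dots> \<le> real (D ^ 2) * (9 / (real L * real D * (real l)\<^sup>2)) / (real D / 4)"
    using cP by (intro divide_right_mono mult_right_mono) auto
  also have "\<dots> = 36 / (real L * (real l)\<^sup>2)" using D_ge1 by (simp add: power2_eq_square field_simps)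
  \<comment> \<open>\<open>288 = 36 * 8\<close> produces the constant \<open>1 / 8\<close>.\<close>
  also have "\<dots> \<le> 36 / (real L * 288)"
  proof -
    have "288 \<le> l ^ 2" using l1000 self_le_power[of l 2] by linarith
    then have "288 \<le> (real l)\<^sup>2" by (metis of_nat_le_iff of_nat_numeral of_nat_power)
    moreover have "0 < (real l)\<^sup>2" "0 < real L" using l_pos L_ge1 by auto
    ultimately show ?thesis by (intro divide_left_mono mult_left_mono mult_pos_pos) auto
  qed
  finally show ?thesis by simp
qed

text \<open>A false hit needs too many collisions of mismatches modulo \<open>Q * p\<close>
  (\<open>E1\<close>), or a jitter that misses all remaining residues (\<open>E2\<close>), or
  distinct codes that agree modulo the third prime (\<open>E3\<close>). The first costs
  \<open>1 / (8 * L)\<close>, the last \<open>1 / (16 * L) + eps\<close>, the second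
  \<open>eps\<close>.\<close>

lemma prob_hit_le:
  assumes fin: "finite A" and A: "block \<kappa> \<subseteq> A"
    and i: "i \<in> locations P T" "i \<notin> close_locations P T \<delta>"
  shows "measure_pmf.prob (tape A) {f. hitk f \<kappa> i} \<le> 1 / (2 * real L)"
proof -
  let ?P = "measure_pmf.prob (tape A)"
  have far: "\<delta> * real m < real (ham_at P T i)" using i by (simp add: close_locations_def lenP)
  have "D \<le> ham_at P T i"
  proof (cases "D = 1")
    case True
    have "0 < \<delta> * real m" using d0 m1 by simp
    then have "0 < ham_at P T i" using far by linarith
    then show ?thesis using True by simp
  next
    case False then show ?thesis using Dlow far by linarith
  qed
  then have "D \<le> card {j. j < m \<and> P ! j \<noteq> T ! (i + j)}" by (simp add: ham_at_def lenP)
  \<comment> \<open>Exactly \<open>D\<close> mismatches are kept, so that the number of pairs and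
    the accounting of losses refer to \<open>D\<close> and not to the unknown Hamming
    distance.\<close>
  then obtain J where J: "J \<subseteq> {j. j < m \<and> P ! j \<noteq> T ! (i + j)}" "card J = D"
    by (rule obtain_subset_with_card_n)
  have Jm: "J \<subseteq> {..<m}" using J by auto
  let ?t = "\<lambda>f. tcode (Qk f \<kappa>) (pk f \<kappa>) (uk f \<kappa>) (i div Qk f \<kappa>) (i mod Qk f \<kappa> div H)"
  let ?p = "\<lambda>f. pcode (Qk f \<kappa>) (pk f \<kappa>) (uk f \<kappa>) (i mod Qk f \<kappa> div H) (i mod Qk f \<kappa> mod H)"
  let ?Cl = "\<lambda>f. inst.Cl m l D L (Qk f \<kappa>) (pk f \<kappa>) J i"
  let ?S = "\<lambda>f. SS (Qk f \<kappa>) (pk f \<kappa>)"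
  define E1 where "E1 f \<longleftrightarrow> D \<le> 4 * card (coll J (Qk f \<kappa> * pk f \<kappa>))" for f
  define E2 where "E2 f \<longleftrightarrow> D \<le> 4 * card (?Cl f) \<and> (\<forall>k<?S f. vv (uk f \<kappa>) k \<notin> ?Cl f)" for f
  define E3 where "E3 f \<longleftrightarrow> ?t f \<noteq> ?p f \<and> ?t f mod ik f \<kappa> = ?p f mod ik f \<kappa>" for f
  have cover: "{f. hitk f \<kappa> i} \<subseteq> {f. E1 f} \<union> ({f. E2 f} \<union> {f. E3 f})"
  proof
    fix f assume f: "f \<in> {f. hitk f \<kappa> i}"
    interpret inst w n m l D L T P \<delta> "Qk f \<kappa>" "pk f \<kappa>" "ik f \<kappa>" "uk f \<kappa>" by (rule inst_k)
    show "f \<in> {f. E1 f} \<union> ({f. E2 f} \<union> {f. E3 f})"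
      using card_Cl[OF Jm J(2), of i] hit_cases[OF i(1) J(1)] f
      by (auto simp: E1_def E2_def E3_def hitk_def hit_def not_le)
  qed
  have "?P {f. hitk f \<kappa> i} \<le> ?P ({f. E1 f} \<union> ({f. E2 f} \<union> {f. E3 f}))"
    using cover by (intro measure_pmf.finite_measure_mono) auto
  also have "\<dots> \<le> ?P {f. E1 f} + ?P ({f. E2 f} \<union> {f. E3 f})" by (intro measure_Un_le) auto
  also have "?P ({f. E2 f} \<union> {f. E3 f}) \<le> ?P {f. E2 f} + ?P {f. E3 f}" by (intro measure_Un_le) auto
  also have "?P {f. E1 f} \<le> 1 / (8 * real L)"
    unfolding E1_def by (rule prob_coll[OF fin A Jm J(2)])
  also have "?P {f. E2 f} \<le> eps"
  proof -
    \<comment> \<open>Only the jitter words are random here; with the others fixed,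
      \<open>Q\<close>, \<open>p\<close> and hence \<open>Cl\<close> are constants.\<close>
    let ?B = "(\<lambda>k. \<kappa> * tb + 3 * l ^ 3 + k) ` {..<tb - 3 * l ^ 3}"
    have sub: "?B \<subseteq> A" using A L3_le by (auto simp: block_def)
    show ?thesis
    proof (rule prob_Pi_pmf_le[OF fin sub])
      fix g' :: "nat \<Rightarrow> nat"
      let ?m = "\<lambda>(f :: nat \<Rightarrow> nat) x. if x \<in> ?B then f x else g' x"
      have Q: "Qk (?m f) \<kappa> = Qk g' \<kappa>" and p: "pk (?m f) \<kappa> = pk g' \<kappa>" for f
        unfolding Qk_def pk_def by (intro pick_cong; auto)+
      interpret inst w n m l D L T P \<delta> "Qk g' \<kappa>" "pk g' \<kappa>" "ik g' \<kappa>" "uk g' \<kappa>" by (rule inst_k)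
      have S: "S \<le> tb - 3 * l ^ 3" using S_le L3_le by linarith
      have u: "vv (uk (?m f) \<kappa>) k = vv (\<lambda>k. f (\<kappa> * tb + 3 * l ^ 3 + k)) k" if "k < S" for f k
        using that S by (auto simp: uk_def vv_def)
      show "measure_pmf.prob (tape ?B) {f. E2 (?m f)} \<le> eps"
      proof (cases "D \<le> 4 * card (Cl J i)")
        case True
        have "{f. E2 (?m f)} = {f. \<forall>k<S. vv (\<lambda>k. f (\<kappa> * tb + 3 * l ^ 3 + k)) k \<notin> Cl J i}"
          unfolding E2_def Q p using True u by simp
        moreover have "(\<lambda>k. \<kappa> * tb + 3 * l ^ 3 + k) ` {..<S} \<subseteq> ?B" using S by (intro image_mono) auto
        ultimately show ?thesis using no_hit_bound[OF True, of ?B "\<kappa> * tb + 3 * l ^ 3"] by simp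
      next
        case False
        then have "{f. E2 (?m f)} = {}" unfolding E2_def Q p by simp
        then show ?thesis by (simp add: eps_def)
      qed
    qed
  qed
  also have "?P {f. E3 f} \<le> 1 / (16 * real L) + eps"
  proof -
    let ?B = "(\<lambda>t. \<kappa> * tb + 2 * l ^ 3 + t) ` {..<l ^ 3}"
    have sub: "?B \<subseteq> A" using A L3_le by (auto simp: block_def)
    show ?thesis
    proof (rule prob_Pi_pmf_le[OF fin sub])
      fix g' :: "nat \<Rightarrow> nat"
      let ?m = "\<lambda>(f :: nat \<Rightarrow> nat) x. if x \<in> ?B then f x else g' x"
      have Q: "Qk (?m f) \<kappa> = Qk g' \<kappa>" and p: "pk (?m f) \<kappa> = pk g' \<kappa>" for f
        unfolding Qk_def pk_def by (intro pick_cong; auto)+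
      have u: "uk (?m f) \<kappa> = uk g' \<kappa>" for f by (auto simp: uk_def fun_eq_iff)
      have ii: "ik (?m f) \<kappa> = ik f \<kappa>" for f unfolding ik_def by (rule pick_cong) auto
      interpret inst w n m l D L T P \<delta> "Qk g' \<kappa>" "pk g' \<kappa>" "ik g' \<kappa>" "uk g' \<kappa>" by (rule inst_k)
      define a where "a = ?t g'"
      define b where "b = ?p g'"
      \<comment> \<open>Neither code depends on the third prime, so their absolute difference is a
        fixed number; the fingerprints agree only if the drawn prime divides it.\<close>
      define N where "N = (if a < b then b - a else a - b)"
      define h where "h = i mod Qk g' \<kappa> div H"
      show "measure_pmf.prob (tape ?B) {f. E3 (?m f)} \<le> 1 / (16 * real L) + eps"
      proof (cases "a = b")
        case True
        then have "{f. E3 (?m f)} = {}" unfolding E3_def Q p u by (simp add: a_def b_def)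
        then show ?thesis by (simp add: eps_def)
      next
        case False
        have N: "0 < N" "N < 2 ^ (w * (ee h - ss h))"
          using False tcode_lt[of "i div Qk g' \<kappa>" h] pcode_lt[of h "i mod Qk g' \<kappa> mod H"]
          by (auto simp: N_def a_def b_def h_def)
        have "{f. E3 (?m f)} \<subseteq> {f. ik f \<kappa> dvd N}"
          unfolding E3_def Q p u ii by (auto simp: N_def mod_eq_dvd_iff_nat simp flip: a_def b_def)
            (metis less_imp_le mod_eq_dvd_iff_nat)
        then have "measure_pmf.prob (tape ?B) {f. E3 (?m f)} \<le> measure_pmf.prob (tape ?B) {f. ik f \<kappa> dvd N}"
          by (intro measure_pmf.finite_measure_mono) auto
        also have "\<dots> \<le> 2 * real (w * (ee h - ss h)) * real l / real Yi + eps"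
          using prob_pick[of ?B "\<kappa> * tb + 2 * l ^ 3" Yi N "w * (ee h - ss h)"] Y_pos Yi_le N by (simp add: ik_def)
        also have "2 * real (w * (ee h - ss h)) * real l / real Yi \<le> 1 / (16 * real L)"
        proof -
          define k where "k = ee h - ss h"
          have k: "k \<le> 2 * l ^ 2 * (m div D + 1)" unfolding k_def by (rule len_le2)
          have "64 * L * (w * k * l) \<le> 64 * L * (l ^ 2 * (2 * l ^ 2 * (m div D + 1)) * l)"
            using wl k by (intro mult_left_mono mult_right_mono mult_mono) auto
          also have "\<dots> = 128 * (L * (m div D + 1) * l ^ 5)" by (simp add: eval_nat_numeral algebra_simps)
          also have "\<dots> \<le> l * (L * (m div D + 1) * l ^ 5)" using l1000 by (intro mult_right_mono) auto
          also have "\<dots> = Yi" by (simp add: Yi_def eval_nat_numeral algebra_simps)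
          finally have "real (64 * L * (w * k * l)) \<le> real Yi" by (rule of_nat_mono)
          then have "32 * real L * (2 * real (w * k) * real l) \<le> real Yi" by (simp add: algebra_simps)
          moreover have "0 \<le> 2 * real (w * k) * real l" by simp
          ultimately have "16 * real L * (2 * real (w * k) * real l) \<le> real Yi" by linarith
          then show ?thesis using Y_pos L_ge1 unfolding k_def[symmetric] by (simp add: field_simps)
        qed
        finally show ?thesis by simp
      qed
    qed
  qed
  also have "1 / (8 * real L) + (eps + (1 / (16 * real L) + eps)) \<le> 1 / (2 * real L)"
    using eps_le_L L_ge1 by (simp add: field_simps)
  finally show ?thesis by simp
qed

lemma hitk_cong:
  assumes "\<And>x. x \<in> block \<kappa> \<Longrightarrow> f x = f' x"
  shows "hitk f \<kappa> i = hitk f' \<kappa> i"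
proof -
  have e: "f (\<kappa> * tb + t) = f' (\<kappa> * tb + t)" if "t < tb" for t
    using assms[of "\<kappa> * tb + t"] that by (simp add: block_def)
  have b: "t < l ^ 3 \<Longrightarrow> l ^ 3 + t < tb" "t < l ^ 3 \<Longrightarrow> 2 * l ^ 3 + t < tb" "t < l ^ 3 \<Longrightarrow> t < tb"
    "t < tb - 3 * l ^ 3 \<Longrightarrow> 3 * l ^ 3 + t < tb" for t
    using L3_le by linarith+
  have "Qk f \<kappa> = Qk f' \<kappa>" "pk f \<kappa> = pk f' \<kappa>" "ik f \<kappa> = ik f' \<kappa>" "uk f \<kappa> = uk f' \<kappa>"
    using e b unfolding Qk_def pk_def ik_def uk_def
    by (auto intro!: pick_cong simp: fun_eq_iff add.assoc)
  then show ?thesis by (simp add: hitk_def)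
qed

text \<open>Rounds read disjoint blocks of the tape, so each round contributes a factor;
  \<open>1 / (2 * L)\<close> is weakened to \<open>1 / 2\<close>.\<close>

lemma prob_all_hits_le:
  assumes i: "i \<in> locations P T" "i \<notin> close_locations P T \<delta>"
  shows "\<kappa> \<le> \<nu> \<Longrightarrow> measure_pmf.prob (tape {..<\<nu> * tb}) {f. \<forall>\<kappa>'<\<kappa>. hitk f \<kappa>' i} \<le> (1 / 2) ^ \<kappa>"
proof (induction \<kappa>)
  case (Suc \<kappa>)
  let ?P = "measure_pmf.prob (tape {..<\<nu> * tb})"
  have "(\<kappa> + 1) * tb \<le> \<nu> * tb" using Suc.prems by (intro mult_right_mono) auto
  then have sub: "block \<kappa> \<subseteq> {..<\<nu> * tb}" by (auto simp: block_def)
  have half: "1 / (2 * real L) \<le> 1 / 2" using L_ge1 by (simp add: field_simps)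
  have "?P {f. \<forall>\<kappa>'<Suc \<kappa>. hitk f \<kappa>' i} = ?P {f. hitk f \<kappa> i \<and> (\<forall>\<kappa>'<\<kappa>. hitk f \<kappa>' i)}"
    by (intro arg_cong[of _ _ ?P]) (auto simp: less_Suc_eq)
  also have "\<dots> \<le> 1 / 2 * ?P {f. \<forall>\<kappa>'<\<kappa>. hitk f \<kappa>' i}"
  proof (rule prob_Pi_pmf_cond[OF _ sub])
    fix h :: "nat \<Rightarrow> nat"
    have "hitk (\<lambda>x. if x \<in> block \<kappa> then f x else h x) \<kappa> i = hitk f \<kappa> i" for f by (rule hitk_cong) auto
    then show "measure_pmf.prob (tape (block \<kappa>)) {f. hitk (\<lambda>x. if x \<in> block \<kappa> then f x else h x) \<kappa> i} \<le> 1 / 2"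
      using prob_hit_le[of "block \<kappa>" \<kappa> i] i half by (simp add: block_def)
  next
    fix f f' :: "nat \<Rightarrow> nat"
    assume e: "\<And>x. x \<in> {..<\<nu> * tb} - block \<kappa> \<Longrightarrow> f x = f' x" "\<And>x. x \<notin> {..<\<nu> * tb} \<Longrightarrow> f x = f' x"
      and h: "\<forall>\<kappa>'<\<kappa>. hitk f \<kappa>' i"
    have eq: "f x = f' x" if "x \<notin> block \<kappa>" for x using e that by blast
    show "\<forall>\<kappa>'<\<kappa>. hitk f' \<kappa>' i"
    proof (intro allI impI)
      fix \<kappa>' assume k: "\<kappa>' < \<kappa>"
      have "(\<kappa>' + 1) * tb \<le> \<kappa> * tb" using k by (intro mult_right_mono) auto
      then have "x \<notin> block \<kappa>" if "x \<in> block \<kappa>'" for x using that by (auto simp: block_def)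
      then have "hitk f \<kappa>' i = hitk f' \<kappa>' i" using eq by (intro hitk_cong) auto
      then show "hitk f' \<kappa>' i" using h k by auto
    qed
  qed simp
  also have "\<dots> \<le> 1 / 2 * (1 / 2) ^ \<kappa>" using Suc by (intro mult_left_mono) auto
  finally show ?case by simp
qed simp

end

section \<open>The program\<close>

abbreviation add_expr (infixl "[+]" 65) where "add_expr \<equiv> Bin Add"
abbreviation sub_expr (infixl "[-]" 65) where "sub_expr \<equiv> Bin Sub"
abbreviation mul_expr (infixl "[*]" 70) where "mul_expr \<equiv> Bin Mul"
abbreviation div_expr (infixl "['/]" 70) where "div_expr \<equiv> Bin Div"
abbreviation mod_expr (infixl "[%]" 70) where "mod_expr \<equiv> Bin Mod"
abbreviation less_expr (infix "[<]" 60) where "less_expr \<equiv> Bin Lt"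
abbreviation eq_expr (infix "[=]" 60) where "eq_expr \<equiv> Bin Eq"
abbreviation seq_com (infixr ";;" 55) where "seq_com \<equiv> Seq"

text \<open>Register plan: 0 to 17 hold the input sizes and derived parameters, 20 the round, 21 to
  29 the choices of the round, 30 to 34 the data of a block, 40 and above are scratch. Memory plan,
  in segments of \<open>n ^ 3\<close> words: tape, chains, bucket successors, marks, then one table
  of bucket heads per block. Primality is tested by naive trial division, affordable because the
  ranges are themselves within the time bound.\<close>

definition pick_com :: "nat \<Rightarrow> nat \<Rightarrow> com" where
  "pick_com y out = Assign out (Reg y) ;;
     For 41 (Reg 11)
       (Assign 42 (Reg y [+] Mem (Reg 40 [+] Reg 41) [%] (Reg 12 [*] Reg y)) ;;
        Assign 43 (Const 1) ;; Assign 44 (Const 2) ;;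
        While (Reg 44 [<] Reg 42)
          (Cond (Reg 42 [%] Reg 44 [=] Const 0) (Assign 43 (Const 0)) Skip ;;
           Assign 44 (Reg 44 [+] Const 1)) ;;
        Cond (Reg 43) (Assign out (Reg 42)) Skip)"

text \<open>Evaluates \<open>zs\<close> at the index in register 45, reading the jitter directly
  from the tape; no list of positions is stored.\<close>

definition pos_expr :: expr where
  "pos_expr = (Reg 45 [/] Reg 24) [*] Reg 28 [+] ((Reg 45 [%] Reg 24) [*] Reg 7
     [+] Mem (Reg 25 [+] Reg 45 [%] Reg 24) [%] Reg 7)"

definition chain_pos :: expr where
  "chain_pos = Reg 40 [*] Reg 21 [+] pos_expr"

text \<open>Chain \<open>c0\<close> occupies a row of \<open>2 * n\<close> words in the second
  segment, entry \<open>b\<close> being the fingerprint of its first \<open>b\<close> samples. A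
  chain has at most \<open>n\<close> samples, so rows do not overlap.\<close>

definition chain_com :: com where
  "chain_com = For 40 (Reg 22)
     (Assign 41 (Reg 15 [+] Reg 40 [*] Reg 16) ;; Store (Reg 41) (Const 0) ;;
      Assign 42 (Const 0) ;; Assign 45 (Const 0) ;;
      While (chain_pos [<] Reg 0)
        (Assign 42 ((Reg 42 [*] Reg 26 [+] TextAt chain_pos [%] Reg 23) [%] Reg 23) ;;
         Assign 45 (Reg 45 [+] Const 1) ;; Store (Reg 41 [+] Reg 45) (Reg 42)))"

text \<open>Register 34 becomes the power of the base by which a prefix fingerprint must be
  multiplied before it is subtracted from a longer one.\<close>

definition window_com :: com where
  "window_com = Assign 45 (Const 0) ;;
     While (pos_expr [<] Reg 30 [*] Reg 6 [+] Reg 6 [-] Const 1) (Assign 45 (Reg 45 [+] Const 1)) ;;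
     Assign 32 (Reg 45) ;; Assign 34 (Const 1) ;;
     While (pos_expr [<] Reg 30 [*] Reg 6 [+] Reg 1)
       (Assign 34 (Reg 34 [*] Reg 26 [%] Reg 23) ;; Assign 45 (Reg 45 [+] Const 1)) ;;
     Assign 33 (Reg 45)"

definition pat_pos :: expr where
  "pat_pos = pos_expr [-] Reg 30 [*] Reg 6 [-] Reg 40"

text \<open>Fingerprints index the table of heads directly. A bucket is a linked list of values
  \<open>y\<close>, stored as \<open>y + 1\<close> so that 0, the initial content of memory, is the
  empty list.\<close>

definition insert_com :: com where
  "insert_com = For 40 (Reg 6)
     (Cond (Reg 30 [*] Reg 6 [+] Reg 40 [<] Reg 21)
       (Assign 42 (Const 0) ;; Assign 45 (Reg 32) ;;
        While (Reg 45 [<] Reg 33)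
          (Assign 42 ((Reg 42 [*] Reg 26 [+] PatAt pat_pos [%] Reg 23) [%] Reg 23) ;;
           Assign 45 (Reg 45 [+] Const 1)) ;;
        Store (Reg 15 [+] Reg 15 [+] Reg 40) (Mem (Reg 31 [+] Reg 42)) ;;
        Store (Reg 31 [+] Reg 42) (Reg 40 [+] Const 1))
       Skip)"

text \<open>The mark of a location is the number of rounds it has survived without interruption;
  comparing it with the round number skips locations that failed earlier. The second test on the
  location is needed because the first checks only \<open>y = 0\<close>, and larger \<open>y\<close>
  may run past the last location.\<close>

definition query_com :: com where
  "query_com = For 40 (Reg 27)
     (Cond (Reg 40 [*] Reg 21 [+] Reg 30 [*] Reg 6 [<] Reg 0 [-] Reg 1 [+] Const 1)
       (Assign 41 (Reg 15 [+] (Reg 40 [%] Reg 22) [*] Reg 16 [+] (Reg 40 [/] Reg 22) [*] Reg 24) ;;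
        Assign 42 ((Mem (Reg 41 [+] Reg 33) [+] Reg 23 [-] Mem (Reg 41 [+] Reg 32) [*] Reg 34 [%] Reg 23) [%] Reg 23) ;;
        Assign 43 (Mem (Reg 31 [+] Reg 42)) ;;
        While (Reg 43)
          (Assign 44 (Reg 40 [*] Reg 21 [+] Reg 30 [*] Reg 6 [+] Reg 43 [-] Const 1) ;;
           Cond ((Mem (Reg 15 [+] Reg 15 [+] Reg 15 [+] Reg 44) [=] Reg 20) [*] (Reg 44 [<] Reg 0 [-] Reg 1 [+] Const 1))
             (Store (Reg 15 [+] Reg 15 [+] Reg 15 [+] Reg 44) (Reg 20 [+] Const 1) ;;
              Cond (Reg 20 [+] Const 1 [=] Reg 13) (Report (Reg 44)) Skip)
             Skip ;;
           Assign 43 (Mem (Reg 15 [+] Reg 15 [+] Reg 43 [-] Const 1))))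
       Skip)"

definition eqf :: "nat \<Rightarrow> (nat \<Rightarrow> nat) \<Rightarrow> (nat \<Rightarrow> nat) \<Rightarrow> bool" where
  "eqf k f f' \<longleftrightarrow> (\<forall>r<k. f r = f' r)"

lemma eqf_refl [simp]: "eqf k f f"
  by (simp add: eqf_def)

lemma eqf_upd [simp]: "k \<le> r \<Longrightarrow> eqf k (f(r := x)) f' = eqf k f f'"
  by (simp add: eqf_def)

lemma eqfD: "eqf k f f' \<Longrightarrow> r < k \<Longrightarrow> f r = f' r"
  by (simp add: eqf_def)

lemma eqf_trans: "eqf j f f' \<Longrightarrow> eqf k f' f'' \<Longrightarrow> i \<le> j \<Longrightarrow> i \<le> k \<Longrightarrow> eqf i f f''"
  by (simp add: eqf_def)

text \<open>Moving register 31 on by \<open>n ^ 3\<close> supplies the next block with heads that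
  are still zero, in place of clearing the table.\<close>

definition block_com :: com where
  "block_com = window_com ;; insert_com ;; query_com ;; Assign 31 (Reg 31 [+] Reg 15)"

text \<open>\<open>2 ^ w\<close> is not a machine word; its residue in register 26 is obtained from
  \<open>(2 ^ w - 1) mod pm\<close> by adding 1 and reducing again.\<close>

definition inst_com :: com where
  "inst_com = Assign 40 (Reg 20 [*] Reg 14) ;; pick_com 8 21 ;;
     Assign 40 (Reg 20 [*] Reg 14 [+] Reg 11) ;; pick_com 9 22 ;;
     Assign 40 (Reg 20 [*] Reg 14 [+] Reg 11 [+] Reg 11) ;; pick_com 10 23 ;;
     Assign 25 (Reg 20 [*] Reg 14 [+] Reg 11 [+] Reg 11 [+] Reg 11) ;;
     Assign 28 (Reg 21 [*] Reg 22) ;; Assign 24 (Reg 28 [/] Reg 7) ;;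
     Assign 26 (((Const 0 [-] Const 1) [%] Reg 23 [+] Const 1) [%] Reg 23) ;;
     Assign 27 (Reg 0 [/] Reg 21 [+] Const 1) ;; Assign 29 (Reg 21 [/] Reg 6 [+] Const 1) ;;
     chain_com ;; For 30 (Reg 29) block_com"

lemma wp_Seq_simps [simp]:
  "wp I (Skip ;; c) s Q \<longleftrightarrow> wp I c (tick 1 s) Q"
  "wp I (Assign r e ;; c) s Q \<longleftrightarrow> wp I c ((tick (1 + cost e) s)\<lparr>reg := (reg s)(r := exp_val I s e)\<rparr>) Q"
  "wp I (Store a e ;; c) s Q \<longleftrightarrow>
     wp I c ((tick (1 + cost a + cost e) s)\<lparr>mem := (mem s)(exp_val I s a := exp_val I s e)\<rparr>) Q"
  "wp I (Cond b c1 c2 ;; c) s Q \<longleftrightarrow>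
     (if exp_val I s b \<noteq> 0 then wp I (c1 ;; c) (tick (1 + cost b) s) Q else wp I (c2 ;; c) (tick (1 + cost b) s) Q)"
  "wp I ((c1 ;; c2) ;; c) s Q \<longleftrightarrow> wp I (c1 ;; c2 ;; c) s Q"
proof -
  have "exec I (c2 ;; c) = (\<lambda>y. exec I c2 y \<bind> exec I c)" by (rule ext) simp
  then show "wp I ((c1 ;; c2) ;; c) s Q \<longleftrightarrow> wp I (c1 ;; c2 ;; c) s Q" by (simp add: wp_def)
qed (simp_all add: wp_def Let_def)

context par begin

abbreviation "inp \<equiv> \<lparr>word_size = w, text_arr = T, pat_arr = P, delta = \<delta>\<rparr>"

text \<open>All overflow checks reduce to this: intermediate values stay at most
  \<open>n ^ 7\<close>, and the word length of \<open>8 * log n\<close> bits leaves one more factor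
  \<open>n\<close>.\<close>

lemma word_lt: "x \<le> n ^ 7 \<Longrightarrow> x < 2 ^ w"
proof -
  assume "x \<le> n ^ 7"
  also have "n ^ 7 < n ^ 8" using l_le_n[of 1] l1000 by (intro power_strict_increasing) auto
  finally show ?thesis using wn by linarith
qed

lemma w_ge: "20 \<le> w"
proof -
  have "2 ^ 20 \<le> (1000::nat) ^ 8" by simp
  also have "\<dots> \<le> n ^ 8" using l_le_n[of 1] l1000 by (intro power_mono) auto
  also have "\<dots> \<le> 2 ^ w" by (rule wn)
  finally show ?thesis by (rule power_le_imp_le_exp[rotated]) simp
qed

lemma const_lt: "x < 2 ^ 20 \<Longrightarrow> (x::nat) < 2 ^ w"
  using power_increasing[OF w_ge, of "2::nat"] by linarith

lemma const_simps [simp]: "0 < w" "2 \<le> w" "3 \<le> w" "Suc 0 < 2 ^ w" "take_bit w (Suc 0) = Suc 0"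
    "numeral k < (2::nat) ^ 20 \<Longrightarrow> take_bit w (numeral k) = (numeral k :: nat)"
  using w_ge const_lt[of "Suc 0"] const_lt[of "numeral k"] by (auto intro!: take_bit_self)

lemma wp_pick:
  assumes r: "reg s 11 = l ^ 3" "reg s 12 = l ^ 2" "reg s y = Y" "reg s 40 = off"
    and ro: "y < 20" "20 \<le> out" "out < 40"
    and Y: "1 < Y" "l ^ 2 * Y \<le> n ^ 2" and off: "off + l ^ 3 \<le> n ^ 3"
    and Q: "\<And>s'. (\<And>r. r < 40 \<Longrightarrow> r \<noteq> out \<Longrightarrow> reg s' r = reg s r) \<Longrightarrow>
       reg s' out = pick Y (l ^ 2 * Y) (\<lambda>t. mem s (off + t)) (l ^ 3) \<Longrightarrow> mem s' = mem s \<Longrightarrow> reported s' = reported s \<Longrightarrow>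
       clock s' \<le> clock s + l ^ 3 * (60 * l ^ 2 * Y + 60) + 20 \<Longrightarrow> Q s'"
  shows "wp inp (pick_com y out) s Q"
proof -
  let ?b = "l ^ 2 * Y"
  let ?u = "\<lambda>t. mem s (off + t)"
  have n1: "1 < n" using l_le_n[of 1] l1000 by auto
  have npow: "n ^ 2 \<le> n ^ 7" "n ^ 3 \<le> n ^ 7" using n1 by (auto intro: power_increasing)
  have Yb: "Y \<le> ?b" using l_pos by simp
  have Ybw: "Y + ?b < 2 ^ w"
  proof -
    have "Y + ?b \<le> 2 * n ^ 2" using Yb Y by linarith
    also have "\<dots> \<le> n * n ^ 2" using n1 by (intro mult_right_mono) auto
    also have "\<dots> = n ^ 3" by (simp add: eval_nat_numeral)
    finally show ?thesis using npow by (intro word_lt) linarith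
  qed
  have offw: "off + t < 2 ^ w" if "t < l ^ 3" for t using that off npow by (intro word_lt) linarith
  have l3w: "l ^ 3 < 2 ^ w" using offw[of 0] off npow by (intro word_lt) linarith
  have bw: "?b < 2 ^ w" using Ybw by linarith
  define J where "J k s' \<longleftrightarrow> (\<forall>r<40. r \<noteq> out \<longrightarrow> reg s' r = reg s r) \<and> reg s' 40 = off \<and> mem s' = mem s \<and>
     reported s' = reported s \<and> reg s' out = pick Y ?b ?u k" for k and s' :: ram_state
  show ?thesis
    unfolding pick_com_def
  proof (simp only: wp_Seq_simps, rule wp_For[where J = J and N = "l ^ 3" and t = "\<lambda>_. 40 * ?b + 40"], goal_cases)
    case 1 then show ?case using r ro by (simp add: J_def)
  next
    case 2 then show ?case by simp
  next
    case 3 then show ?case using l3w by simp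
  next
    case (4 k s') then show ?case using r ro by (simp add: J_def)
  next
    case (5 k s')
    define c where "c = cand Y ?b ?u k"
    have cb: "c < Y + ?b" "Y \<le> c" using Y l_pos by (auto simp: c_def cand_def)
    then have cw: "c < 2 ^ w" "1 < c" using Ybw Y by linarith+
    have regs: "reg s' y = Y" "reg s' 12 = l ^ 2" "reg s' 40 = off" "reg s' 41 = k" "mem s' = mem s"
      using 5 r ro by (auto simp: J_def)
    have e: "exp_val inp s' (Reg y [+] Mem (Reg 40 [+] Reg 41) [%] (Reg 12 [*] Reg y)) = c"
      using regs 5(1) bw offw[of k] cw by (simp add: c_def cand_def)
    \<comment> \<open>After \<open>j\<close> iterations the divisors from 2 to \<open>j + 1\<close>
      have been tried, so \<open>c - 2\<close> iterations decide primality.\<close>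
    define K where "K j t \<longleftrightarrow> (\<forall>r<43. r \<noteq> 42 \<longrightarrow> reg t r = reg s' r) \<and> reg t 42 = c \<and> reg t 44 = j + 2 \<and>
      reg t 43 = of_bool (\<forall>d\<in>{2..<j + 2}. \<not> d dvd c) \<and> mem t = mem s' \<and> reported t = reported s'" for j and t :: ram_state
    have pr: "prime c \<longleftrightarrow> (\<forall>d\<in>{2..<c}. \<not> d dvd c)" using cw by (auto simp: prime_nat_iff')
    show ?case
    proof (simp only: wp_Seq_simps e, rule wp_Seq, rule wp_While[where J = K and N = "c - 2" and t = "\<lambda>_. 15"], goal_cases)
      case 1 then show ?case by (simp add: K_def)
    next
      case (2 j t) then show ?case by (simp add: K_def)
    next
      case (3 j t)
      have "j + 3 < 2 ^ w" using 3(1) cw by linarith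
      moreover have "{2..<Suc (Suc (Suc j))} = insert (j + 2) {2..<Suc (Suc j)}" by auto
      ultimately show ?case using 3(2) by (auto simp: K_def dvd_eq_mod_eq_0)
    next
      case (4 t) then show ?case using cw by (simp add: K_def)
    next
      case (5 k t x) then show ?case by (simp add: K_def)
    next
      case (6 t)
      have s: "(\<Sum>j<c - 2. 15 + cost (Reg 44 [<] Reg 42) + 1) = 19 * (c - 2)" by simp
      have "19 * (c - 2) \<le> 38 * ?b" using cb Yb by linarith
      moreover have "clock t \<le> clock s' + 19 * (c - 2) + 30" using 6(2) unfolding s by simp
      ultimately have ck: "clock t \<le> clock s' + 38 * ?b + 30" by linarith
      have "c - 2 + 2 = c" using cw by simp
      then have reg43: "reg t 43 = of_bool (prime c)" using 6(1) unfolding K_def pr by metis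
      have regt: "r < 42 \<Longrightarrow> reg t r = reg s' r" "reg t 42 = c" "mem t = mem s" "reported t = reported s'" for r
        using 6(1) regs by (auto simp: K_def)
      show ?case
        using ck reg43 regt 5(2,3) ro by (auto simp: J_def c_def)
    qed
  next
    case (6 k s' x) then show ?case by (simp add: J_def)
  next
    case (7 s')
    have "l ^ 3 * (48 + 40 * ?b) \<le> l ^ 3 * (60 * l ^ 2 * Y + 60)" by (intro mult_left_mono) auto
    moreover have "clock s' \<le> clock s + l ^ 3 * (48 + 40 * ?b) + 8" using 7(2) by simp
    ultimately have "clock s' \<le> clock s + l ^ 3 * (60 * l ^ 2 * Y + 60) + 20" by linarith
    then show ?case using 7(1) by (intro Q) (auto simp: J_def)
  qed
qed

end

section \<open>Verification of one round: evaluation of positions, and the chains\<close>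

locale prog = inst +
  fixes vb \<kappa> :: nat
  assumes vb: "vb + S \<le> n ^ 3" and kb: "\<kappa> < l ^ 2"
begin

definition "iregs f \<longleftrightarrow> f (0::nat) = n \<and> f 1 = m \<and> f 6 = H \<and> f 7 = g \<and> f 13 = l ^ 2 \<and> f 15 = n ^ 3 \<and> f 16 = 2 * n \<and>
   f 20 = \<kappa> \<and> f 21 = Q \<and> f 22 = p \<and> f 23 = pm \<and> f 24 = S \<and> f 25 = vb \<and> f 26 = 2 ^ w mod pm \<and>
   f 27 = n div Q + 1 \<and> f 28 = q \<and> f 29 = Q div H + 1"

definition "tapeok M \<longleftrightarrow> (\<forall>k<S. M (vb + k) = u k)"

lemma iregs_upd [simp]: "30 \<le> r \<Longrightarrow> iregs (f(r := x)) = iregs f"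
  by (simp add: iregs_def)

lemma iregs_eqf: "eqf k f f' \<Longrightarrow> 30 \<le> k \<Longrightarrow> iregs f = iregs f'"
  by (simp add: iregs_def eqf_def)

lemma iregsD: "iregs f \<Longrightarrow> f 0 = n" "iregs f \<Longrightarrow> f (Suc 0) = m" "iregs f \<Longrightarrow> f 6 = H" "iregs f \<Longrightarrow> f 7 = g"
  "iregs f \<Longrightarrow> f 13 = l ^ 2" "iregs f \<Longrightarrow> f 15 = n ^ 3" "iregs f \<Longrightarrow> f 16 = 2 * n" "iregs f \<Longrightarrow> f 20 = \<kappa>"
  "iregs f \<Longrightarrow> f 21 = Q" "iregs f \<Longrightarrow> f 22 = p" "iregs f \<Longrightarrow> f 23 = pm" "iregs f \<Longrightarrow> f 24 = S" "iregs f \<Longrightarrow> f 25 = vb"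
  "iregs f \<Longrightarrow> f 26 = 2 ^ w mod pm" "iregs f \<Longrightarrow> f 27 = n div Q + 1" "iregs f \<Longrightarrow> f 28 = q" "iregs f \<Longrightarrow> f 29 = Q div H + 1"
  by (simp_all add: iregs_def)

lemma tapeok_upd [simp]: "n ^ 3 \<le> a \<Longrightarrow> tapeok (M(a := x)) = tapeok M"
  using vb by (simp add: tapeok_def)

lemma tapeok_cong: "(\<And>x. x < n ^ 3 \<Longrightarrow> M x = M' x) \<Longrightarrow> tapeok M = tapeok M'"
  using vb by (simp add: tapeok_def)

lemma n_big: "1000 \<le> n" using l_le_n[of 1] l1000 by simp

lemma Q_le_n: "Q \<le> 2 * n ^ 2" using Q_le YQ_le by linarith
lemma pm_le_n: "pm \<le> 2 * n ^ 2" using pm_le Yi_le by linarith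

lemma p_le_n: "p * (2 * n) + 2 * n \<le> n ^ 3"
proof -
  have "p \<le> 2 * (l ^ 5 * (D div mu))" using p_le by (simp add: Yp_def eval_nat_numeral algebra_simps)
  also have "\<dots> \<le> 2 * (l ^ 5 * n)" using D_le_n div_le_dividend[of D mu] by (intro mult_left_mono) linarith+
  finally have "p * (2 * n) \<le> 2 * (l ^ 5 * n) * (2 * n)" by (rule mult_right_mono) simp
  moreover have "2 * (l ^ 5 * n) * (2 * n) = 4 * (l ^ 5 * (n * n))" by (simp add: mult_ac)
  moreover have "2 * n \<le> 2 * (n * n)" using n_pos by simp
  ultimately have "p * (2 * n) + 2 * n \<le> 4 * (l ^ 5 * (n * n)) + 2 * (n * n)" by linarith
  also have "\<dots> \<le> 4 * (l ^ 5 * (n * n)) + 2 * (l ^ 5 * (n * n))" using l_pos by simp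
  also have "\<dots> \<le> l * (l ^ 5 * (n * n))" using mult_right_mono[of 6 l "l ^ 5 * (n * n)"] l1000 by simp
  also have "\<dots> = l ^ 6 * (n * n)" by (simp add: eval_nat_numeral)
  also have "\<dots> \<le> n * (n * n)" using l_le_n[of 6] by (intro mult_right_mono) auto
  finally show ?thesis by (simp add: power3_eq_cube)
qed

lemma q_le_n: "q \<le> n ^ 2"
proof -
  have "4 * (L * l ^ 10) \<le> l * (L * l ^ 10)" using l1000 by (intro mult_right_mono) auto
  also have "\<dots> = L * l ^ 11" by (simp add: eval_nat_numeral)
  also have "\<dots> \<le> n" by (rule Ll_le) simp
  finally have "4 * (L * l ^ 10) * D \<le> n * n" using D_le_n by (rule mult_mono) auto
  moreover have "q \<le> 4 * (L * l ^ 10) * D" using q_le by (simp add: mult_ac)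
  ultimately show ?thesis by (simp add: power2_eq_square)
qed

lemma H_le_n: "H \<le> n" using H_le_m mn by simp
lemma zz_le: "a \<le> n ^ 3 \<Longrightarrow> zz a \<le> n ^ 6"
proof -
  assume a: "a \<le> n ^ 3"
  have "vv u (a mod S) \<le> q" using vv_less_q[of "a mod S"] S_pos by (simp add: less_imp_le)
  moreover have "a div S * q \<le> n ^ 3 * n ^ 2" using a q_le_n div_le_dividend[of a S] by (intro mult_mono) linarith+
  ultimately have "zz a \<le> n ^ 5 + n ^ 2" using q_le_n by (simp add: zs_def power_add[symmetric])
  also have "\<dots> \<le> 2 * n ^ 5" using n_pos power_increasing[of 2 5 n] by simp
  also have "\<dots> \<le> n * n ^ 5" using n_big by (intro mult_right_mono) auto
  finally show ?thesis by (simp add: eval_nat_numeral)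
qed

lemma word_add: "x \<le> n ^ 6 \<Longrightarrow> y \<le> n ^ 6 \<Longrightarrow> x + y < 2 ^ w"
proof -
  assume "x \<le> n ^ 6" "y \<le> n ^ 6"
  moreover have "2 * n ^ 6 \<le> n * n ^ 6" using n_big by (intro mult_right_mono) auto
  ultimately have "x + y \<le> n * n ^ 6" by linarith
  then show ?thesis by (intro word_lt) (simp add: eval_nat_numeral)
qed

lemma pow_le: "j \<le> k \<Longrightarrow> n ^ j \<le> n ^ k" using n_pos by (intro power_increasing) auto

lemma le6: "x \<le> n ^ 3 \<Longrightarrow> x \<le> n ^ 6" using pow_le[of 3 6] by simp

lemma wd6: "x \<le> n ^ 6 \<Longrightarrow> x < 2 ^ w" using pow_le[of 6 7] by (intro word_lt) simp

lemma eval_pos: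
  assumes "iregs (reg s)" "tapeok (mem s)" "reg s 45 = a" "a \<le> n ^ 3"
  shows "exp_val inp s pos_expr = zz a"
proof -
  have z: "a div S * q + (a mod S * g + u (a mod S) mod g) = zz a"
    by (simp add: zs_def vv_def)
  have "zz a \<le> n ^ 6" by (rule zz_le[OF assms(4)])
  then have b: "a div S * q < 2 ^ w" "a mod S * g < 2 ^ w" "a mod S * g + u (a mod S) mod g < 2 ^ w" "zz a < 2 ^ w"
    using z wd6[of "zz a"] by linarith+
  have "a mod S < S" using S_pos by simp
  then have t: "mem s (vb + a mod S) = u (a mod S)" "vb + a mod S < 2 ^ w"
    using assms(2) vb wd6[OF le6, of "vb + a mod S"] by (auto simp: tapeok_def)
  show ?thesis using z b t assms(3) by (simp add: pos_expr_def iregsD[OF assms(1)])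
qed

definition "nb c0 = (LEAST b. n \<le> c0 * Q + zz b)"

lemma less_nb: "b < nb c0 \<longleftrightarrow> c0 * Q + zz b < n"
proof
  assume "b < nb c0" then show "c0 * Q + zz b < n" unfolding nb_def using not_less_Least by fastforce
next
  assume b: "c0 * Q + zz b < n"
  have "n \<le> c0 * Q + zz (nb c0)" unfolding nb_def by (rule LeastI[of _ n]) (simp add: zs_ge trans_le_add2)
  then have "zz b < zz (nb c0)" using b by simp
  then show "b < nb c0" using zs_mono by (simp add: strict_mono_less)
qed

lemma nb_le: "nb c0 \<le> n div g + 1" "nb c0 \<le> n"
proof -
  show "nb c0 \<le> n div g + 1"
  proof (rule ccontr)
    assume "\<not> ?thesis"
    then have "c0 * Q + zz (n div g + 1) < n" using less_nb[of "n div g + 1" c0] by linarith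
    moreover have "(n div g + 1) * g \<le> zz (n div g + 1)" by (rule zs_ge)
    moreover have "n < (n div g + 1) * g" using g_ge1
      by (metis Suc_eq_plus1 dividend_less_div_times less_le_trans mult_Suc zero_less_one add.commute)
    ultimately show False by linarith
  qed
  show "nb c0 \<le> n"
    using less_nb[of n c0] zs_ge(2)[of n] by linarith
qed

definition "base c0 = n ^ 3 + c0 * (2 * n)"

definition "chainok M \<longleftrightarrow> (\<forall>c0<p. \<forall>b\<le>nb c0. M (base c0 + b) = cc c0 b mod pm)"

lemma base_le: "c0 < p \<Longrightarrow> base c0 + 2 * n \<le> 2 * n ^ 3"
proof -
  assume "c0 < p"
  then have "c0 * (2 * n) + 2 * n \<le> p * (2 * n)" by (metis Suc_leI mult_Suc mult_le_mono1 add.commute)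
  then show ?thesis using p_le_n by (simp add: base_def)
qed

lemma hash_step: "(c mod pm * (2 ^ w mod pm) + x mod pm) mod pm = (c * 2 ^ w + x) mod pm"
proof -
  let ?a = "c mod pm * (2 ^ w mod pm)"
  have "(?a + x mod pm) mod pm = (?a + x) mod pm" by (rule mod_add_right_eq)
  also have "\<dots> = (?a mod pm + x) mod pm" by (rule mod_add_left_eq[symmetric])
  also have "?a mod pm = c * 2 ^ w mod pm" by (rule mod_mult_eq)
  finally show ?thesis by (simp only: mod_add_left_eq)
qed

text \<open>Residues are at most \<open>2 * n ^ 2\<close>, so a product stays below
  \<open>n ^ 5\<close> and the machine Horner step is exact, not merely correct modulo
  \<open>2 ^ w\<close>.\<close>

lemma hash_bounds: "c mod pm * (2 ^ w mod pm) < 2 ^ w" "c mod pm * (2 ^ w mod pm) + x mod pm < 2 ^ w"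
proof -
  have lt: "y mod pm \<le> 2 * n ^ 2" for y using Q_pos pm_le_n mod_less_divisor[of pm y] by linarith
  have "c mod pm * (2 ^ w mod pm) \<le> (2 * n ^ 2) * (2 * n ^ 2)" using lt by (intro mult_mono) auto
  also have "\<dots> = 4 * n ^ 4" by (simp flip: power_add)
  also have "\<dots> \<le> n * n ^ 4" using n_big by (intro mult_right_mono) auto
  also have "\<dots> = n ^ 5" by (simp add: eval_nat_numeral)
  finally have a: "c mod pm * (2 ^ w mod pm) \<le> n ^ 5" .
  have "2 * n ^ 2 \<le> n * n ^ 2" using n_big by (intro mult_right_mono) auto
  then have "x mod pm \<le> n ^ 3" using lt[of x] by (simp add: eval_nat_numeral)
  then show "c mod pm * (2 ^ w mod pm) + x mod pm < 2 ^ w"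
    using a pow_le[of 5 6] by (intro word_add le6[of "x mod pm"]) linarith+
  then show "c mod pm * (2 ^ w mod pm) < 2 ^ w" by linarith
qed

lemma small: "n \<le> n ^ 3" "2 * n \<le> n ^ 3" "2 * n ^ 3 \<le> n ^ 6" "5 * n ^ 3 \<le> n ^ 6" "2 * n ^ 2 \<le> n ^ 3"
proof -
  show "2 * n \<le> n ^ 3" using p_le_n by linarith
  then show "n \<le> n ^ 3" by linarith
  have "5 * n ^ 3 \<le> n ^ 3 * n ^ 3" using n_big \<open>n \<le> n ^ 3\<close> by (intro mult_right_mono) auto
  then show "5 * n ^ 3 \<le> n ^ 6" "2 * n ^ 3 \<le> n ^ 6" by (simp_all flip: power_add)
  show "2 * n ^ 2 \<le> n ^ 3" using n_big by (simp add: power3_eq_cube power2_eq_square)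
qed

lemma p_le_n3: "p \<le> n ^ 3"
proof -
  have "p * 1 \<le> p * (2 * n)" using n_pos by (intro mult_left_mono) auto
  then show ?thesis using p_le_n by linarith
qed

lemma eval_hash:
  assumes "iregs (reg s)" "reg s 42 = c mod pm" "exp_val inp s e = x"
  shows "exp_val inp s ((Reg 42 [*] Reg 26 [+] e [%] Reg 23) [%] Reg 23) = (c * 2 ^ w + x) mod pm"
  by (simp only: exp_val.simps apply_op.simps ram_input.simps iregsD[OF assms(1)] assms(2,3)
      take_bit_self[OF hash_bounds(1)] take_bit_self[OF hash_bounds(2)] hash_step)

lemma eval_chain_pos:
  assumes "iregs (reg s)" "tapeok (mem s)" "reg s 45 = k" "k \<le> n" "reg s 40 = c0" "c0 < p"
  shows "exp_val inp s chain_pos = c0 * Q + zz k"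
proof -
  have "c0 \<le> n ^ 3" using assms(6) p_le_n3 by linarith
  moreover have "Q \<le> n ^ 3" using Q_le_n small(5) by (rule order_trans)
  ultimately have c1: "c0 * Q \<le> n ^ 3 * n ^ 3" by (rule mult_mono) auto
  have c2: "c0 * Q \<le> n ^ 6" using c1 by (simp flip: power_add)
  have k3: "k \<le> n ^ 3" using assms(4) small(1) by (rule order_trans)
  have "c0 * Q + zz k < 2 ^ w" "c0 * Q < 2 ^ w" using word_add[OF c2 zz_le[OF k3]] wd6[OF c2] by auto
  then show ?thesis using eval_pos[OF assms(1-3) k3] assms(5)
    by (simp add: chain_pos_def iregsD[OF assms(1)])
qed

end

context prog begin

lemma wp_chain:
  assumes s: "iregs (reg s)" "tapeok (mem s)"
    and post: "\<And>s'. eqf 40 (reg s') (reg s) \<Longrightarrow> (\<And>x. x < n ^ 3 \<or> 2 * n ^ 3 \<le> x \<Longrightarrow> mem s' x = mem s x) \<Longrightarrow>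
       chainok (mem s') \<Longrightarrow> reported s' = reported s \<Longrightarrow> clock s' \<le> clock s + p * (100 * (n div g) + 200) + 20 \<Longrightarrow> R s'"
  shows "wp inp chain_com s R"
proof -
  define J where "J k s' \<longleftrightarrow> eqf 40 (reg s') (reg s) \<and> (\<forall>x. x < n ^ 3 \<or> 2 * n ^ 3 \<le> x \<longrightarrow> mem s' x = mem s x) \<and>
     (\<forall>c0<k. \<forall>b\<le>nb c0. mem s' (base c0 + b) = cc c0 b mod pm) \<and> reported s' = reported s" for k and s' :: ram_state
  have ir: "iregs (reg s')" "tapeok (mem s')" if "J k s'" for k s'
  proof -
    show "iregs (reg s')" using that s(1) iregs_eqf[of 40 "reg s'" "reg s"] by (simp add: J_def)
    show "tapeok (mem s')" using that s(2) tapeok_cong[of "mem s'" "mem s"] by (simp add: J_def)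
  qed
  show ?thesis
    unfolding chain_com_def
  proof (rule wp_For[where J = J and N = p and t = "\<lambda>_. 80 * (n div g) + 180"], goal_cases)
    case 1 then show ?case by (simp add: J_def)
  next
    case 2 then show ?case by simp
  next
    case 3 then show ?case using p_le_n3 wd6[OF le6] by simp
  next
    case (4 k s') then show ?case using ir[of k s'] by (simp add: iregsD)
  next
    case (5 c0 s1)
    note i1 = ir[OF 5(2)]
    have bw: "base c0 + b \<le> n ^ 6" if "b \<le> 2 * n" for b using base_le[OF 5(1)] small that by linarith
    have b1: "c0 * (2 * n) < 2 ^ w" "n ^ 3 + c0 * (2 * n) < 2 ^ w" "base c0 < 2 ^ w"
      using bw[of 0] wd6[of "base c0"] by (auto simp: base_def)
    define K where "K k t \<longleftrightarrow> eqf 41 (reg t) (reg s1) \<and> reg t 41 = base c0 \<and> reg t 42 = cc c0 k mod pm \<and> reg t 45 = k \<and>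
       (\<forall>x. x < base c0 \<or> base c0 + k < x \<longrightarrow> mem t x = mem s1 x) \<and> (\<forall>b\<le>k. mem t (base c0 + b) = cc c0 b mod pm) \<and>
       reported t = reported s1" for k and t :: ram_state
    have kr: "iregs (reg t)" "tapeok (mem t)" "reg t 40 = c0" if "K k t" for k t
    proof -
      show "iregs (reg t)" using that i1(1) iregs_eqf[of 41 "reg t" "reg s1"] by (simp add: K_def)
      have "n ^ 3 \<le> base c0" by (simp add: base_def)
      then show "tapeok (mem t)" using that i1(2) tapeok_cong[of "mem t" "mem s1"] by (simp add: K_def)
      show "reg t 40 = c0" using that 5(3) eqfD[of 41 "reg t" "reg s1" 40] by (simp add: K_def)
    qed
    have ev: "exp_val inp t chain_pos = c0 * Q + zz k" if "K k t" "k \<le> n" for k t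
      using eval_chain_pos[OF kr(1,2)[OF that(1)] _ that(2) kr(3)[OF that(1)] 5(1)] that(1) by (simp add: K_def)
    have nbn: "nb c0 \<le> n" by (rule nb_le)
    have costp: "cost chain_pos = 24" by (simp add: chain_pos_def pos_expr_def)
    show ?case
    proof (simp only: wp_Seq_simps, rule wp_While[where J = K and N = "nb c0" and t = "\<lambda>_. 50"], goal_cases)
      case 1
      show ?case using i1 5(3) b1 by (simp add: K_def iregsD base_def)
    next
      case (2 k t)
      have "k \<le> n" using 2 nbn by linarith
      then show ?case using ev[OF 2(2)] less_nb[of k c0] 2(1) iregsD[OF kr(1)[OF 2(2)]] by simp
    next
      case (3 k t)
      have kn: "k < n" using 3(1) nbn by linarith
      have pos: "c0 * Q + zz k < n" using less_nb[of k c0] 3(1) by simp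
      have e1: "exp_val inp t (TextAt chain_pos) = tx (c0 * Q + zz k)"
        using ev[OF 3(2)] kn pos by (simp add: lenT tx_def)
      have e2: "exp_val inp t ((Reg 42 [*] Reg 26 [+] TextAt chain_pos [%] Reg 23) [%] Reg 23) = cc c0 (Suc k) mod pm"
        unfolding cc_Suc by (rule eval_hash[OF kr(1)[OF 3(2)] _ e1]) (use 3(2) in \<open>simp add: K_def\<close>)
      have k1: "Suc k < 2 ^ w" "Suc (base c0 + k) < 2 ^ w" using kn wd6[OF bw[of "k + 1"]] n_big by auto
      show ?case
        unfolding wp_Seq_simps e2
        using 3(2) k1 costp by (auto simp: K_def le_Suc_eq)
    next
      case (4 t) then show ?case using ev[of "nb c0" t] less_nb[of "nb c0" c0] nbn iregsD[OF kr(1)[OF 4]] by simp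
    next
      case (5 k t x) then show ?case by (simp add: K_def)
    next
      case (6 t)
      have ck: "clock t \<le> clock s1 + (80 * (n div g) + 180)" using 6(2) nb_le(1)[of c0] costp by simp
      have old: "mem t (base c + b) = mem s1 (base c + b)" if "c < c0" "b \<le> nb c" for c b
      proof -
        have "b \<le> n" using that nb_le(2)[of c] by linarith
        have "(c + 1) * (2 * n) \<le> c0 * (2 * n)" using that by (intro mult_right_mono) auto
        then have "base c + b < base c0" using \<open>b \<le> n\<close> n_pos by (simp add: base_def)
        then show ?thesis using 6(1) by (simp add: K_def)
      qed
      have out: "mem t x = mem s1 x" if "x < n ^ 3 \<or> 2 * n ^ 3 \<le> x" for x
      proof -
        have "x < base c0 \<or> base c0 + nb c0 < x" using that base_le[OF 5(1)] nbn n_pos by (auto simp: base_def)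
        then show ?thesis using 6(1) unfolding K_def by blast
      qed
      have new: "mem t (base c + b) = cc c b mod pm" if "c < Suc c0" "b \<le> nb c" for c b
      proof (cases "c = c0")
        case True then show ?thesis using 6(1) that by (simp add: K_def)
      next
        case False then show ?thesis using old[of c b] 5(2) that by (simp add: J_def)
      qed
      have "eqf 40 (reg t) (reg s)" using eqf_trans[of 41 "reg t" "reg s1" 40 "reg s" 40] 6(1) 5(2) by (simp add: K_def J_def)
      then show ?case using ck new out 6(1) 5(2) kr(3)[OF 6(1)] by (simp add: J_def K_def)
    qed
  next
    case (6 k s' x) then show ?case by (simp add: J_def)
  next
    case (7 s')
    have "clock s' \<le> 6 + (clock s + p * (188 + 80 * (n div g)))" using 7(2) by simp
    moreover have "p * (188 + 80 * (n div g)) \<le> p * (100 * (n div g) + 200)" by (intro mult_left_mono) auto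
    ultimately have "clock s' \<le> clock s + p * (100 * (n div g) + 200) + 20" by linarith
    then show ?case using 7(1) by (intro post) (auto simp: J_def chainok_def)
  qed
qed

end

section \<open>Windows, buckets and queries of one block\<close>

lemma sub_word: "y \<le> x \<Longrightarrow> x < 2 ^ w \<Longrightarrow> take_bit w (2 ^ w + x - y) = (x - y :: nat)"
  using apply_op_Sub[of y x w] by simp

text \<open>The list is given by the value \<open>v\<close> of a pointer, not by its address, so the
  predicate applies alike to a bucket head in memory and to the register that walks along the
  list.\<close>

primrec lst :: "nat \<Rightarrow> (nat \<Rightarrow> nat) \<Rightarrow> nat \<Rightarrow> nat list \<Rightarrow> bool" where
  "lst N M v [] \<longleftrightarrow> v = 0"
| "lst N M v (y # ys) \<longleftrightarrow> v = y + 1 \<and> lst N M (M (N + y)) ys"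

lemma lst_cong: "(\<And>y. y \<in> set ys \<Longrightarrow> M (N + y) = M' (N + y)) \<Longrightarrow> lst N M v ys = lst N M' v ys"
  by (induction ys arbitrary: v) auto

context prog begin

lemma lo_hi_le: "h \<le> Q div H \<Longrightarrow> h * H + H + m \<le> n ^ 3"
proof -
  assume "h \<le> Q div H"
  then have "h * H \<le> Q div H * H" by (rule mult_right_mono) simp
  also have "\<dots> \<le> Q" by simp
  also have "\<dots> \<le> 2 * n ^ 2" by (rule Q_le_n)
  finally have "h * H + H + m \<le> 2 * n ^ 2 + 2 * n" using H_le_n mn by linarith
  also have "\<dots> \<le> 4 * n ^ 2" using n_pos by (simp add: power2_eq_square)
  also have "\<dots> \<le> n * n ^ 2" using n_big by (intro mult_right_mono) auto
  finally show ?thesis by (simp add: eval_nat_numeral)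
qed

lemma ee_le: "ee h \<le> h * H + m"
  using less_en[of "h * H + m" h] zs_ge(2)[of "h * H + m"] by linarith

lemma cost_pos: "cost pos_expr = 20" "cost pat_pos = 26"
  by (simp_all add: pos_expr_def pat_pos_def)

text \<open>Each block rescans the samples from index 0. This costs \<open>ee h\<close>, about
  \<open>L + m / D\<close> up to powers of \<open>l\<close>, and with about \<open>L\<close> blocks
  stays within \<open>L^2 * (m / D)\<close>.\<close>

lemma wp_window:
  assumes s: "iregs (reg s)" "tapeok (mem s)" "reg s 30 = h" and h: "h \<le> Q div H"
    and post: "\<And>s'. eqf 32 (reg s') (reg s) \<Longrightarrow> reg s' 32 = ss h \<Longrightarrow> reg s' 33 = ee h \<Longrightarrow>
       reg s' 34 = 2 ^ (w * (ee h - ss h)) mod pm \<Longrightarrow> mem s' = mem s \<Longrightarrow> reported s' = reported s \<Longrightarrow>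
       clock s' \<le> clock s + 50 * ee h + 100 \<Longrightarrow> R s'"
  shows "wp inp window_com s R"
proof -
  have b3: "h * H + H + m \<le> n ^ 6" using lo_hi_le[OF h] by (rule le6)
  have bw: "h * H < 2 ^ w" "h * H + H < 2 ^ w" "h * H + m < 2 ^ w" "1 \<le> h * H + H"
    using wd6[OF b3] H_ge1 by linarith+
  have ee3: "ee h \<le> n ^ 3" using ee_le[of h] lo_hi_le[OF h] by linarith
  have ss3: "ss h \<le> n ^ 3" using ee3 st_le_en[of h] by linarith
  have ev: "exp_val inp t (pos_expr [<] Reg 30 [*] Reg 6 [+] Reg 6 [-] Const 1) = of_bool (zz k < h * H + H - 1)"
      "exp_val inp t (pos_expr [<] Reg 30 [*] Reg 6 [+] Reg 1) = of_bool (zz k < h * H + m)"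
    if t: "eqf 32 (reg t) (reg s)" "mem t = mem s" "reg t 45 = k" "k \<le> n ^ 3" for t k
  proof -
    have i: "iregs (reg t)" using t(1) s(1) iregs_eqf[of 32 "reg t" "reg s"] by simp
    have e: "exp_val inp t pos_expr = zz k" using i t s(2) by (intro eval_pos) auto
    have h30: "reg t 30 = h" using eqfD[OF t(1), of 30] s(3) by simp
    show "exp_val inp t (pos_expr [<] Reg 30 [*] Reg 6 [+] Reg 6 [-] Const 1) = of_bool (zz k < h * H + H - 1)"
      using e bw h30 sub_word[of 1 "h * H + H" w] by (simp add: iregsD[OF i])
    show "exp_val inp t (pos_expr [<] Reg 30 [*] Reg 6 [+] Reg 1) = of_bool (zz k < h * H + m)"
      using e bw h30 by (simp add: iregsD[OF i])
  qed
  define J where "J k t \<longleftrightarrow> eqf 32 (reg t) (reg s) \<and> reg t 45 = k \<and> mem t = mem s \<and> reported t = reported s" for k and t :: ram_state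
  show ?thesis
    unfolding window_com_def
  proof (simp only: wp_Seq_simps, rule wp_Seq, rule wp_While[where J = J and N = "ss h" and t = "\<lambda>_. 4"], goal_cases)
    case 1 then show ?case by (simp add: J_def)
  next
    case (2 k t)
    have "k \<le> n ^ 3" using 2(1) ss3 by linarith
    then show ?case using 2 less_st[of k h] ev(1)[of t k] by (simp add: J_def del: exp_val.simps)
  next
    case (3 k t)
    have "Suc k < 2 ^ w" using 3(1) ss3 wd6[OF le6, of "Suc k"] by simp
    then show ?case using 3(2) by (simp add: J_def)
  next
    case (4 t)
    then show ?case using less_st[of "ss h" h] ev(1)[of t "ss h"] ss3 by (simp add: J_def del: exp_val.simps)
  next
    case (5 k t x) then show ?case by (simp add: J_def)
  next
    case (6 t)
    have ct: "clock t \<le> clock s + 40 * ss h + 50" using 6(2) cost_pos by simp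
    define K where "K k t' \<longleftrightarrow> eqf 32 (reg t') (reg s) \<and> reg t' 32 = ss h \<and> reg t' 34 = 2 ^ (w * k) mod pm \<and>
      reg t' 45 = ss h + k \<and> mem t' = mem s \<and> reported t' = reported s" for k and t' :: ram_state
    have pm1: "1 < pm" using Y_pos ib by linarith
    show ?case
    proof (simp only: wp_Seq_simps, rule wp_Seq, rule wp_While[where J = K and N = "ee h - ss h" and t = "\<lambda>_. 10"], goal_cases)
      case 1 then show ?case using 6(1) pm1 by (simp add: K_def J_def)
    next
      case (2 k t')
      have "ss h + k \<le> n ^ 3" "ss h + k < ee h" using 2(1) ee3 by linarith+
      then show ?case using 2(2) less_en[of "ss h + k" h] ev(2)[of t' "ss h + k"] by (simp add: K_def del: exp_val.simps)
    next
      case (3 k t')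
      have "Suc (ss h + k) \<le> n ^ 3" using 3(1) ee3 by linarith
      then have k1: "Suc (ss h + k) < 2 ^ w" using wd6[OF le6] by blast
      have i: "iregs (reg t')" using 3(2) s(1) iregs_eqf[of 32 "reg t'" "reg s"] by (simp add: K_def)
      have "exp_val inp t' (Reg 34 [*] Reg 26 [%] Reg 23) = 2 ^ (w * k) mod pm * (2 ^ w mod pm) mod pm"
        using 3(2) take_bit_self[OF hash_bounds(1)[of "2 ^ (w * k)"]]
        by (simp only: exp_val.simps apply_op.simps ram_input.simps iregsD[OF i] K_def)
      also have "\<dots> = (2 ^ (w * k) * 2 ^ w) mod pm" by (rule mod_mult_eq)
      also have "\<dots> = 2 ^ (w * Suc k) mod pm" by (simp add: power_add mult.commute)
      finally have e: "exp_val inp t' (Reg 34 [*] Reg 26 [%] Reg 23) = 2 ^ (w * Suc k) mod pm" .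
      show ?case
        unfolding wp_Seq_simps e using 3(2) k1 by (simp add: K_def)
    next
      case (4 t')
      have "ss h + (ee h - ss h) = ee h" using st_le_en[of h] by simp
      then show ?case using 4 less_en[of "ee h" h] ev(2)[of t' "ee h"] ee3 by (simp add: K_def del: exp_val.simps)
    next
      case (5 k t' x) then show ?case by (simp add: K_def)
    next
      case (6 t')
      have "clock t' \<le> clock t + 40 * (ee h - ss h) + 45" using 6(2) cost_pos by simp
      then have "clock t' \<le> clock s + 40 * ee h + 95" using ct st_le_en[of h] by linarith
      moreover have "ss h + (ee h - ss h) = ee h" using st_le_en[of h] by simp
      ultimately show ?case using 6(1) by (simp add: K_def, intro post) auto
    qed
  qed
qed

text \<open>Reversed because insertion is at the head; this is the exact order of the bucket for
  fingerprint \<open>x\<close> once all values below \<open>k\<close> have been treated.\<close>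

definition "ys h x k = rev (filter (\<lambda>y. h * H + y < Q \<and> pcode Q p u h y mod pm = x) [0..<k])"

lemma wp_insert:
  assumes s: "iregs (reg s)" "tapeok (mem s)" "reg s 30 = h" "reg s 31 = TB" "reg s 32 = ss h" "reg s 33 = ee h"
    and h: "h \<le> Q div H" and TB: "4 * n ^ 3 \<le> TB" "TB + n ^ 3 \<le> n ^ 6"
    and zero: "\<And>x. TB \<le> x \<Longrightarrow> mem s x = 0"
    and post: "\<And>s'. eqf 40 (reg s') (reg s) \<Longrightarrow>
       (\<And>x. x < 2 * n ^ 3 \<or> 3 * n ^ 3 \<le> x \<and> x < TB \<or> TB + n ^ 3 \<le> x \<Longrightarrow> mem s' x = mem s x) \<Longrightarrow>
       (\<And>x. x < pm \<Longrightarrow> lst (2 * n ^ 3) (mem s') (mem s' (TB + x)) (ys h x H)) \<Longrightarrow> reported s' = reported s \<Longrightarrow>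
       clock s' \<le> clock s + H * (100 * (ee h - ss h) + 200) + 20 \<Longrightarrow> R s'"
  shows "wp inp insert_com s R"
proof -
  have pm3: "pm \<le> n ^ 3" using pm_le_n small(5) by (rule order_trans)
  have Hn3: "H \<le> n ^ 3" using H_le_n small(1) by (rule order_trans)
  have ee3: "ee h \<le> n ^ 3" using ee_le[of h] lo_hi_le[OF h] by linarith
  define same where "same t \<longleftrightarrow> (\<forall>x. x < 2 * n ^ 3 \<or> 3 * n ^ 3 \<le> x \<and> x < TB \<or> TB + n ^ 3 \<le> x \<longrightarrow> mem t x = mem s x)" for t :: ram_state
  have same_tick: "same (tick x t) = same t" "same (t\<lparr>reg := f\<rparr>) = same t" for x t f by (simp_all add: same_def)
  define J where "J k t \<longleftrightarrow> eqf 40 (reg t) (reg s) \<and> same t \<and>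
     (\<forall>x<pm. lst (2 * n ^ 3) (mem t) (mem t (TB + x)) (ys h x k)) \<and> reported t = reported s" for k and t :: ram_state
  have ir: "iregs (reg t)" "tapeok (mem t)" if "J k t" for k t
  proof -
    show "iregs (reg t)" using that s(1) iregs_eqf[of 40 "reg t" "reg s"] by (simp add: J_def)
    show "tapeok (mem t)" using that s(2) tapeok_cong[of "mem t" "mem s"] by (simp add: J_def same_def)
  qed
  show ?thesis
    unfolding insert_com_def
  proof (rule wp_For[where J = J and N = H and t = "\<lambda>_. 90 * (ee h - ss h) + 160"], goal_cases)
    case 1
    then show ?case using zero by (simp add: J_def ys_def same_def)
  next
    case 2 then show ?case by simp
  next
    case 3 then show ?case using wd6[OF le6[OF Hn3]] by simp
  next
    case (4 k t) then show ?case using ir[of k t] by (simp add: iregsD)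
  next
    case (5 y t1)
    note i1 = ir[OF 5(2)]
    have r1: "reg t1 30 = h" "reg t1 31 = TB" "reg t1 32 = ss h" "reg t1 33 = ee h"
      using 5(2) s eqfD[of 40 "reg t1" "reg s"] by (simp_all add: J_def)
    have hy: "h * H + y \<le> n ^ 6" using lo_hi_le[OF h] 5(1) le6[of "h * H + y"] by linarith
    then have hyw: "h * H < 2 ^ w" "h * H + y < 2 ^ w" using wd6[OF hy] by linarith+
    have gd: "exp_val inp t1 (Reg 30 [*] Reg 6 [+] Reg 40 [<] Reg 21) = of_bool (h * H + y < Q)"
      using hyw 5(3) r1 by (simp add: iregsD[OF i1(1)])
    define K where "K j t \<longleftrightarrow> eqf 41 (reg t) (reg t1) \<and> reg t 45 = ss h + j \<and>
      reg t 42 = enc w (map (\<lambda>a. px (zz a - h * H - y)) [ss h..<ss h + j]) mod pm \<and> mem t = mem t1 \<and> reported t = reported t1" for j and t :: ram_state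
    have kr: "iregs (reg t)" "tapeok (mem t)" "reg t 40 = y" "reg t 30 = h" "reg t 31 = TB" "reg t 33 = ee h" if "K j t" for j t
    proof -
      have e: "eqf 41 (reg t) (reg t1)" using that by (simp add: K_def)
      show "iregs (reg t)" using e i1(1) iregs_eqf[of 41 "reg t" "reg t1"] by simp
      show "tapeok (mem t)" using that i1(2) by (simp add: K_def)
      show "reg t 40 = y" "reg t 30 = h" "reg t 31 = TB" "reg t 33 = ee h"
        using eqfD[OF e, of 40] eqfD[OF e, of 30] eqfD[OF e, of 31] eqfD[OF e, of 33] r1 5(3) by simp_all
    qed
    show ?case
    proof (cases "h * H + y < Q")
      case False
      have "ys h x (Suc y) = ys h x y" for x using False by (simp add: ys_def)
      then show ?thesis using 5 False gd by (simp add: J_def same_tick del: exp_val.simps)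
    next
      case True
      show ?thesis
        unfolding wp_Cond gd
      proof (simp only: True of_bool_eq one_neq_zero if_True not_False_eq_True wp_Seq_simps simp_thms,
          rule wp_Seq, rule wp_While[where J = K and N = "ee h - ss h" and t = "\<lambda>_. 60"], goal_cases)
        case 1
        show ?case using r1 by (simp add: K_def)
      next
        case (2 j t) then show ?case using kr[OF 2(2)] by (simp add: K_def)
      next
        case (3 j t)
        let ?a = "ss h + j"
        have a: "ss h \<le> ?a" "?a < ee h" using 3(1) by auto
        have a3: "?a \<le> n ^ 3" using a ee3 by linarith
        have win: "zz ?a - h * H - y < m" "h * H + y \<le> zz ?a"
          using px_arg[OF a 5(1)] by linarith+
        have zw: "zz ?a < 2 ^ w" using wd6[OF zz_le[OF a3]] .
        have e0: "exp_val inp t pos_expr = zz ?a"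
          using kr[OF 3(2)] 3(2) a3 by (intro eval_pos) (auto simp: K_def)
        have "take_bit w (2 ^ w + zz ?a - h * H) = zz ?a - h * H"
          using win zw by (intro sub_word) auto
        moreover have "take_bit w (2 ^ w + (zz ?a - h * H) - y) = zz ?a - h * H - y"
          using win zw by (intro sub_word) auto
        ultimately have e1: "exp_val inp t pat_pos = zz ?a - h * H - y"
          using e0 kr[OF 3(2)] hyw by (simp add: pat_pos_def iregsD[OF kr(1)[OF 3(2)]])
        have e2: "exp_val inp t (PatAt pat_pos) = px (zz ?a - h * H - y)"
          using e1 win by (simp add: Let_def lenP px_def)
        have e3: "exp_val inp t ((Reg 42 [*] Reg 26 [+] PatAt pat_pos [%] Reg 23) [%] Reg 23) =
           enc w (map (\<lambda>a. px (zz a - h * H - y)) [ss h..<ss h + Suc j]) mod pm"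
          using eval_hash[OF kr(1)[OF 3(2)] _ e2] 3(2) by (simp add: K_def)
        have "Suc ?a \<le> n ^ 3" using a ee3 by linarith
        then have "Suc ?a < 2 ^ w" using wd6[OF le6] by blast
        then show ?case unfolding wp_Seq_simps e3 using 3(2) cost_pos by (simp add: K_def)
      next
        case (4 t) then show ?case using kr[OF 4] st_le_en[of h] by (simp add: K_def)
      next
        case (5 j t x) then show ?case by (simp add: K_def)
      next
        case (6 t)
        note k = kr[OF 6(1)]
        define x where "x = pcode Q p u h y mod pm"
        have x: "reg t 42 = x" "x < pm" using 6(1) st_le_en[of h] Q_pos by (simp_all add: K_def x_def pcode_def)
        have m1: "mem t = mem t1" "reported t = reported t1" using 6(1) by (simp_all add: K_def)
        have ad: "n ^ 3 + n ^ 3 < 2 ^ w" "2 * n ^ 3 + y < 2 ^ w" "TB + x < 2 ^ w" "Suc y < 2 ^ w"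
        proof -
          show "n ^ 3 + n ^ 3 < 2 ^ w" using small(3) by (intro wd6) linarith
          show "2 * n ^ 3 + y < 2 ^ w" using small(4) 5(1) Hn3 by (intro wd6) linarith
          show "TB + x < 2 ^ w" using TB x pm3 by (intro wd6) linarith
          show "Suc y < 2 ^ w" using 5(1) Hn3 le6[of "Suc y"] by (intro wd6) linarith
        qed
        have ev1: "exp_val inp t (Reg 15 [+] Reg 15 [+] Reg 40) = 2 * n ^ 3 + y"
          using ad k by (simp add: iregsD[OF k(1)])
        have ev2: "exp_val inp (t\<lparr>mem := M\<rparr>) (Reg 31 [+] Reg 42) = TB + x" "exp_val inp t (Reg 31 [+] Reg 42) = TB + x" for M
          using ad k x by simp_all
        have ev3: "exp_val inp (t\<lparr>mem := M\<rparr>) (Reg 40 [+] Const 1) = y + 1" for M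
          using ad k by simp
        let ?M = "(mem t)(2 * n ^ 3 + y := mem t (TB + x), TB + x := y + 1)"
        have yH: "y < n ^ 3" using 5(1) Hn3 by linarith
        have TBy: "2 * n ^ 3 + y < TB" using yH TB by linarith
        have lstM: "lst (2 * n ^ 3) ?M (?M (TB + z)) (ys h z (Suc y))" if z: "z < pm" for z
        proof -
          have old: "lst (2 * n ^ 3) (mem t) (mem t (TB + z)) (ys h z y)" using 5(2) z m1 by (simp add: J_def)
          \<comment> \<open>The old lists contain only values below \<open>y\<close>, so writing the
            successor of \<open>y\<close> and one head leaves their links intact.\<close>
          have "lst (2 * n ^ 3) ?M v (ys h z y) = lst (2 * n ^ 3) (mem t) v (ys h z y)" for v
            by (rule lst_cong) (use TBy yH TB in \<open>auto simp: ys_def\<close>)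
          then have old': "lst (2 * n ^ 3) ?M (mem t (TB + z)) (ys h z y)" using old by simp
          show ?thesis
          proof (cases "z = x")
            case True
            then have "ys h z (Suc y) = y # ys h z y" using \<open>h * H + y < Q\<close> by (simp add: ys_def x_def)
            then show ?thesis using old' True TBy by simp
          next
            case False
            then have "ys h z (Suc y) = ys h z y" by (simp add: ys_def x_def)
            then show ?thesis using old' False TBy by simp
          qed
        qed
        have sm: "same (t\<lparr>mem := ?M\<rparr>)"
          using 5(2) m1 yH TB x pm3 by (auto simp: J_def same_def)
        have eq: "eqf 40 (reg t) (reg s)"
          using eqf_trans[of 41 "reg t" "reg t1" 40 "reg s" 40] 6(1) 5(2) by (simp add: K_def J_def)
        have ck: "clock t \<le> clock t1 + 70 * (ee h - ss h) + 40" using 6(2) by simp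
        show ?case
          unfolding wp_Seq_simps wp_Store ev1
          using ev2 ev3 ck eq k(3) 5(2) m1(2) lstM sm
          by (simp add: J_def same_def del: fun_upd_apply)
      qed
    qed
  next
    case (6 k t x) then show ?case by (simp add: J_def same_tick)
  next
    case (7 t)
    have "clock t \<le> 6 + (clock s + H * (168 + 90 * (ee h - ss h)))" using 7(2) by simp
    moreover have "H * (168 + 90 * (ee h - ss h)) \<le> H * (100 * (ee h - ss h) + 200)" by (intro mult_left_mono) auto
    ultimately have "clock t \<le> clock s + H * (100 * (ee h - ss h) + 200) + 20" by linarith
    then show ?case using 7(1) by (intro post) (auto simp: J_def same_def)
  qed
qed

end

text \<open>Adding \<open>k\<close> first keeps the natural subtraction from truncating. With
  \<open>x\<close> the shifted prefix code and \<open>t\<close> the window code, this recovers the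
  window fingerprint from two prefix fingerprints.\<close>

lemma mod_sub_left: "0 < k \<Longrightarrow> ((x + t) mod k + k - x mod k) mod k = t mod (k::nat)"
proof -
  assume k: "0 < k"
  define d where "d = (x + t) mod k + k - x mod k"
  have "x mod k < k" using k by simp
  then have "int d = int ((x + t) mod k) + int k - int (x mod k)" unfolding d_def by (simp add: of_nat_diff)
  moreover have "int k * int ((x + t) div k) + int ((x + t) mod k) = int x + int t"
    by (metis mult_div_mod_eq of_nat_add of_nat_mult)
  moreover have "int k * int (x div k) + int (x mod k) = int x"
    by (metis mult_div_mod_eq of_nat_add of_nat_mult)
  ultimately have "int d = int t + int k * (1 - int ((x + t) div k) + int (x div k))"
    by (simp add: algebra_simps)
  then have "int d mod int k = int t mod int k" by simp
  then have "int (d mod k) = int (t mod k)" by (simp add: zmod_int)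
  then show ?thesis unfolding d_def by simp
qed

context prog begin

text \<open>The marks in the middle of a round, with \<open>mk\<close> their values at its start and
  \<open>Z\<close> the locations treated so far.\<close>

definition "mkok mk M Z \<longleftrightarrow> (\<forall>i\<le>n - m. M (3 * n ^ 3 + i) = (if i \<in> Z \<and> hit Q p pm u i \<and> mk i = \<kappa> then \<kappa> + 1 else mk i))"

definition "repok R M \<longleftrightarrow> R = {i. i \<le> n - m \<and> M (3 * n ^ 3 + i) = l ^ 2}"

text \<open>The length of the bucket walked by query \<open>(c, h)\<close>, entries past the last
  location included, since they cost time as well.\<close>

definition "cn c h = (if c * Q + h * H \<le> n - m then card {y. y < H \<and> h * H + y < Q \<and> pcode Q p u h y mod pm = tcode Q p u c h mod pm} else 0)"

text \<open>The first gap lies inside every window because \<open>g \<le> D \<le> m\<close>; this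
  makes \<open>ee h - 1\<close> a genuine predecessor.\<close>

lemma ee_pos: "0 < ee h"
proof -
  have "g \<le> D"
  proof (cases "D = 1")
    case False
    have "D div l ^ 2 \<le> D div 2" using l1000 self_le_power[of l 2] by (intro div_le_mono2) auto
    then show ?thesis using D_ge1 False unfolding g_def by linarith
  next
    case True
    have "1 < l ^ 2" using one_less_power[of l 2] l1000 by simp
    then have "D div l ^ 2 = 0" using True by simp
    then show ?thesis using D_ge1 unfolding g_def by linarith
  qed
  then have "zz 0 < h * H + m" using D_le_m vv_bounds(2)[of 0] by (simp add: zs_def)
  then show ?thesis using less_en by blast
qed

text \<open>A chain is stored only up to the end of the text; the guard of the query ensures that
  the window ends there at the latest, so both prefix entries exist.\<close>

lemma ee_le_nb:
  assumes "c * Q + h * H \<le> n - m"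
  shows "ee h + c div p * S \<le> nb (c mod p)"
proof -
  have "zz (ee h - 1) < h * H + m" using less_en[of "ee h - 1" h] ee_pos[of h] by simp
  moreover have "c mod p * Q + c div p * q = c * Q"
  proof -
    have "c mod p * Q + c div p * q = (c mod p + c div p * p) * Q" by (simp only: ring_distribs mult_ac)
    then show ?thesis by (simp only: mod_div_mult_eq)
  qed
  ultimately have "c mod p * Q + zz (ee h - 1 + c div p * S) < n"
    using assms mn unfolding zs_shift by linarith
  then have "ee h - 1 + c div p * S < nb (c mod p)" using less_nb by blast
  then show ?thesis using ee_pos[of h] by linarith
qed

lemma hit_iff:
  assumes "y < H" "h * H + y < Q"
  shows "hit Q p pm u (c * Q + h * H + y) \<longleftrightarrow> tcode Q p u c h mod pm = pcode Q p u h y mod pm"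
    "(c * Q + h * H + y) div Q = c" "(c * Q + h * H + y) mod Q div H = h" "(c * Q + h * H + y) mod Q mod H = y"
proof -
  have 1: "(c * Q + h * H + y) div Q = c" "(c * Q + h * H + y) mod Q = h * H + y"
    using assms(2) by (simp_all add: add.assoc)
  moreover have 2: "(h * H + y) div H = h" "(h * H + y) mod H = y" using assms(1) by simp_all
  ultimately show "hit Q p pm u (c * Q + h * H + y) \<longleftrightarrow> tcode Q p u c h mod pm = pcode Q p u h y mod pm"
    "(c * Q + h * H + y) div Q = c" "(c * Q + h * H + y) mod Q div H = h" "(c * Q + h * H + y) mod Q mod H = y"
    by (simp_all add: hit_def)
qed

lemma wp_query:
  assumes s: "iregs (reg s)" "reg s 30 = h" "reg s 31 = TB" "reg s 32 = ss h" "reg s 33 = ee h"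
      "reg s 34 = 2 ^ (w * (ee h - ss h)) mod pm"
    and ch: "chainok (mem s)" and h: "h \<le> Q div H" and TB: "4 * n ^ 3 \<le> TB" "TB + n ^ 3 \<le> n ^ 6"
    and ls: "\<And>x. x < pm \<Longrightarrow> lst (2 * n ^ 3) (mem s) (mem s (TB + x)) (ys h x H)"
    and mk: "mkok mk (mem s) Z" and rep: "repok (reported s) (mem s)"
    and post: "\<And>s'. eqf 40 (reg s') (reg s) \<Longrightarrow>
       (\<And>x. x < 3 * n ^ 3 \<or> 4 * n ^ 3 \<le> x \<Longrightarrow> mem s' x = mem s x) \<Longrightarrow>
       mkok mk (mem s') (Z \<union> {i. i mod Q div H = h}) \<Longrightarrow> repok (reported s') (mem s') \<Longrightarrow>
       clock s' \<le> clock s + (\<Sum>c\<le>n div Q. 100 + 100 * cn c h) + 20 \<Longrightarrow> R s'"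
  shows "wp inp query_com s R"
proof -
  have pm3: "pm \<le> n ^ 3" using pm_le_n small(5) by (rule order_trans)
  have hQ: "h * H + H + m \<le> n ^ 3" by (rule lo_hi_le[OF h])
  define A where "A t \<longleftrightarrow> (\<forall>x. x < 3 * n ^ 3 \<or> 4 * n ^ 3 \<le> x \<longrightarrow> mem t x = mem s x) \<and> repok (reported t) (mem t)" for t :: ram_state
  have A_simps: "A (tick x t) = A t" "A (t\<lparr>reg := f\<rparr>) = A t" for x t f by (simp_all add: A_def)
  define J where "J k t \<longleftrightarrow> eqf 40 (reg t) (reg s) \<and> A t \<and>
     mkok mk (mem t) (Z \<union> {i. i mod Q div H = h \<and> i div Q < k})" for k and t :: ram_state
  have jr: "iregs (reg t)" "reg t 30 = h" "reg t 31 = TB" "reg t 32 = ss h" "reg t 33 = ee h"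
      "reg t 34 = 2 ^ (w * (ee h - ss h)) mod pm" if "eqf 40 (reg t) (reg s)" for t :: ram_state
    using s iregs_eqf[OF that] eqfD[OF that, of 30] eqfD[OF that, of 31] eqfD[OF that, of 32] eqfD[OF that, of 33]
      eqfD[OF that, of 34] by simp_all
  have nm: "take_bit w (2 ^ w + n - m) = n - m" "Suc (n - m) < 2 ^ w" "n < 2 ^ w"
  proof -
    show n2: "n < 2 ^ w" using small(1) by (intro wd6 le6)
    then show "take_bit w (2 ^ w + n - m) = n - m" using mn by (intro sub_word)
    show "Suc (n - m) < 2 ^ w" using n2 m1 mn by linarith
  qed
  have n3w: "n ^ 3 < 2 ^ w" "n ^ 3 + n ^ 3 < 2 ^ w" "n ^ 3 + n ^ 3 + n ^ 3 < 2 ^ w"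
    using wd6[OF small(4)] by linarith+
  have k1: "Suc \<kappa> < 2 ^ w"
  proof -
    have "Suc \<kappa> \<le> l ^ 2" using kb by simp
    also have "\<dots> \<le> n" by (rule l_le_n) simp
    finally show ?thesis using nm by linarith
  qed
  show ?thesis
    unfolding query_com_def
  proof (rule wp_For[where J = J and N = "n div Q + 1" and t = "\<lambda>c. 80 + 90 * cn c h"], goal_cases)
    case 1
    have "{i. i mod Q div H = h \<and> i div Q < 0} = {}" by simp
    then show ?case using mk rep unfolding J_def A_def by simp
  next
    case 2 then show ?case by simp
  next
    case 3
    have "n div Q + 1 \<le> n ^ 3" using div_le_dividend[of n Q] small(2) n_pos by linarith
    then show ?case using wd6[OF le6] by simp
  next
    case (4 k t) then show ?case using jr(1)[of t] by (simp add: J_def iregsD)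
  next
    case (5 c t1)
    have e1: "eqf 40 (reg t1) (reg s)" using 5(2) by (simp add: J_def)
    note i1 = jr[OF e1]
    have cQ: "c * Q \<le> n"
    proof -
      have "c * Q \<le> n div Q * Q" using 5(1) by (intro mult_right_mono) auto
      also have "\<dots> \<le> n" by simp
      finally show ?thesis .
    qed
    have chw: "c * Q < 2 ^ w" "h * H < 2 ^ w" "c * Q + h * H < 2 ^ w"
    proof -
      have "c * Q + h * H \<le> 2 * n ^ 3" using cQ hQ small(1) by linarith
      then show "c * Q + h * H < 2 ^ w" using small(3) by (intro wd6) linarith
      then show "c * Q < 2 ^ w" "h * H < 2 ^ w" by linarith+
    qed
    have gd: "exp_val inp t1 (Reg 40 [*] Reg 21 [+] Reg 30 [*] Reg 6 [<] Reg 0 [-] Reg 1 [+] Const 1) = of_bool (c * Q + h * H \<le> n - m)"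
      using chw nm 5(3) i1(2) by (simp add: iregsD[OF i1(1)] less_Suc_eq_le)
    have Zc: "{i. i mod Q div H = h \<and> i div Q < Suc c} = {i. i mod Q div H = h \<and> i div Q < c} \<union> {i. i mod Q div H = h \<and> i div Q = c}"
      by (auto simp: less_Suc_eq)
    show ?case
    proof (cases "c * Q + h * H \<le> n - m")
      case False
      \<comment> \<open>When the guard fails, every position of this block and row lies beyond
        \<open>n - m\<close>, so there is no mark to update.\<close>
      have "mkok mk (mem t1) (Z \<union> {i. i mod Q div H = h \<and> i div Q < Suc c})"
      proof -
        have "\<not> (i mod Q div H = h \<and> i div Q = c)" if "i \<le> n - m" for i
        proof
          assume a: "i mod Q div H = h \<and> i div Q = c"
          have "c * Q + h * H \<le> i" using decomp(1)[of i] unfolding a[THEN conjunct1] a[THEN conjunct2] by linarith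
          then show False using that False by linarith
        qed
        then have "i \<in> Z \<union> {i. i mod Q div H = h \<and> i div Q < Suc c} \<longleftrightarrow> i \<in> Z \<union> {i. i mod Q div H = h \<and> i div Q < c}"
          if "i \<le> n - m" for i
          using that unfolding Zc by blast
        then show ?thesis using 5(2) unfolding J_def mkok_def by simp
      qed
      then show ?thesis using 5(2,3) False gd by (simp add: J_def A_simps del: exp_val.simps)
    next
      case True
      define c0 where "c0 = c mod p"
      define o' where "o' = c div p * S"
      have c0: "c0 < p" using Q_pos by (simp add: c0_def)
      have eb: "ee h + o' \<le> nb c0" using ee_le_nb[OF True] by (simp add: c0_def o'_def)
      have sb: "ss h + o' \<le> nb c0" using eb st_le_en[of h] by linarith
      have bb: "base c0 + nb c0 \<le> 2 * n ^ 3" using base_le[OF c0] nb_le(2)[of c0] by linarith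
      have bw: "base c0 + nb c0 < 2 ^ w" using bb small(3) by (intro wd6) linarith
      have w41: "n ^ 3 + c0 * (2 * n) + o' < 2 ^ w" "n ^ 3 + c0 * (2 * n) < 2 ^ w" "c0 * (2 * n) < 2 ^ w" "o' < 2 ^ w"
          "base c0 + o' + ee h < 2 ^ w" "base c0 + o' + ss h < 2 ^ w"
        using bw eb sb by (auto simp: base_def)
      have ev41: "exp_val inp t1 (Reg 15 [+] (Reg 40 [%] Reg 22) [*] Reg 16 [+] (Reg 40 [/] Reg 22) [*] Reg 24) = base c0 + o'"
        using w41 5(3) by (simp add: iregsD[OF i1(1)] base_def flip: c0_def o'_def)
      define tt where "tt = tcode Q p u c h mod pm"
      have me: "mem t1 (base c0 + o' + ee h) = cc c0 (ee h + o') mod pm" "mem t1 (base c0 + o' + ss h) = cc c0 (ss h + o') mod pm"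
      proof -
        have x: "base c0 + b < 3 * n ^ 3" if "b \<le> nb c0" for b using that bb n_pos by (simp add: order_le_less_trans[of _ "2 * n ^ 3"])
        have "mem t1 (base c0 + b) = cc c0 b mod pm" if "b \<le> nb c0" for b
          using 5(2) x[OF that] ch c0 that by (simp add: J_def A_def chainok_def)
        from this[OF eb] this[OF sb] show "mem t1 (base c0 + o' + ee h) = cc c0 (ee h + o') mod pm"
          "mem t1 (base c0 + o' + ss h) = cc c0 (ss h + o') mod pm" by (simp_all add: add_ac)
      qed
      have ev42: "exp_val inp t ((Mem (Reg 41 [+] Reg 33) [+] Reg 23 [-] Mem (Reg 41 [+] Reg 32) [*] Reg 34 [%] Reg 23) [%] Reg 23) = tt"
        if t: "eqf 40 (reg t) (reg s)" "reg t 41 = base c0 + o'" "mem t = mem t1" for t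
      proof -
        let ?x = "cc c0 (ss h + o') * 2 ^ (w * (ee h - ss h))"
        have prod: "cc c0 (ss h + o') mod pm * (2 ^ (w * (ee h - ss h)) mod pm) < 2 ^ w"
        proof -
          have lt: "y mod pm \<le> n ^ 3" for y using Q_pos pm3 mod_less_divisor[of pm y] by linarith
          have "cc c0 (ss h + o') mod pm * (2 ^ (w * (ee h - ss h)) mod pm) \<le> n ^ 3 * n ^ 3" using lt by (intro mult_mono) auto
          then show ?thesis by (intro wd6) (simp flip: power_add)
        qed
        have pmod: "cc c0 (ss h + o') mod pm * (2 ^ (w * (ee h - ss h)) mod pm) mod pm = ?x mod pm" by (rule mod_mult_eq)
        have sum: "cc c0 (ee h + o') mod pm + pm < 2 ^ w"
        proof -
          have "cc c0 (ee h + o') mod pm \<le> n ^ 3" using Q_pos pm3 mod_less_divisor[of pm "cc c0 (ee h + o')"] by linarith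
          then show ?thesis using pm3 small(3) by (intro wd6) linarith
        qed
        have xm: "?x mod pm < pm" using Q_pos by simp
        have sub: "take_bit w (2 ^ w + (cc c0 (ee h + o') mod pm + pm) - ?x mod pm) = cc c0 (ee h + o') mod pm + pm - ?x mod pm"
          using sum xm by (intro sub_word) linarith+
        have "exp_val inp t ((Mem (Reg 41 [+] Reg 33) [+] Reg 23 [-] Mem (Reg 41 [+] Reg 32) [*] Reg 34 [%] Reg 23) [%] Reg 23)
           = (cc c0 (ee h + o') mod pm + pm - ?x mod pm) mod pm"
          by (simp only: exp_val.simps apply_op.simps ram_input.simps iregsD[OF jr(1)[OF t(1)]] jr[OF t(1)] t
              take_bit_self[OF w41(5)] take_bit_self[OF w41(6)] me take_bit_self[OF prod] pmod take_bit_self[OF sum] sub)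
        also have "\<dots> = tcode Q p u c h mod pm"
        proof -
          have "cc c0 (ee h + o') = ?x + tcode Q p u c h" unfolding c0_def o'_def by (rule cc_tcode)
          then show ?thesis using mod_sub_left[of pm ?x "tcode Q p u c h"] Q_pos by simp
        qed
        finally show ?thesis by (simp add: tt_def)
      qed
      have tt: "tt < pm" using Q_pos by (simp add: tt_def)
      define Y where "Y = ys h tt H"
      have Yset: "y \<in> set Y \<longleftrightarrow> y < H \<and> h * H + y < Q \<and> pcode Q p u h y mod pm = tt" for y by (auto simp: Y_def ys_def)
      have Ylen: "length Y = cn c h"
      proof -
        have "distinct Y" by (simp add: Y_def ys_def)
        then have "length Y = card (set Y)" by (simp add: distinct_card)
        also have "set Y = {y. y < H \<and> h * H + y < Q \<and> pcode Q p u h y mod pm = tcode Q p u c h mod pm}" using Yset by (auto simp: tt_def)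
        finally show ?thesis using True by (simp add: cn_def)
      qed
      \<comment> \<open>Treated so far: all earlier rows, and the first \<open>j\<close> entries of
        the current bucket.\<close>
      define Zj where "Zj j = Z \<union> {i. i mod Q div H = h \<and> i div Q < c} \<union> (\<lambda>y. c * Q + h * H + y) ` set (take j Y)" for j
      define K where "K j t \<longleftrightarrow> eqf 41 (reg t) (reg t1) \<and> A t \<and> mkok mk (mem t) (Zj j) \<and>
         lst (2 * n ^ 3) (mem t) (reg t 43) (drop j Y)" for j and t :: ram_state
      have kr: "eqf 40 (reg t) (reg s)" "reg t 40 = c" if "K j t" for j t
      proof -
        have e: "eqf 41 (reg t) (reg t1)" using that by (simp add: K_def)
        show "eqf 40 (reg t) (reg s)" using eqf_trans[OF e e1, of 40] by simp
        show "reg t 40 = c" using eqfD[OF e, of 40] 5(3) by simp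
      qed
      have ltb: "lst (2 * n ^ 3) (mem t1) (mem t1 (TB + tt)) Y"
      proof -
        have l0: "lst (2 * n ^ 3) (mem s) (mem s (TB + tt)) Y" unfolding Y_def by (rule ls[OF tt])
        have same: "mem t1 x = mem s x" if "x < 3 * n ^ 3 \<or> 4 * n ^ 3 \<le> x" for x using 5(2) that by (auto simp: J_def A_def)
        have "mem t1 (TB + tt) = mem s (TB + tt)" by (rule same) (use TB in simp)
        moreover have "lst (2 * n ^ 3) (mem t1) v Y = lst (2 * n ^ 3) (mem s) v Y" for v
        proof (rule lst_cong, rule same)
          fix y assume "y \<in> set Y"
          then have "y < H" using Yset by simp
          then show "2 * n ^ 3 + y < 3 * n ^ 3 \<or> 4 * n ^ 3 \<le> 2 * n ^ 3 + y" using H_le_n small(1) by linarith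
        qed
        ultimately show ?thesis using l0 by simp
      qed
      have TBtt: "TB + tt < 2 ^ w" using TB tt pm3 by (intro wd6) linarith
      show ?thesis
        unfolding wp_Cond gd
      proof (simp only: True of_bool_eq one_neq_zero if_True not_False_eq_True wp_Seq_simps simp_thms exp_val_tick ev41,
          rule wp_While[where J = K and N = "length Y" and t = "\<lambda>_. 60"], goal_cases)
        case 1
        let ?s = "(tick (1 + cost (Reg 15 [+] (Reg 40 [%] Reg 22) [*] Reg 16 [+] (Reg 40 [/] Reg 22) [*] Reg 24))
           (tick (1 + cost (Reg 40 [*] Reg 21 [+] Reg 30 [*] Reg 6 [<] Reg 0 [-] Reg 1 [+] Const 1)) t1))
           \<lparr>reg := (reg t1)(41 := base c0 + o')\<rparr>"
        have e: "exp_val inp ?s ((Mem (Reg 41 [+] Reg 33) [+] Reg 23 [-] Mem (Reg 41 [+] Reg 32) [*] Reg 34 [%] Reg 23) [%] Reg 23) = tt"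
          by (rule ev42) (use e1 in simp_all)
        have m1: "mkok mk (mem t1) (Zj 0)" using 5(2) by (simp add: J_def Zj_def)
        show ?case
          using e m1 ltb i1 TBtt 5(2) by (simp add: K_def J_def A_simps del: exp_val.simps) (simp add: i1)
      next
        case (2 j t)
        then obtain y yr where "drop j Y = y # yr" by (metis Cons_nth_drop_Suc)
        then show ?case using 2(2) by (simp add: K_def)
      next
        case (3 j t)
        note k = jr[OF kr(1)[OF 3(2)]] kr(2)[OF 3(2)]
        define y where "y = Y ! j"
        define i where "i = c * Q + h * H + y"
        have dr: "drop j Y = y # drop (Suc j) Y" unfolding y_def using 3(1) by (simp add: Cons_nth_drop_Suc)
        have yY: "y \<in> set Y" unfolding y_def using 3(1) by simp
        then have y: "y < H" "h * H + y < Q" "pcode Q p u h y mod pm = tt" using Yset by auto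
        have r43: "reg t 43 = y + 1" and ln: "lst (2 * n ^ 3) (mem t) (mem t (2 * n ^ 3 + y)) (drop (Suc j) Y)"
          using 3(2) by (simp_all add: K_def dr)
        have hi: "hit Q p pm u i" unfolding i_def using hit_iff(1)[OF y(1,2)] y(3) by (simp add: tt_def)
        have i3: "i < n ^ 3"
        proof -
          have "i < n + Q" unfolding i_def using cQ y(2) by linarith
          also have "\<dots> \<le> n + 2 * n ^ 2" using Q_le_n by simp
          also have "\<dots> \<le> 3 * n ^ 2" using n_pos by (simp add: power2_eq_square)
          also have "\<dots> \<le> n * n ^ 2" using n_big by (intro mult_right_mono) auto
          finally show ?thesis by (simp add: eval_nat_numeral)
        qed
        have iw: "c * Q + h * H + Suc y < 2 ^ w" "3 * n ^ 3 + i < 2 ^ w" "n ^ 3 + n ^ 3 + Suc y < 2 ^ w"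
        proof -
          show "c * Q + h * H + Suc y < 2 ^ w" using i3 unfolding i_def by (intro wd6 le6) linarith
          show "3 * n ^ 3 + i < 2 ^ w" using i3 small(4) by (intro wd6) linarith
          show "n ^ 3 + n ^ 3 + Suc y < 2 ^ w" using y(1) H_le_n small(1) small(4) by (intro wd6) linarith
        qed
        have s1: "take_bit w (2 ^ w + (c * Q + h * H + Suc y) - Suc 0) = i"
          using sub_word[of "Suc 0" "c * Q + h * H + Suc y" w] iw by (simp add: i_def)
        have s2: "take_bit w (2 ^ w + (n ^ 3 + n ^ 3 + Suc y) - Suc 0) = 2 * n ^ 3 + y"
          using sub_word[of "Suc 0" "n ^ 3 + n ^ 3 + Suc y" w] iw by simp
        have ev44: "exp_val inp t (Reg 40 [*] Reg 21 [+] Reg 30 [*] Reg 6 [+] Reg 43 [-] Const 1) = i"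
          using s1 chw iw by (simp add: iregsD[OF k(1)] k r43)
        define t2 where "t2 = (tick (1 + cost (Reg 40 [*] Reg 21 [+] Reg 30 [*] Reg 6 [+] Reg 43 [-] Const 1)) t)\<lparr>reg := (reg t)(44 := i)\<rparr>"
        have i2: "iregs (reg t2)" "reg t2 44 = i" "mem t2 = mem t" "reported t2 = reported t" "reg t2 43 = y + 1" using k(1) r43 by (simp_all add: t2_def)
        have evm: "exp_val inp t' (Reg 15 [+] Reg 15 [+] Reg 15 [+] Reg 44) = 3 * n ^ 3 + i" if "iregs (reg t')" "reg t' 44 = i" for t' :: ram_state
          using n3w iw that by (simp add: iregsD[OF that(1)])
        have gd2: "exp_val inp t2 ((Mem (Reg 15 [+] Reg 15 [+] Reg 15 [+] Reg 44) [=] Reg 20) [*] (Reg 44 [<] Reg 0 [-] Reg 1 [+] Const 1))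
             = of_bool (mem t (3 * n ^ 3 + i) = \<kappa> \<and> i \<le> n - m)"
        proof -
          have "exp_val inp t2 (Mem (Reg 15 [+] Reg 15 [+] Reg 15 [+] Reg 44) [=] Reg 20) = of_bool (mem t (3 * n ^ 3 + i) = \<kappa>)"
            using evm[OF i2(1,2)] i2 by (simp only: exp_val.simps apply_op.simps ram_input.simps iregsD[OF i2(1)])
          moreover have "exp_val inp t2 (Reg 44 [<] Reg 0 [-] Reg 1 [+] Const 1) = of_bool (i \<le> n - m)"
            using nm i2 by (simp add: iregsD[OF i2(1)] less_Suc_eq_le)
          ultimately show ?thesis by (simp only: exp_val.simps(7) apply_op.simps ram_input.simps) (simp add: of_bool_def)
        qed
        have At: "A t" and mkt: "mkok mk (mem t) (Zj j)" using 3(2) by (simp_all add: K_def)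
        have Zs: "Zj (Suc j) = insert i (Zj j)" using 3(1) by (simp add: Zj_def take_Suc_conv_app_nth i_def y_def)
        have ev43: "exp_val inp t' (Mem (Reg 15 [+] Reg 15 [+] Reg 43 [-] Const 1)) = mem t' (2 * n ^ 3 + y)"
          if "iregs (reg t')" "reg t' 43 = y + 1" for t' :: ram_state
          using that n3w iw s2 by (simp add: iregsD[OF that(1)])
        have y2: "2 * n ^ 3 + y' < 3 * n ^ 3" if "y' < H" for y' using that H_le_n small(1) by linarith
        show ?case
        proof (simp only: wp_Seq_simps ev44 t2_def[symmetric] gd2, cases "mem t (3 * n ^ 3 + i) = \<kappa> \<and> i \<le> n - m", goal_cases)
          case 1
          define M where "M = (mem t)(3 * n ^ 3 + i := \<kappa> + 1)"
          have mk0: "mem t (3 * n ^ 3 + i) = \<kappa>" "i \<le> n - m" using 1 by auto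
          have mi: "mk i = \<kappa>" using mkt mk0 by (auto simp: mkok_def split: if_splits)
          have mkM: "mkok mk M (Zj (Suc j))"
            using mkt mi hi unfolding mkok_def M_def Zs by auto
          have AM: "mem t' x = mem s x" if "mem t' = M" "x < 3 * n ^ 3 \<or> 4 * n ^ 3 \<le> x" for t' :: ram_state and x
            using At that i3 by (auto simp: A_def M_def)
          have lM: "lst (2 * n ^ 3) M v (drop (Suc j) Y) = lst (2 * n ^ 3) (mem t) v (drop (Suc j) Y)" for v
          proof (rule lst_cong)
            fix y' assume "y' \<in> set (drop (Suc j) Y)"
            then have "y' < H" using Yset in_set_dropD by metis
            then show "M (2 * n ^ 3 + y') = mem t (2 * n ^ 3 + y')" using y2[of y'] by (simp add: M_def)
          qed
          have My: "M (2 * n ^ 3 + y) = mem t (2 * n ^ 3 + y)" using y2[OF y(1)] by (simp add: M_def)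
          have R0: "reported t = {i. i \<le> n - m \<and> mem t (3 * n ^ 3 + i) = l ^ 2}" using At by (simp add: A_def repok_def)
          \<comment> \<open>A location whose mark equals the current round has not been reported,
            because the rounds are numbered below \<open>l ^ 2\<close>.\<close>
          have kl: "\<kappa> \<noteq> l ^ 2" using kb by simp
          have R1: "repok (if \<kappa> + 1 = l ^ 2 then insert i (reported t) else reported t) M"
            unfolding repok_def R0 M_def using mk0 kl by auto
          have ev20: "exp_val inp t' (Reg 20 [+] Const 1) = \<kappa> + 1" if "iregs (reg t')" for t' :: ram_state
            using that k1 by (simp add: iregsD[OF that])
          have ev13: "exp_val inp t' (Reg 20 [+] Const 1 [=] Reg 13) = of_bool (\<kappa> + 1 = l ^ 2)" if "iregs (reg t')" for t' :: ram_state
            using that k1 by (simp add: iregsD[OF that])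
          define t3 where "t3 = (tick (1 + cost (Reg 15 [+] Reg 15 [+] Reg 15 [+] Reg 44) + cost (Reg 20 [+] Const 1))
              (tick (1 + cost ((Mem (Reg 15 [+] Reg 15 [+] Reg 15 [+] Reg 44) [=] Reg 20) [*] (Reg 44 [<] Reg 0 [-] Reg 1 [+] Const 1))) t2))\<lparr>mem := M\<rparr>"
          have t3: "iregs (reg t3)" "reg t3 44 = i" "reg t3 43 = y + 1" "mem t3 = M" "reported t3 = reported t" "reg t3 = reg t2"
             "clock t3 = clock t + 42"
            using i2 by (simp_all add: t3_def t2_def)
          have e2: "eqf 41 (reg t2) (reg t1)" using 3(2) by (simp add: t2_def K_def)
          have body: "wp inp (Cond (Reg 20 [+] Const 1 [=] Reg 13) (Report (Reg 44)) Skip ;; Assign 43 (Mem (Reg 15 [+] Reg 15 [+] Reg 43 [-] Const 1))) t3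
              (\<lambda>s'. K (Suc j) s' \<and> clock s' \<le> clock t + 60)"
          proof (cases "\<kappa> + 1 = l ^ 2")
            case True
            show ?thesis
              apply (simp only: wp_Seq_simps ev13[OF t3(1)] True of_bool_eq one_neq_zero if_True not_False_eq_True simp_thms)
              apply (rule wp_Seq)
              using t3 True R1 AM lM My mkM ln e2 n3w iw s2
              by (simp add: K_def A_def iregsD[OF i2(1)] i2)
          next
            case False
            show ?thesis
              apply (simp only: wp_Seq_simps ev13[OF t3(1)] False of_bool_eq if_False simp_thms)
              using t3 False R1 AM lM My mkM ln e2 n3w iw s2
              by (simp add: K_def A_def iregsD[OF i2(1)] i2)
          qed
          have ti: "iregs (reg (tick x t2))" "reg (tick x t2) 44 = i" for x using i2 by simp_all
          have Meq: "(mem (tick x t2))(3 * n ^ 3 + i := \<kappa> + 1) = M" for x using i2 by (simp add: M_def)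
          show ?case
            using body
            by (simp only: 1 of_bool_eq one_neq_zero if_True not_False_eq_True simp_thms wp_Seq_simps evm[OF ti] ev20[OF ti(1)] Meq t3_def)
        next
          case 2
          have mkM: "mkok mk (mem t) (Zj (Suc j))"
          proof (cases "i \<le> n - m")
            case True
            then have "mem t (3 * n ^ 3 + i) \<noteq> \<kappa>" using 2 by simp
            then have "i \<in> Zj j \<or> mk i \<noteq> \<kappa>" using mkt True by (auto simp: mkok_def split: if_splits)
            then show ?thesis using mkt hi unfolding mkok_def Zs by auto
          next
            case False then show ?thesis using mkt unfolding mkok_def Zs by auto
          qed
          have e2: "eqf 41 (reg t2) (reg t1)" using 3(2) by (simp add: t2_def K_def)
          have ct2: "clock t2 = clock t + 12" by (simp add: t2_def)
          show ?case
            apply (simp only: 2 of_bool_eq if_False simp_thms wp_Seq_simps)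
            using mkM e2 At ln i2 ct2 n3w iw s2 by (simp add: K_def A_def iregsD[OF i2(1)])
        qed
      next
        case (4 t) then show ?case by (simp add: K_def)
      next
        case (5 j t x) then show ?case by (simp add: K_def A_simps)
      next
        case (6 t)
        have mkM: "mkok mk (mem t) (Z \<union> {i. i mod Q div H = h \<and> i div Q < Suc c})"
        proof -
          \<comment> \<open>\<open>mkok\<close> distinguishes members of \<open>Z\<close> only among
            hits, and a hit in row \<open>c\<close> and block \<open>h\<close> is exactly an entry
            of the bucket.\<close>
          have iff: "i \<in> Zj (length Y) \<longleftrightarrow> i \<in> Z \<union> {i. i mod Q div H = h \<and> i div Q < Suc c}" if hi: "hit Q p pm u i" for i
          proof
            assume "i \<in> Zj (length Y)"
            then show "i \<in> Z \<union> {i. i mod Q div H = h \<and> i div Q < Suc c}"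
              unfolding Zj_def using Yset hit_iff(2,3) by auto
          next
            assume a: "i \<in> Z \<union> {i. i mod Q div H = h \<and> i div Q < Suc c}"
            show "i \<in> Zj (length Y)"
            proof (cases "i \<in> Z \<or> i mod Q div H = h \<and> i div Q < c")
              case True then show ?thesis by (auto simp: Zj_def)
            next
              case False
              then have ic: "i mod Q div H = h" "i div Q = c" using a by (auto simp: less_Suc_eq)
              define y where "y = i mod Q mod H"
              have d: "i = c * Q + h * H + y" "y < H" using decomp[of i] ic by (simp_all add: y_def)
              have "i mod Q = h * H + y" using div_mult_mod_eq[of "i mod Q" H] ic by (simp add: y_def)
              then have "h * H + y < Q" using Q_pos mod_less_divisor[of Q i] by simp
              moreover have "pcode Q p u h y mod pm = tt" using hi ic by (simp add: hit_def tt_def y_def)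
              ultimately have "y \<in> set Y" using Yset d by simp
              then show ?thesis using d by (auto simp: Zj_def)
            qed
          qed
          show ?thesis using 6(1) iff unfolding K_def mkok_def by auto
        qed
        have "clock t \<le> clock t1 + (80 + 90 * cn c h)" using 6(2) Ylen by simp
        then show ?case using 6(1) mkM kr[OF 6(1)] by (simp add: J_def K_def A_simps)
      qed
    qed
  next
    case (6 k t x) then show ?case by (simp add: J_def A_simps)
  next
    case (7 t)
    have set: "{..<n div Q + 1} = {..n div Q}" by auto
    have sum: "(\<Sum>c<n div Q + 1. 80 + 90 * cn c h + cost (Reg 27) + 7) \<le> (\<Sum>c\<le>n div Q. 100 + 100 * cn c h)"
      unfolding set by (intro sum_mono) simp
    have "mkok mk (mem t) (Z \<union> {i. i mod Q div H = h})"
    proof -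
      have "i div Q < n div Q + 1" if "i \<le> n - m" for i
        using that div_le_mono[of i n Q] by linarith
      then show ?thesis using 7(1) unfolding J_def mkok_def by auto
    qed
    moreover have "clock t \<le> clock s + (\<Sum>c\<le>n div Q. 100 + 100 * cn c h) + 20" using 7(2) sum by simp
    ultimately show ?case using 7(1) by (intro post) (auto simp: J_def A_def)
  qed
qed

end

context prog begin

lemma chainok_cong:
  assumes "\<And>x. x < 2 * n ^ 3 \<Longrightarrow> M x = M' x"
  shows "chainok M = chainok M'"
proof -
  have "base c0 + b < 2 * n ^ 3" if "c0 < p" "b \<le> nb c0" for c0 b
    using base_le[OF that(1)] that(2) nb_le(2)[of c0] n_pos by linarith
  then show ?thesis unfolding chainok_def using assms by simp
qed

definition "block_time h = 50 * ee h + H * (100 * (ee h - ss h) + 200) + 200 + (\<Sum>c\<le>n div Q. 100 + 100 * cn c h)"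

lemma wp_block:
  assumes s: "iregs (reg s)" "tapeok (mem s)" "chainok (mem s)" "reg s 30 = h" "reg s 31 = TB"
    and h: "h \<le> Q div H" and TB: "4 * n ^ 3 \<le> TB" "TB + n ^ 3 \<le> n ^ 6"
    and zero: "\<And>x. TB \<le> x \<Longrightarrow> mem s x = 0"
    and mk: "mkok mk (mem s) Z" and rep: "repok (reported s) (mem s)"
    and post: "\<And>s'. eqf 31 (reg s') (reg s) \<Longrightarrow> reg s' 31 = TB + n ^ 3 \<Longrightarrow>
       (\<And>x. x < 2 * n ^ 3 \<Longrightarrow> mem s' x = mem s x) \<Longrightarrow> (\<And>x. TB + n ^ 3 \<le> x \<Longrightarrow> mem s' x = 0) \<Longrightarrow>
       mkok mk (mem s') (Z \<union> {i. i mod Q div H = h}) \<Longrightarrow> repok (reported s') (mem s') \<Longrightarrow>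
       clock s' \<le> clock s + block_time h \<Longrightarrow> R s'"
  shows "wp inp block_com s R"
  unfolding block_com_def
proof (rule wp_Seq, rule wp_window[OF s(1,2,4) h], rule wp_Seq, goal_cases)
  case (1 t)
  have it: "iregs (reg t)" "reg t 30 = h" "reg t 31 = TB"
    using s iregs_eqf[OF 1(1)] eqfD[OF 1(1), of 30] eqfD[OF 1(1), of 31] by simp_all
  show ?case
  proof (rule wp_insert[of t h TB], goal_cases)
    case 1 then show ?case using it by simp
  next
    case 2 then show ?case using 1(5) s by simp
  next
    case 7 then show ?case by (rule h)
  next
    case (10 x) then show ?case using 1(5) zero by simp
  next
    case (11 t2)
    have i2: "iregs (reg t2)" "reg t2 30 = h" "reg t2 31 = TB" "reg t2 32 = ss h" "reg t2 33 = ee h" "reg t2 34 = 2 ^ (w * (ee h - ss h)) mod pm"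
      using it 1 iregs_eqf[OF 11(1)] eqfD[OF 11(1), of 30] eqfD[OF 11(1), of 31] eqfD[OF 11(1), of 32] eqfD[OF 11(1), of 33] eqfD[OF 11(1), of 34] by simp_all
    have lo: "mem t2 x = mem s x" if "x < 2 * n ^ 3" for x using 11(2)[of x] 1(5) that by simp
    have mid: "mem t2 (3 * n ^ 3 + i) = mem s (3 * n ^ 3 + i)" if "i \<le> n - m" for i
    proof -
      have "i < n" using that m1 mn by linarith
      then have "i < n ^ 3" using small(1) by linarith
      then have "3 * n ^ 3 + i < TB" using TB by linarith
      then show ?thesis using 11(2)[of "3 * n ^ 3 + i"] 1(5) by simp
    qed
    have mk2: "mkok mk (mem t2) Z" using mk mid by (simp add: mkok_def)
    have rep2: "repok (reported t2) (mem t2)"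
    proof -
      have "reported t2 = reported s" using 11(4) 1(6) by simp
      moreover have "{i. i \<le> n - m \<and> mem t2 (3 * n ^ 3 + i) = l ^ 2} = {i. i \<le> n - m \<and> mem s (3 * n ^ 3 + i) = l ^ 2}" using mid by auto
      ultimately show ?thesis using rep by (simp add: repok_def)
    qed
    have ch2: "chainok (mem t2)" using s(3) chainok_cong[of "mem t2" "mem s"] lo by simp
    show ?case
    proof (rule wp_Seq, rule wp_query[OF i2 ch2 h TB 11(3) mk2 rep2], goal_cases)
      case (1 x) then show ?case .
    next
      case (2 t3)
      have e23: "eqf 31 (reg t3) (reg s)"
        using eqf_trans[OF 2(1) 11(1), of 40] eqf_trans[of 40 "reg t3" "reg t" 32 "reg s" 31] 1(1) by simp
      have r3: "reg t3 31 = TB" "reg t3 15 = n ^ 3"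
        using eqfD[OF 2(1), of 31] eqfD[OF 2(1), of 15] i2 iregsD[OF i2(1)] by simp_all
      have "TB + n ^ 3 < 2 ^ w" using TB by (intro wd6)
      then have ev: "exp_val inp t3 (Reg 31 [+] Reg 15) = TB + n ^ 3" using r3 by simp
      have mlo: "mem t3 x = mem s x" if "x < 2 * n ^ 3" for x using 2(2)[of x] lo[OF that] that by simp
      have mhi: "mem t3 x = 0" if "TB + n ^ 3 \<le> x" for x
        using 2(2)[of x] 11(2)[of x] 1(5) zero[of x] that TB by simp
      have "clock t3 \<le> clock s + 50 * ee h + H * (100 * (ee h - ss h) + 200) + (\<Sum>c\<le>n div Q. 100 + 100 * cn c h) + 140"
        using 1(7) 11(5) 2(5) by linarith
      then show ?case
        unfolding wp_Assign ev using e23 mlo mhi 2(3,4)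
        by (intro post) (auto simp: block_time_def)
    qed
  qed (use it 1 TB in auto)
qed

text \<open>The triple \<open>(h, c, y)\<close> is determined by the position
  \<open>c * Q + h * H + y\<close>, so the walked entries are distinct positions. The extra
  \<open>H\<close> covers positions that pass the guard at \<open>y = 0\<close> but lie beyond
  \<open>n - m\<close>.\<close>

lemma sum_cn: "(\<Sum>h\<le>Q div H. \<Sum>c\<le>n div Q. cn c h) \<le> card {i \<in> locations P T. hit Q p pm u i} + H"
proof -
  let ?A = "SIGMA h:{..Q div H}. SIGMA c:{..n div Q}. {y. c * Q + h * H \<le> n - m \<and> y < H \<and> h * H + y < Q \<and> pcode Q p u h y mod pm = tcode Q p u c h mod pm}"
  have c: "cn c h = card {y. c * Q + h * H \<le> n - m \<and> y < H \<and> h * H + y < Q \<and> pcode Q p u h y mod pm = tcode Q p u c h mod pm}" for c h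
    by (simp add: cn_def)
  have f: "finite {y. c * Q + h * H \<le> n - m \<and> y < H \<and> h * H + y < Q \<and> pcode Q p u h y mod pm = tcode Q p u c h mod pm}" for c h
    by (rule finite_subset[of _ "{..<H}"]) auto
  have "(\<Sum>h\<le>Q div H. \<Sum>c\<le>n div Q. cn c h) = card ?A"
    unfolding c using f by (subst card_SigmaI; simp add: finite_SigmaI)+
  also have "\<dots> = card ((\<lambda>(h, c, y). c * Q + h * H + y) ` ?A)"
  proof (rule card_image[symmetric], rule inj_onI, clarsimp)
    fix h c y h' c' y' :: nat
    assume a: "y < H" "h * H + y < Q" "y' < H" "h' * H + y' < Q" and e: "c * Q + h * H + y = c' * Q + h' * H + y'"
    have "(c * Q + h * H + y) div Q = (c' * Q + h' * H + y') div Q" "(c * Q + h * H + y) mod Q div H = (c' * Q + h' * H + y') mod Q div H"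
      "(c * Q + h * H + y) mod Q mod H = (c' * Q + h' * H + y') mod Q mod H" using e by simp_all
    then show "h = h' \<and> c = c' \<and> y = y'"
      unfolding hit_iff(2-4)[OF a(1,2)] hit_iff(2-4)[OF a(3,4)] by simp
  qed
  also have "\<dots> \<le> card ({i \<in> locations P T. hit Q p pm u i} \<union> {n - m + 1..<n - m + 1 + H})"
  proof (rule card_mono)
    show "finite ({i \<in> locations P T. hit Q p pm u i} \<union> {n - m + 1..<n - m + 1 + H})" by (simp add: locations_def)
    show "(\<lambda>(h, c, y). c * Q + h * H + y) ` ?A \<subseteq> {i \<in> locations P T. hit Q p pm u i} \<union> {n - m + 1..<n - m + 1 + H}"
    proof
      fix i assume "i \<in> (\<lambda>(h, c, y). c * Q + h * H + y) ` ?A"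
      then obtain h c y where i: "i = c * Q + h * H + y"
        and a: "c * Q + h * H \<le> n - m" "y < H" "h * H + y < Q" "pcode Q p u h y mod pm = tcode Q p u c h mod pm"
        by auto
      have "hit Q p pm u i" unfolding i using hit_iff(1)[OF a(2,3)] a(4) by simp
      moreover have "i < n - m + 1 + H" unfolding i using a by linarith
      ultimately show "i \<in> {i \<in> locations P T. hit Q p pm u i} \<union> {n - m + 1..<n - m + 1 + H}"
        by (cases "i < n - m + 1") (auto simp: locations_def lenT lenP)
    qed
  qed
  also have "\<dots> \<le> card {i \<in> locations P T. hit Q p pm u i} + H"
    using card_Un_le[of "{i \<in> locations P T. hit Q p pm u i}" "{n - m + 1..<n - m + 1 + H}"] by simp
  finally show ?thesis .
qed

definition "work_time = p * (100 * (n div g) + 200) + (\<Sum>h\<le>Q div H. 50 * ee h + H * (100 * (ee h - ss h) + 200) + 300) +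
   (Q div H + 1) * (n div Q + 1) * 100 + 100 * H + 100"

lemma wp_search:
  assumes s: "iregs (reg s)" "tapeok (mem s)" "reg s 31 = TB"
    and TB: "4 * n ^ 3 \<le> TB" "TB + (2 * n ^ 2 + 1) * n ^ 3 \<le> n ^ 6"
    and zero: "\<And>x. TB \<le> x \<Longrightarrow> mem s x = 0"
    and mk: "\<And>i. i \<le> n - m \<Longrightarrow> mem s (3 * n ^ 3 + i) = mk i" and rep: "repok (reported s) (mem s)"
    and post: "\<And>s'. eqf 30 (reg s') (reg s) \<Longrightarrow> reg s' 31 = TB + (Q div H + 1) * n ^ 3 \<Longrightarrow>
       (\<And>x. x < n ^ 3 \<Longrightarrow> mem s' x = mem s x) \<Longrightarrow> (\<And>x. TB + (Q div H + 1) * n ^ 3 \<le> x \<Longrightarrow> mem s' x = 0) \<Longrightarrow>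
       (\<And>i. i \<le> n - m \<Longrightarrow> mem s' (3 * n ^ 3 + i) = (if hit Q p pm u i \<and> mk i = \<kappa> then \<kappa> + 1 else mk i)) \<Longrightarrow>
       repok (reported s') (mem s') \<Longrightarrow>
       clock s' \<le> clock s + work_time + 100 * card {i \<in> locations P T. hit Q p pm u i} \<Longrightarrow> R s'"
  shows "wp inp (chain_com ;; For 30 (Reg 29) block_com) s R"
proof (rule wp_Seq, rule wp_chain[OF s(1,2)], goal_cases)
  case (1 t)
  have it: "iregs (reg t)" using s iregs_eqf[OF 1(1)] by simp
  have tt: "tapeok (mem t)" using s(2) tapeok_cong[of "mem t" "mem s"] 1(2) by simp
  have QH: "Q div H \<le> 2 * n ^ 2" using Q_le_n div_le_dividend[of Q H] by linarith
  define J where "J k t' \<longleftrightarrow> eqf 30 (reg t') (reg t) \<and> reg t' 31 = TB + k * n ^ 3 \<and>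
     (\<forall>x<2 * n ^ 3. mem t' x = mem t x) \<and> (\<forall>x\<ge>TB + k * n ^ 3. mem t' x = 0) \<and>
     mkok mk (mem t') {i. i mod Q div H < k} \<and> repok (reported t') (mem t')" for k and t' :: ram_state
  have hi: "mem t x = mem s x" if "2 * n ^ 3 \<le> x" for x using 1(2)[of x] that by simp
  show ?case
  proof (rule wp_For[where J = J and N = "Q div H + 1" and t = block_time], goal_cases)
    case 1
    have "mkok mk (mem t) {}" using mk hi by (simp add: mkok_def)
    moreover have "repok (reported t) (mem t)" using rep hi 1 \<open>reported t = reported s\<close> by (simp add: repok_def)
    moreover have "reg t 31 = TB" using eqfD[OF \<open>eqf 40 (reg t) (reg s)\<close>, of 31] s(3) by simp
    ultimately show ?case using hi TB zero by (simp add: J_def)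
  next
    case 2 then show ?case by simp
  next
    case 3
    have "2 * n ^ 2 + 1 < 2 ^ w"
    proof (rule wd6)
      have "(2 * n ^ 2 + 1) * 1 \<le> (2 * n ^ 2 + 1) * n ^ 3" using n_pos by (intro mult_left_mono) auto
      then have a: "2 * n ^ 2 + 1 \<le> (2 * n ^ 2 + 1) * n ^ 3" by (simp only: mult_1_right)
      have b: "(2 * n ^ 2 + 1) * n ^ 3 \<le> n ^ 6" using TB(2) by (rule add_leD2)
      show "2 * n ^ 2 + 1 \<le> n ^ 6" using a b by (rule order_trans)
    qed
    then show ?case using QH by simp
  next
    case (4 k t')
    then have "iregs (reg t')" using it iregs_eqf[of 30 "reg t'" "reg t"] by (simp add: J_def)
    then show ?case by (simp add: iregsD)
  next
    case (5 h t')
    have i: "iregs (reg t')" using 5(2) it iregs_eqf[of 30 "reg t'" "reg t"] by (simp add: J_def)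
    have lo: "mem t' x = mem t x" if "x < 2 * n ^ 3" for x using 5(2) that by (simp add: J_def)
    have tp: "tapeok (mem t')" using tt tapeok_cong[of "mem t'" "mem t"] lo by simp
    have ch: "chainok (mem t')" using 1(3) chainok_cong[of "mem t'" "mem t"] lo by simp
    have hQ: "h \<le> Q div H" using 5(1) by simp
    have "(h + 1) * n ^ 3 \<le> (2 * n ^ 2 + 1) * n ^ 3" using hQ QH by (intro mult_right_mono) linarith+
    then have "TB + (h + 1) * n ^ 3 \<le> n ^ 6" using TB(2) by linarith
    then have TBh: "4 * n ^ 3 \<le> TB + h * n ^ 3" "TB + h * n ^ 3 + n ^ 3 \<le> n ^ 6" using TB(1) by simp_all
    have r: "reg t' 31 = TB + h * n ^ 3" "\<And>x. TB + h * n ^ 3 \<le> x \<Longrightarrow> mem t' x = 0" "mkok mk (mem t') {i. i mod Q div H < h}"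
      "repok (reported t') (mem t')" using 5(2) by (auto simp: J_def)
    show ?case
    proof (rule wp_block[OF i tp ch 5(3) r(1) hQ TBh r(2-4)], goal_cases)
      case (1 x) then show ?case .
    next
      case (2 t2)
      have e: "eqf 30 (reg t2) (reg t)" using eqf_trans[OF 2(1), of 30 "reg t" 30] 5(2) by (simp add: J_def)
      have Zs: "{i. i mod Q div H < h} \<union> {i. i mod Q div H = h} = {i. i mod Q div H < Suc h}" by auto
      show ?case using 2(2-7) e lo eqfD[OF 2(1), of 30] 5(3) unfolding Zs by (simp add: J_def add_ac)
    qed
  next
    case (6 k t' x) then show ?case by (simp add: J_def)
  next
    case (7 t')
    have lo: "mem t' x = mem s x" if "x < n ^ 3" for x
    proof -
      have "mem t' x = mem t x" using 7(1) that by (simp add: J_def)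
      then show ?thesis using 1(2)[of x] that by simp
    qed
    have mk': "mem t' (3 * n ^ 3 + i) = (if hit Q p pm u i \<and> mk i = \<kappa> then \<kappa> + 1 else mk i)" if "i \<le> n - m" for i
    proof -
      have "i mod Q div H \<le> Q div H" using Q_pos by (intro div_le_mono) simp
      then show ?thesis using 7(1) that by (simp add: J_def mkok_def)
    qed
    have e: "eqf 30 (reg t') (reg s)" using eqf_trans[of 30 "reg t'" "reg t" 40 "reg s" 30] 7(1) 1(1) by (simp add: J_def)
    have set: "{..<Q div H + 1} = {..Q div H}" by auto
    have "(\<Sum>h<Q div H + 1. block_time h + cost (Reg 29) + 7)
        = (\<Sum>h\<le>Q div H. 50 * ee h + H * (100 * (ee h - ss h) + 200) + 208) + (\<Sum>h\<le>Q div H. \<Sum>c\<le>n div Q. 100 + 100 * cn c h)"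
      unfolding set block_time_def by (subst sum.distrib[symmetric], intro sum.cong refl) simp
    moreover have "(\<Sum>h\<le>Q div H. \<Sum>c\<le>n div Q. 100 + 100 * cn c h) = (Q div H + 1) * (n div Q + 1) * 100 + 100 * (\<Sum>h\<le>Q div H. \<Sum>c\<le>n div Q. cn c h)"
    proof -
      have "(\<Sum>c\<le>n div Q. 100 + 100 * cn c h) = (n div Q + 1) * 100 + 100 * (\<Sum>c\<le>n div Q. cn c h)" for h
        by (simp add: sum.distrib flip: sum_distrib_left)
      then have "(\<Sum>h\<le>Q div H. \<Sum>c\<le>n div Q. 100 + 100 * cn c h)
          = (\<Sum>h\<le>Q div H. (n div Q + 1) * 100) + (\<Sum>h\<le>Q div H. 100 * (\<Sum>c\<le>n div Q. cn c h))"
        by (subst sum.distrib[symmetric]) (intro sum.cong refl, simp only:)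
      also have "(\<Sum>h\<le>Q div H. (n div Q + 1) * 100) = (Q div H + 1) * (n div Q + 1) * 100"
        by (simp only: sum_constant card_atMost Suc_eq_plus1 mult.assoc of_nat_id)
      finally show ?thesis by (subst sum_distrib_left)
    qed
    moreover note sum_cn
    moreover have "(\<Sum>h\<le>Q div H. 50 * ee h + H * (100 * (ee h - ss h) + 200) + 208) \<le> (\<Sum>h\<le>Q div H. 50 * ee h + H * (100 * (ee h - ss h) + 200) + 300)"
      by (intro sum_mono) simp
    moreover have "clock t' \<le> clock t + (\<Sum>h<Q div H + 1. block_time h + cost (Reg 29) + 7) + 6"
      using 7(2) by simp
    ultimately have "clock t' \<le> clock s + work_time + 100 * card {i \<in> locations P T. hit Q p pm u i}"
      using 1(5) unfolding work_time_def by linarith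
    then show ?case using e lo mk' 7(1) by (intro post) (auto simp: J_def)
  qed
qed

end

section \<open>Running time of a round\<close>

lemma real_div_le: "real (a div b) \<le> real a / real b"
proof (cases "b = 0")
  case False
  have "real (a div b * b) \<le> real a" by (intro of_nat_mono) simp
  then show ?thesis using False by (simp add: field_simps)
qed simp

context par begin

text \<open>The first two terms pay for chains and queries, the second also for false candidates,
  the third for the pattern fingerprints and the scans.\<close>

definition "WW = real n / real D + real n / real L + (real L)\<^sup>2 * (real m / real D)"

lemma WW_ge:
  "real n / real D \<le> WW" "real n / real L \<le> WW" "(real L)\<^sup>2 * (real m / real D) \<le> WW" "(real L)\<^sup>2 \<le> WW"
  "real L * (real m / real D) \<le> WW" "real L \<le> WW" "1 \<le> WW" "real n / real mu \<le> WW" "real D / real mu \<le> WW"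
proof -
  have L: "1 \<le> real L" and D: "1 \<le> real D" and md: "1 \<le> real m / real D"
    using L_ge1 D_ge1 D_le_m by (simp_all add: field_simps)
  have p: "0 \<le> real n / real D" "0 \<le> real n / real L" "0 \<le> (real L)\<^sup>2 * (real m / real D)" by simp_all
  then show "real n / real D \<le> WW" "real n / real L \<le> WW" and c: "(real L)\<^sup>2 * (real m / real D) \<le> WW"
    by (simp_all add: WW_def)
  have LL: "real L \<le> (real L)\<^sup>2" using mult_right_mono[OF L, of "real L"] by (simp add: power2_eq_square)
  have "(real L)\<^sup>2 * 1 \<le> (real L)\<^sup>2 * (real m / real D)" using md by (intro mult_left_mono) auto
  then show s: "(real L)\<^sup>2 \<le> WW" using c by simp
  have "real L * (real m / real D) \<le> (real L)\<^sup>2 * (real m / real D)" using LL by (intro mult_right_mono) auto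
  then show "real L * (real m / real D) \<le> WW" using c by simp
  show "real L \<le> WW" using LL s by linarith
  then show "1 \<le> WW" using L by simp
  show nm: "real n / real mu \<le> WW"
  proof (cases "D \<le> L")
    case True then show ?thesis using p unfolding mu_def WW_def by (simp add: min_def)
  next
    case False then show ?thesis using p unfolding mu_def WW_def by (simp add: min_def)
  qed
  have "real D / real mu \<le> real n / real mu" using D_le_n by (intro divide_right_mono) auto
  then show "real D / real mu \<le> WW" using nm by linarith
qed

definition "pick_time = l ^ 3 * (60 * l ^ 2 * YQ + 60) + l ^ 3 * (60 * l ^ 2 * Yp + 60) + l ^ 3 * (60 * l ^ 2 * Yi + 60) + 200"

lemma l_pow_le: "j \<le> k \<Longrightarrow> real l ^ j \<le> real l ^ k" using l1000 by (intro power_increasing) auto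

text \<open>Trial division is linear in the range, and the three ranges are bounded by
  \<open>L^2\<close>, by \<open>D / mu \<le> n / mu\<close> and by \<open>L * (m / D)\<close>, up to
  constants and powers of \<open>l\<close>.\<close>

lemma pick_time_le: "real pick_time \<le> 700 * real l ^ 12 * WW"
proof -
  have Q: "real YQ \<le> real l ^ 3 * WW"
  proof -
    have "L * mu \<le> L ^ 2" using mu_le by (simp add: power2_eq_square)
    then have "real (L * mu) \<le> (real L)\<^sup>2" by (metis of_nat_mono of_nat_power)
    then have "real (L * mu) * real l ^ 3 \<le> WW * real l ^ 3" using WW_ge(4) by (intro mult_right_mono) auto
    then show ?thesis by (simp add: YQ_def mult.commute)
  qed
  have p: "real Yp \<le> real l ^ 3 * WW"
  proof -
    have "real (D div mu) = real D / real mu" using mu_dvd_D by (rule real_of_nat_div)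
    then have "real (D div mu) * real l ^ 3 \<le> WW * real l ^ 3" using WW_ge(9) by (intro mult_right_mono) auto
    then show ?thesis by (simp add: Yp_def mult.commute)
  qed
  have i: "real Yi \<le> 2 * real l ^ 6 * WW"
  proof -
    have "real (m div D) \<le> real m / real D" by (rule real_div_le)
    moreover have "1 \<le> real m / real D" using D_ge1 D_le_m by (simp add: field_simps)
    ultimately have "real (m div D + 1) \<le> 2 * (real m / real D)" by simp
    then have "real L * real (m div D + 1) \<le> real L * (2 * (real m / real D))" by (rule mult_left_mono) simp
    also have "real L * (2 * (real m / real D)) = 2 * (real L * (real m / real D))" by simp
    also have "\<dots> \<le> 2 * WW" using WW_ge(5) by (intro mult_left_mono) auto
    finally have "real L * real (m div D + 1) * real l ^ 6 \<le> 2 * WW * real l ^ 6" by (rule mult_right_mono) simp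
    then show ?thesis by (simp add: Yi_def algebra_simps)
  qed
  have "real l ^ 3 * WW \<le> real l ^ 6 * WW" using l_pow_le[of 3 6] WW_ge(7) by (intro mult_right_mono) auto
  then have s: "real YQ + real Yp + real Yi \<le> 4 * (real l ^ 6 * WW)" using Q p i by linarith
  have "real pick_time = 60 * real l ^ 5 * (real YQ + real Yp + real Yi) + 180 * real l ^ 3 + 200"
    by (simp add: pick_time_def algebra_simps eval_nat_numeral)
  also have "\<dots> \<le> 60 * real l ^ 5 * (4 * (real l ^ 6 * WW)) + 180 * real l ^ 3 + 200"
    using s by (intro add_right_mono mult_left_mono) auto
  also have "60 * real l ^ 5 * (4 * (real l ^ 6 * WW)) = 240 * (real l ^ 11 * WW)" by (simp add: eval_nat_numeral)
  also have "\<dots> + 180 * real l ^ 3 + 200 \<le> 240 * (real l ^ 12 * WW) + 180 * (real l ^ 12 * WW) + 200 * (real l ^ 12 * WW)"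
  proof (intro add_mono mult_left_mono)
    show "real l ^ 11 * WW \<le> real l ^ 12 * WW" using l_pow_le[of 11 12] WW_ge(7) by (intro mult_right_mono) auto
    show "real l ^ 3 \<le> real l ^ 12 * WW" using mult_mono[OF l_pow_le[of 3 12] WW_ge(7)] by simp
    show "200 \<le> 200 * (real l ^ 12 * WW)" using mult_mono[OF l_pow_le[of 0 12] WW_ge(7)] by simp
  qed auto
  also have "\<dots> \<le> 700 * real l ^ 12 * WW" using WW_ge(7) by simp
  finally show ?thesis .
qed

end

context prog begin

lemma work_le: "real work_time \<le> 32000 * real l ^ 12 * WW"
proof -
  have l0: "1 \<le> real l" using l1000 by simp
  have mu8: "mu \<le> 8 * H"
  proof -
    have "mu div 4 \<le> H" by (simp add: H_def)
    then show ?thesis using H_ge1 by linarith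
  qed
  have Dg: "1 / real g \<le> (real l)\<^sup>2 / real D"
  proof -
    have "real D \<le> (real l)\<^sup>2 * real g" using D_le_g by (metis of_nat_mono of_nat_mult of_nat_power)
    then show ?thesis using g_ge1 D_ge1 by (simp add: field_simps)
  qed
  have Qr: "real Q \<le> 2 * real l ^ 5 * real L * real mu"
  proof -
    have "Q \<le> 2 * l ^ 5 * L * mu" using Q_le by (simp add: YQ_def eval_nat_numeral algebra_simps)
    then have "real Q \<le> real (2 * l ^ 5 * L * mu)" by (rule of_nat_mono)
    then show ?thesis by simp
  qed
  have mum: "real mu \<le> real D" "real mu \<le> real L" "1 \<le> real mu" using mu_le mu_ge1 by simp_all
  have HQ: "H \<le> Q"
  proof -
    have "1 * mu * 1 \<le> L * mu * l ^ 3" using L_ge1 l_pos by (intro mult_mono) auto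
    then have "mu \<le> YQ" unfolding YQ_def by (simp only: mult_1_left mult_1_right)
    then show ?thesis using H_le(2) Qb(1) by linarith
  qed
  \<comment> \<open>The number of blocks, at most about \<open>L\<close> since \<open>H\<close> is
    within a constant factor of \<open>mu\<close>.\<close>
  define nh where "nh = real (Q div H + 1)"
  have nh1: "nh * real H \<le> 2 * real Q"
  proof -
    have "(Q div H + 1) * H \<le> 2 * Q"
      using HQ div_times_less_eq_dividend[of Q H] unfolding ring_distribs by linarith
    then have "real ((Q div H + 1) * H) \<le> real (2 * Q)" by (rule of_nat_mono)
    then show ?thesis unfolding nh_def by (simp only: of_nat_mult of_nat_numeral)
  qed
  have nh2: "nh \<le> 32 * real l ^ 5 * real L"
  proof -
    have "real mu \<le> 8 * real H" using mu8 by linarith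
    then have "nh * real mu \<le> nh * (8 * real H)" by (rule mult_left_mono) (simp add: nh_def)
    also have "\<dots> \<le> 16 * real Q" using nh1 by simp
    also have "\<dots> \<le> 32 * real l ^ 5 * real L * real mu" using Qr by linarith
    finally show ?thesis by (rule mult_right_le_imp_le) (use mum(3) in simp)
  qed
  have len: "real (ee h - ss h) \<le> 4 * (real l)\<^sup>2 * (real m / real D)" for h
  proof -
    have "real (ee h - ss h) \<le> real (2 * l ^ 2 * (m div D + 1))" using len_le2[of h] by (rule of_nat_mono)
    also have "\<dots> = 2 * (real l)\<^sup>2 * real (m div D + 1)" by (simp only: of_nat_mult of_nat_numeral of_nat_power)
    also have "\<dots> \<le> 2 * (real l)\<^sup>2 * (2 * (real m / real D))"
    proof (intro mult_left_mono)
      have "real (m div D) \<le> real m / real D" by (rule real_div_le)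
      moreover have "1 \<le> real m / real D" using D_ge1 D_le_m by (simp add: field_simps)
      ultimately show "real (m div D + 1) \<le> 2 * (real m / real D)" by simp
    qed simp
    finally show ?thesis by simp
  qed
  have ss: "real (ss h) \<le> 4 * real l ^ 7 * real L + 1" if "h \<le> Q div H" for h
  proof -
    have "h * H \<le> Q div H * H" using that by (rule mult_right_mono) simp
    also have "\<dots> \<le> Q" by simp
    finally have "h * H + H \<le> 2 * Q" using HQ by simp
    then have a: "(h * H + H) div g + 1 \<le> 2 * Q div g + 1" by (intro add_right_mono div_le_mono)
    have "real (ss h) \<le> real (2 * Q div g + 1)" using st_le[of h] a by (intro of_nat_mono) linarith
    also have "\<dots> \<le> real (2 * Q) / real g + 1" using real_div_le[of "2 * Q" g] by simp
    also have "real (2 * Q) / real g = 2 * real Q * (1 / real g)" by simp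
    also have "\<dots> \<le> 2 * (2 * real l ^ 5 * real L * real mu) * ((real l)\<^sup>2 / real D)"
      using Qr Dg by (intro mult_mono) auto
    also have "\<dots> = 4 * real l ^ 7 * real L * (real mu / real D)" by (simp add: eval_nat_numeral)
    also have "\<dots> \<le> 4 * real l ^ 7 * real L * 1"
      using mum D_ge1 by (intro mult_left_mono) (auto simp: field_simps)
    finally show ?thesis by simp
  qed
  have lift: "real l ^ j * x \<le> real l ^ 12 * WW" if "j \<le> 12" "x \<le> WW" "0 \<le> x" for j x
    using l_pow_le[OF that(1)] that by (intro mult_mono) auto
  \<comment> \<open>Chains: \<open>p\<close>, about \<open>D / mu\<close>, chains of about
    \<open>n / D\<close> samples give \<open>n / mu\<close>.\<close>
  have A: "real (p * (100 * (n div g) + 200)) \<le> 600 * (real l ^ 12 * WW)"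
  proof -
    have pr: "real p \<le> 2 * real l ^ 5 * (real D / real mu)"
    proof -
      have "p \<le> 2 * l ^ 5 * (D div mu)" using p_le by (simp add: Yp_def eval_nat_numeral algebra_simps)
      then have "real p \<le> real (2 * l ^ 5 * (D div mu))" by (rule of_nat_mono)
      also have "\<dots> = 2 * real l ^ 5 * (real D / real mu)" using real_of_nat_div[OF mu_dvd_D] by simp
      finally show ?thesis .
    qed
    have ng: "real (n div g) \<le> real n * ((real l)\<^sup>2 / real D)"
    proof -
      have "real (n div g) \<le> real n * (1 / real g)" using real_div_le[of n g] by simp
      also have "\<dots> \<le> real n * ((real l)\<^sup>2 / real D)" using Dg by (rule mult_left_mono) simp
      finally show ?thesis .
    qed
    have "real p * real (n div g) \<le> 2 * real l ^ 5 * (real D / real mu) * (real n * ((real l)\<^sup>2 / real D))"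
      using pr ng by (intro mult_mono) auto
    also have "\<dots> = 2 * (real l ^ 7 * (real n / real mu))" using D_ge1 by (simp add: eval_nat_numeral)
    also have "\<dots> \<le> 2 * (real l ^ 12 * WW)" using lift[of 7 "real n / real mu"] WW_ge(8) by simp
    finally have 1: "real p * real (n div g) \<le> 2 * (real l ^ 12 * WW)" .
    have 2: "real p \<le> 2 * (real l ^ 12 * WW)" using pr lift[of 5 "real D / real mu"] WW_ge(9) by simp
    have "real (p * (100 * (n div g) + 200)) = 100 * (real p * real (n div g)) + 200 * real p" by (simp add: algebra_simps)
    then show ?thesis using 1 2 by linarith
  qed
  have nhL: "nh * x \<le> 32 * (real l ^ 5 * (real L * x))" if "0 \<le> x" for x
    using mult_right_mono[OF nh2 that] by (simp add: mult.assoc)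
  \<comment> \<open>Window scans. The exponent 12 arises here: \<open>l ^ 5 * L\<close> blocks, each
    scanning up to \<open>l ^ 7 * L\<close> samples.\<close>
  have B: "(\<Sum>h\<le>Q div H. 50 * real (ee h)) \<le> 14400 * (real l ^ 12 * WW)"
  proof -
    have "(\<Sum>h\<le>Q div H. 50 * real (ee h)) \<le> (\<Sum>h\<le>Q div H. 50 * (4 * real l ^ 7 * real L + 1 + 4 * (real l)\<^sup>2 * (real m / real D)))"
    proof (intro sum_mono mult_left_mono)
      fix h assume "h \<in> {..Q div H}"
      then have "real (ss h) \<le> 4 * real l ^ 7 * real L + 1" using ss by simp
      moreover have "real (ee h) = real (ss h) + real (ee h - ss h)" using st_le_en[of h] by (simp add: of_nat_diff)
      ultimately show "real (ee h) \<le> 4 * real l ^ 7 * real L + 1 + 4 * (real l)\<^sup>2 * (real m / real D)" using len[of h] by linarith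
    qed simp
    also have "\<dots> = nh * (50 * (4 * real l ^ 7 * real L + 1 + 4 * (real l)\<^sup>2 * (real m / real D)))"
      by (simp add: nh_def)
    also have "\<dots> = 200 * real l ^ 7 * (nh * real L) + 50 * nh + 200 * (real l)\<^sup>2 * (nh * (real m / real D))"
      by (simp only: ring_distribs mult_ac) simp
    also have "\<dots> \<le> 200 * real l ^ 7 * (32 * (real l ^ 5 * (real L * real L))) + 50 * (32 * (real l ^ 5 * (real L * 1))) + 200 * (real l)\<^sup>2 * (32 * (real l ^ 5 * (real L * (real m / real D))))"
      using nhL[of "real L"] nhL[of 1] nhL[of "real m / real D"] by (intro add_mono mult_left_mono) auto
    also have "\<dots> = 6400 * (real l ^ 12 * (real L)\<^sup>2) + 1600 * (real l ^ 5 * real L) + 6400 * (real l ^ 7 * (real L * (real m / real D)))"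
      by (simp add: eval_nat_numeral)
    also have "\<dots> \<le> 14400 * (real l ^ 12 * WW)"
      using lift[of 12 "(real L)\<^sup>2"] lift[of 5 "real L"] lift[of 7 "real L * (real m / real D)"] WW_ge by simp
    finally show ?thesis .
  qed
  \<comment> \<open>Pattern fingerprints: the blocks together have about \<open>Q\<close> shifts,
    each with about \<open>m / D\<close> samples.\<close>
  have C: "(\<Sum>h\<le>Q div H. real H * (100 * real (ee h - ss h) + 200)) \<le> 2400 * (real l ^ 12 * WW)"
  proof -
    have "(\<Sum>h\<le>Q div H. real H * (100 * real (ee h - ss h) + 200)) \<le> (\<Sum>h\<le>Q div H. real H * (600 * (real l)\<^sup>2 * (real m / real D)))"
    proof (intro sum_mono mult_left_mono)
      fix h
      have "1 \<le> (real l)\<^sup>2 * (real m / real D)"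
        using mult_mono[of 1 "(real l)\<^sup>2" 1 "real m / real D"] l0 D_ge1 D_le_m by (simp add: field_simps one_le_power)
      then show "100 * real (ee h - ss h) + 200 \<le> 600 * (real l)\<^sup>2 * (real m / real D)" using len[of h] by linarith
    qed simp
    also have "\<dots> = nh * real H * (600 * (real l)\<^sup>2 * (real m / real D))" by (simp add: nh_def)
    also have "\<dots> \<le> 2 * real Q * (600 * (real l)\<^sup>2 * (real m / real D))" using nh1 by (rule mult_right_mono) simp
    also have "\<dots> \<le> 2 * (2 * real l ^ 5 * real L * real L) * (600 * (real l)\<^sup>2 * (real m / real D))"
    proof (intro mult_right_mono mult_left_mono)
      have "2 * real l ^ 5 * real L * real mu \<le> 2 * real l ^ 5 * real L * real L" using mum by (intro mult_left_mono) auto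
      then show "real Q \<le> 2 * real l ^ 5 * real L * real L" using Qr by linarith
    qed auto
    also have "\<dots> = 2400 * (real l ^ 7 * ((real L)\<^sup>2 * (real m / real D)))" by (simp add: eval_nat_numeral)
    also have "\<dots> \<le> 2400 * (real l ^ 12 * WW)" using lift[of 7 "(real L)\<^sup>2 * (real m / real D)"] WW_ge(3) by simp
    finally show ?thesis .
  qed
  have nhW: "nh \<le> 32 * (real l ^ 12 * WW)" using nhL[of 1] lift[of 5 "real L"] WW_ge(6) by simp
  \<comment> \<open>Queries: \<open>Q / H\<close> blocks times \<open>n / Q\<close> rows, that is
    about \<open>n / mu\<close>.\<close>
  have E: "nh * real (n div Q + 1) \<le> 48 * (real l ^ 12 * WW)"
  proof -
    have "nh * real (n div Q) \<le> nh * (real n / real Q)" by (intro mult_left_mono real_div_le) (simp add: nh_def)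
    also have "\<dots> \<le> 16 * (real n / real mu)"
    proof -
      have "nh * real mu \<le> 16 * real Q"
      proof -
        have "real mu \<le> 8 * real H" using mu8 by linarith
        then have "nh * real mu \<le> nh * (8 * real H)" by (rule mult_left_mono) (simp add: nh_def)
        then show ?thesis using nh1 by simp
      qed
      then have "nh * real mu * real n \<le> 16 * real Q * real n" by (rule mult_right_mono) simp
      then show ?thesis using Q_pos mum by (simp add: field_simps)
    qed
    also have "\<dots> \<le> 16 * (real l ^ 12 * WW)" using lift[of 0 "real n / real mu"] WW_ge(8) by simp
    finally have "nh * real (n div Q) \<le> 16 * (real l ^ 12 * WW)" .
    then show ?thesis using nhW by (simp add: ring_distribs)
  qed
  have Fh: "real H \<le> real l ^ 12 * WW" "1 \<le> real l ^ 12 * WW"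
  proof -
    have "real H \<le> WW" using H_le(2) mum WW_ge(6) by linarith
    then show "real H \<le> real l ^ 12 * WW" using lift[of 0 "real H"] by simp
    show "1 \<le> real l ^ 12 * WW" using lift[of 0 1] WW_ge(7) by simp
  qed
  have sumsplit: "real (\<Sum>h\<le>Q div H. 50 * ee h + H * (100 * (ee h - ss h) + 200) + 300) =
     (\<Sum>h\<le>Q div H. 50 * real (ee h)) + (\<Sum>h\<le>Q div H. real H * (100 * real (ee h - ss h) + 200)) + 300 * nh"
    by (simp add: sum.distrib nh_def)
  have "real work_time = real (p * (100 * (n div g) + 200)) + real (\<Sum>h\<le>Q div H. 50 * ee h + H * (100 * (ee h - ss h) + 200) + 300) +
      100 * (nh * real (n div Q + 1)) + 100 * real H + 100"
    unfolding work_time_def nh_def by (simp only: of_nat_add of_nat_mult of_nat_numeral)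
  then show ?thesis using A B C E Fh nhW unfolding sumsplit by linarith
qed

end

section \<open>A complete round within the sequence of rounds\<close>

lemma tick_tick: "tick a (tick b s) = tick (a + b) s"
  by (simp add: tick_def)

context par begin

definition "pregs f \<longleftrightarrow> f (0::nat) = n \<and> f 1 = m \<and> f 6 = H \<and> f 7 = g \<and> f 8 = YQ \<and> f 9 = Yp \<and> f 10 = Yi \<and>
   f 11 = l ^ 3 \<and> f 12 = l ^ 2 \<and> f 13 = l ^ 2 \<and> f 14 = tb \<and> f 15 = n ^ 3 \<and> f 16 = 2 * n"

definition "ltape = l ^ 2 * tb"

lemma ltape_le: "ltape \<le> n" "ltape \<le> n ^ 3"
proof -
  have "ltape = L * l ^ 15" by (simp add: ltape_def tb_def eval_nat_numeral algebra_simps)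
  then show 1: "ltape \<le> n" using Ll_le[of 15] by simp
  have "n \<le> n ^ 3" using n_pos by (simp add: self_le_power)
  then show "ltape \<le> n ^ 3" using 1 by linarith
qed

text \<open>Number of initial rounds survived: after the first miss the value stays behind the round
  number for good, so it equals \<open>\<kappa>\<close> only if all earlier rounds were
  hits.\<close>

primrec mkf :: "(nat \<Rightarrow> nat) \<Rightarrow> nat \<Rightarrow> nat \<Rightarrow> nat" where
  "mkf \<omega> 0 i = 0"
| "mkf \<omega> (Suc \<kappa>) i = (if hitk \<omega> \<kappa> i \<and> mkf \<omega> \<kappa> i = \<kappa> then \<kappa> + 1 else mkf \<omega> \<kappa> i)"

lemma mkf_eq: "mkf \<omega> \<kappa> i \<le> \<kappa>" "mkf \<omega> \<kappa> i = \<kappa> \<longleftrightarrow> (\<forall>j<\<kappa>. hitk \<omega> j i)"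
proof (induction \<kappa>)
  case 0
  { case 1 then show ?case by simp next case 2 then show ?case by simp }
next
  case (Suc \<kappa>)
  { case 1 then show ?case using Suc by auto
  next
    case 2 then show ?case using Suc by (auto simp: less_Suc_eq)
  }
qed

definition "cands \<omega> \<kappa> = card {i \<in> locations P T. hitk \<omega> \<kappa> i}"

text \<open>The number of head tables consumed is \<open>Q div H + 1\<close> and depends on the
  random \<open>Q\<close>; the postcondition therefore only bounds the new table base
  \<open>TB'\<close>.\<close>

lemma wp_inst:
  assumes s: "pregs (reg s)" "reg s 20 = \<kappa>" "reg s 31 = TB" and k: "\<kappa> < l ^ 2"
    and TB: "4 * n ^ 3 \<le> TB" "TB + (2 * n ^ 2 + 1) * n ^ 3 \<le> n ^ 6"
    and zero: "\<And>x. TB \<le> x \<Longrightarrow> mem s x = 0"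
    and tape: "\<And>x. x < ltape \<Longrightarrow> mem s x = \<omega> x"
    and mk: "\<And>i. i \<le> n - m \<Longrightarrow> mem s (3 * n ^ 3 + i) = mkf \<omega> \<kappa> i"
    and rep: "reported s = {i. i \<le> n - m \<and> mem s (3 * n ^ 3 + i) = l ^ 2}"
    and post: "\<And>s' TB'. (\<forall>r<21. reg s' r = reg s r) \<Longrightarrow> reg s' 31 = TB' \<Longrightarrow>
       TB \<le> TB' \<Longrightarrow> TB' \<le> TB + (2 * n ^ 2 + 1) * n ^ 3 \<Longrightarrow>
       (\<And>x. x < ltape \<Longrightarrow> mem s' x = \<omega> x) \<Longrightarrow> (\<And>x. TB' \<le> x \<Longrightarrow> mem s' x = 0) \<Longrightarrow>
       (\<And>i. i \<le> n - m \<Longrightarrow> mem s' (3 * n ^ 3 + i) = mkf \<omega> (Suc \<kappa>) i) \<Longrightarrow>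
       reported s' = {i. i \<le> n - m \<and> mem s' (3 * n ^ 3 + i) = l ^ 2} \<Longrightarrow>
       real (clock s') \<le> real (clock s) + 33000 * real l ^ 12 * WW + 100 * real (cands \<omega> \<kappa>) \<Longrightarrow> R s'"
  shows "wp inp inst_com s R"
proof -
  have kt: "\<kappa> * tb + tb \<le> ltape"
  proof -
    have "(\<kappa> + 1) * tb \<le> l ^ 2 * tb" using k by (intro mult_right_mono) auto
    then show ?thesis by (simp add: ltape_def)
  qed
  have n36: "n ^ 3 \<le> n ^ 6" using n_pos by (intro power_increasing) auto
  have e23: "2 * l ^ 3 = l ^ 3 + l ^ 3" "3 * l ^ 3 = l ^ 3 + (l ^ 3 + l ^ 3)" by simp_all
  have wd: "x < 2 ^ w" if "x \<le> n ^ 6" for x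
    using that power_increasing[of 6 7 n] n_pos by (intro word_lt) linarith
  have wt: "x < 2 ^ w" if "x \<le> ltape" for x using that ltape_le n36 by (intro wd) linarith
  have offs: "\<kappa> * tb + 3 * l ^ 3 \<le> ltape" using kt L3_le by linarith
  have p0: "reg s 0 = n" "reg s 6 = H" "reg s 7 = g" "reg s 8 = YQ" "reg s 9 = Yp" "reg s 10 = Yi"
    "reg s 11 = l ^ 3" "reg s 12 = l ^ 2" "reg s 14 = tb" "reg s (Suc 0) = m" "reg s 13 = l ^ 2" "reg s 15 = n ^ 3" "reg s 16 = 2 * n"
    using s(1) by (simp_all add: pregs_def)
  have rd: "(\<lambda>t. mem s (off + t)) t = \<omega> (off + t)" if "off + l ^ 3 \<le> ltape" "t < l ^ 3" for off t
    using tape that by simp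
  have w3: "\<kappa> * tb < 2 ^ w" "\<kappa> * tb + l ^ 3 < 2 ^ w" "\<kappa> * tb + l ^ 3 + l ^ 3 < 2 ^ w" "\<kappa> * tb + l ^ 3 + l ^ 3 + l ^ 3 < 2 ^ w"
    using offs wt[of "\<kappa> * tb + 3 * l ^ 3"] by linarith+
  have ev: "exp_val inp s (Reg 20 [*] Reg 14) = \<kappa> * tb"
    using w3 s p0 by simp
  have o3: "\<kappa> * tb + l ^ 3 \<le> n ^ 3" "(\<kappa> * tb + l ^ 3) + l ^ 3 \<le> n ^ 3" "(\<kappa> * tb + l ^ 3 + l ^ 3) + l ^ 3 \<le> n ^ 3"
    using offs ltape_le by linarith+
  have Y2: "l ^ 2 * YQ \<le> n ^ 2" "l ^ 2 * Yp \<le> n ^ 2" "l ^ 2 * Yi \<le> n ^ 2" using YQ_le Yp_le Yi_le by auto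
  show ?thesis
    unfolding inst_com_def
  proof (simp only: wp_Seq_simps ev, rule wp_Seq, rule wp_pick[where Y = YQ and off = "\<kappa> * tb"], goal_cases)
    case (11 s1)
    have r1: "r < 40 \<Longrightarrow> r \<noteq> 21 \<Longrightarrow> reg s1 r = reg s r" for r using 11(1)[of r] by simp
    have Q1: "reg s1 21 = Qk \<omega> \<kappa>"
    proof -
      have "pick YQ (l ^ 2 * YQ) (\<lambda>t. mem s (\<kappa> * tb + t)) (l ^ 3) = Qk \<omega> \<kappa>"
        unfolding Qk_def using rd[of "\<kappa> * tb"] offs by (intro pick_cong) auto
      then show ?thesis using 11(2) by simp
    qed
    have m1: "mem s1 = mem s" "reported s1 = reported s" using 11(3,4) by simp_all
    have ev1: "exp_val inp s1 (Reg 20 [*] Reg 14 [+] Reg 11) = \<kappa> * tb + l ^ 3"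
      using w3 r1 s p0 by simp
    show ?case
    proof (simp only: wp_Seq_simps ev1, rule wp_Seq, rule wp_pick[where Y = Yp and off = "\<kappa> * tb + l ^ 3"], goal_cases)
      case (11 s2)
      have r2: "r < 40 \<Longrightarrow> r \<noteq> 21 \<Longrightarrow> r \<noteq> 22 \<Longrightarrow> reg s2 r = reg s r" "reg s2 21 = Qk \<omega> \<kappa>" for r
        using 11(1)[of r] 11(1)[of 21] r1[of r] Q1 by simp_all
      have p2: "reg s2 22 = pk \<omega> \<kappa>"
      proof -
        have "pick Yp (l ^ 2 * Yp) (\<lambda>t. mem s (\<kappa> * tb + l ^ 3 + t)) (l ^ 3) = pk \<omega> \<kappa>"
          unfolding pk_def using rd[of "\<kappa> * tb + l ^ 3"] offs by (intro pick_cong) auto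
        then show ?thesis using 11(2) m1 by simp
      qed
      have m2: "mem s2 = mem s" "reported s2 = reported s" using 11(3,4) m1 by simp_all
      have ev2: "exp_val inp s2 (Reg 20 [*] Reg 14 [+] Reg 11 [+] Reg 11) = \<kappa> * tb + l ^ 3 + l ^ 3"
        using w3 r2 s p0 by simp
      show ?case
      proof (simp only: wp_Seq_simps ev2, rule wp_Seq, rule wp_pick[where Y = Yi and off = "\<kappa> * tb + l ^ 3 + l ^ 3"], goal_cases)
        case (11 s3)
        have r3: "r < 40 \<Longrightarrow> r \<noteq> 21 \<Longrightarrow> r \<noteq> 22 \<Longrightarrow> r \<noteq> 23 \<Longrightarrow> reg s3 r = reg s r" "reg s3 21 = Qk \<omega> \<kappa>" "reg s3 22 = pk \<omega> \<kappa>" for r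
          using 11(1)[of r] 11(1)[of 21] 11(1)[of 22] r2 p2 by simp_all
        have i3: "reg s3 23 = ik \<omega> \<kappa>"
        proof -
          have "pick Yi (l ^ 2 * Yi) (\<lambda>t. mem s (\<kappa> * tb + l ^ 3 + l ^ 3 + t)) (l ^ 3) = ik \<omega> \<kappa>"
            unfolding ik_def using rd[of "\<kappa> * tb + l ^ 3 + l ^ 3"] offs by (intro pick_cong) (auto simp: add_ac e23)
          then show ?thesis using 11(2) m2 by simp
        qed
        have m3: "mem s3 = mem s" "reported s3 = reported s" using 11(3,4) m2 by simp_all
        have ck3: "clock s3 \<le> clock s + pick_time - 100"
          using 11(5) \<open>clock s2 \<le> _\<close> \<open>clock s1 \<le> _\<close> by (simp add: pick_time_def)
        let ?vb = "\<kappa> * tb + l ^ 3 + l ^ 3 + l ^ 3"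
        interpret inst w n m l D L T P \<delta> "Qk \<omega> \<kappa>" "pk \<omega> \<kappa>" "ik \<omega> \<kappa>" "uk \<omega> \<kappa>" by (rule inst_k)
        have vbS: "?vb + S \<le> ltape" using S_le L3_le kt by linarith
        interpret prog w n m l D L T P \<delta> "Qk \<omega> \<kappa>" "pk \<omega> \<kappa>" "ik \<omega> \<kappa>" "uk \<omega> \<kappa>" ?vb \<kappa>
        proof
          show "?vb + S \<le> n ^ 3" using vbS ltape_le by linarith
        qed (rule k)
        have qw: "q < 2 ^ w" using q_le_n n_pow_le_w[of 2] power_strict_increasing[of 2 3 n] n_big
          by (intro wd) (meson le_trans n36 pow_le numeral_le_iff semiring_norm)
        define s4 where "s4 = s3\<lparr>reg := (reg s3)(25 := ?vb, 28 := q, 24 := S, 26 := 2 ^ w mod ik \<omega> \<kappa>, 27 := n div Qk \<omega> \<kappa> + 1, 29 := Qk \<omega> \<kappa> div H + 1)\<rparr>"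
        have beta: "take_bit w (2 ^ w - Suc 0) = 2 ^ w - Suc 0" by simp
        have pm1: "1 < ik \<omega> \<kappa>" using Y_pos ib by linarith
        have pw: "ik \<omega> \<kappa> < 2 ^ w" using pm_le_n small(5) n36 by (intro wd) linarith
        have bw: "Suc ((2 ^ w - Suc 0) mod ik \<omega> \<kappa>) < 2 ^ w"
          using pw mod_less_divisor[of "ik \<omega> \<kappa>" "2 ^ w - Suc 0"] pm1 by linarith
        have bm: "Suc ((2 ^ w - Suc 0) mod ik \<omega> \<kappa>) mod ik \<omega> \<kappa> = 2 ^ w mod ik \<omega> \<kappa>"
          by (simp add: mod_Suc_eq)
        have n1w: "Suc (n div Qk \<omega> \<kappa>) < 2 ^ w" "Suc (Qk \<omega> \<kappa> div H) < 2 ^ w"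
        proof -
          have "Suc (n div Qk \<omega> \<kappa>) \<le> n ^ 3" using div_le_dividend[of n "Qk \<omega> \<kappa>"] small(2) n_pos by linarith
          then show "Suc (n div Qk \<omega> \<kappa>) < 2 ^ w" using n36 by (intro wd) linarith
          have "2 * n ^ 2 + 1 \<le> 3 * n ^ 2" using n_pos by simp
          also have "\<dots> \<le> n * n ^ 2" using n_big by (intro mult_right_mono) auto
          finally have "2 * n ^ 2 + 1 \<le> n ^ 3" by (simp add: eval_nat_numeral)
          then show "Suc (Qk \<omega> \<kappa> div H) < 2 ^ w"
            using Q_le_n div_le_dividend[of "Qk \<omega> \<kappa>" H] n36 by (intro wd) linarith
        qed
        have i4: "iregs (reg s4)"
          unfolding iregs_def s4_def using r3 i3 p0 s(2) by simp
        have t4: "tapeok (mem s4)"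
          unfolding tapeok_def
        proof (intro allI impI)
          fix j assume j: "j < S"
          have "j < tb - 3 * l ^ 3" using j S_le L3_le by linarith
          moreover have "?vb + j < ltape" using j vbS by linarith
          ultimately show "mem s4 (?vb + j) = uk \<omega> \<kappa> j"
            using tape[of "?vb + j"] m3 by (simp add: s4_def uk_def add_ac e23)
        qed
        have mem4: "mem s4 = mem s" "reported s4 = reported s" "clock s4 = clock s3" by (simp_all add: s4_def m3)
        have r4: "reg s4 31 = TB" using r3 s by (simp add: s4_def)
        have search: "wp inp (chain_com ;; For 30 (Reg 29) block_com) (tick x s4) R" if x: "x \<le> 80" for x
        proof (rule wp_search[where TB = TB and mk = "mkf \<omega> \<kappa>"], goal_cases)
          case 1 then show ?case using i4 by simp
        next
          case 2 then show ?case using t4 by simp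
        next
          case 3 then show ?case using r4 by simp
        next
          case (6 x) then show ?case using zero mem4 by simp
        next
          case (7 i) then show ?case using mk mem4 by simp
        next
          case 8 then show ?case using rep mem4 by (simp add: repok_def)
        next
          case (9 s5)
          have rr: "\<forall>r<21. reg s5 r = reg s r"
          proof (intro allI impI)
            fix r :: nat assume "r < 21"
            then show "reg s5 r = reg s r" using eqfD[OF 9(1), of r] r3(1)[of r] by (simp add: s4_def)
          qed
          have "Qk \<omega> \<kappa> div H + 1 \<le> 2 * n ^ 2 + 1" using Q_le_n div_le_dividend[of "Qk \<omega> \<kappa>" H] by linarith
          then have T2: "TB + (Qk \<omega> \<kappa> div H + 1) * n ^ 3 \<le> TB + (2 * n ^ 2 + 1) * n ^ 3" by (intro add_left_mono mult_right_mono) auto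
          have cc: "clock s5 \<le> clock s + pick_time + work_time + 100 * cands \<omega> \<kappa>"
            using 9(7) ck3 mem4 x by (simp add: cands_def hitk_def pick_time_def)
          have "real (clock s5) \<le> real (clock s + pick_time + work_time + 100 * cands \<omega> \<kappa>)" using cc by (rule of_nat_mono)
          also have "\<dots> = real (clock s) + real pick_time + real work_time + 100 * real (cands \<omega> \<kappa>)" by simp
          also have "\<dots> \<le> real (clock s) + 33000 * real l ^ 12 * WW + 100 * real (cands \<omega> \<kappa>)"
          proof -
            have "0 \<le> real l ^ 12 * WW" using WW_ge(7) by simp
            then show ?thesis using pick_time_le work_le by linarith
          qed
          finally have ckf: "real (clock s5) \<le> real (clock s) + 33000 * real l ^ 12 * WW + 100 * real (cands \<omega> \<kappa>)" .
          show ?case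
          proof (rule post[OF rr 9(2) _ T2], goal_cases)
            case 1 then show ?case by simp
          next
            case (2 x) then show ?case using 9(3)[of x] ltape_le tape[of x] mem4 by simp
          next
            case (3 x) then show ?case using 9(4)[of x] by simp
          next
            case (4 i) then show ?case using 9(5)[of i] by (simp add: hitk_def)
          next
            case 5 then show ?case using 9(6) by (simp add: repok_def)
          next
            case 6 then show ?case by (rule ckf)
          qed
        qed (use TB in auto)
        have step: "exp_val inp s3 (Reg 20 [*] Reg 14 [+] Reg 11 [+] Reg 11 [+] Reg 11) = ?vb"
          using w3 r3 s p0 by simp
        show ?case
          apply (simp add: tick_tick sub_word r3 i3 p0 s(2) w3 qw bw bm n1w)
          apply (rule search[unfolded s4_def SS_def tick_upd Suc_eq_plus1[symmetric]])
          apply simp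
          done
      qed (use r2 s p0 Y_pos Y2 o3 in auto)
    qed (use r1 s p0 Y_pos Y2 o3 in auto)
  qed (use s p0 Y_pos Y2 o3 in auto)
qed

end

section \<open>Computing the parameters, drawing the tape, and the complete search\<close>

text \<open>Since \<open>\<delta>\<close> can only be compared, \<open>D\<close> and
  \<open>L\<close> are found by doubling while \<open>2 * D \<le> \<delta> * m\<close>, respectively
  \<open>(2 * L) ^ 3 \<le> \<delta> * n\<close>, still holds; no root is extracted.\<close>

definition params_com :: com where
  "params_com =
     Assign 2 (Const 0) ;; Assign 40 (Reg 0) ;;
     While (Reg 40) (Assign 40 (Reg 40 [/] Const 2) ;; Assign 2 (Reg 2 [+] Const 1)) ;;
     Assign 3 (Const 1) ;;
     While (DeltaLe (Reg 3 [+] Reg 3) (Reg 1)) (Assign 3 (Reg 3 [+] Reg 3)) ;;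
     Assign 4 (Const 1) ;;
     While (DeltaLe ((Reg 4 [+] Reg 4) [*] (Reg 4 [+] Reg 4) [*] (Reg 4 [+] Reg 4)) (Reg 0)) (Assign 4 (Reg 4 [+] Reg 4)) ;;
     Cond (Reg 3 [<] Reg 4) (Assign 5 (Reg 3)) (Assign 5 (Reg 4)) ;;
     Assign 6 (Reg 5 [/] Const 4) ;; Cond (Reg 6) Skip (Assign 6 (Const 1)) ;;
     Assign 12 (Reg 2 [*] Reg 2) ;; Assign 13 (Reg 12) ;; Assign 11 (Reg 12 [*] Reg 2) ;;
     Assign 7 (Reg 3 [/] Reg 12 [+] Const 1) ;;
     Assign 8 (Reg 4 [*] Reg 5 [*] Reg 11) ;; Assign 9 ((Reg 3 [/] Reg 5) [*] Reg 11) ;;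
     Assign 10 (Reg 4 [*] (Reg 1 [/] Reg 3 [+] Const 1) [*] (Reg 11 [*] Reg 11)) ;;
     Assign 14 (Reg 4 [*] (Reg 11 [*] Reg 11 [*] (Reg 11 [*] Reg 11) [*] Reg 2)) ;;
     Assign 15 (Reg 0 [*] Reg 0 [*] Reg 0) ;; Assign 16 (Reg 0 [+] Reg 0) ;; Assign 17 (Reg 13 [*] Reg 14) ;;
     Assign 31 (Reg 15 [+] Reg 15 [+] Reg 15 [+] Reg 15)"

text \<open>Register 41 is reset after each store, so the random words remain in memory only and the
  registers at the end are the same for all outcomes.\<close>

definition fill_loop :: com where
  "fill_loop = While (Reg 40 [<] Reg 17)
     (Rand 41 ;; Store (Reg 40) (Reg 41) ;; Assign 41 (Const 0) ;; Assign 40 (Reg 40 [+] Const 1))"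

definition core_com :: com where
  "core_com = params_com ;; (Assign 40 (Const 0) ;; Assign 41 (Const 0) ;; fill_loop) ;; For 20 (Reg 13) inst_com"

context par begin

definition "filled N k s t \<omega> = \<lparr>reg = (reg s)(40 := N), mem = (\<lambda>x. if k \<le> x \<and> x < N then \<omega> x else mem s x),
     reported = reported s, clock = clock s + t\<rparr>"

text \<open>\<open>Rand\<close> is executed only here. Unrolling the loop once corresponds to
  splitting one coordinate off the product distribution, which gives the induction on the number of
  words still to be drawn.\<close>

lemma fill_loop:
  assumes "N < 2 ^ w" "k \<le> N" "reg s 40 = k" "reg s 41 = 0" "reg s 17 = N"
  shows "exec inp fill_loop s = map_spmf (filled N k s (14 * (N - k) + 4)) (spmf_of_pmf (tape {k..<N}))"
proof -
  define g where "g s = (exp_val inp s (Reg 40 [<] Reg 17) \<noteq> 0)" for s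
  define B where "B = (Rand 41 ;; Store (Reg 40) (Reg 41) ;; Assign 41 (Const 0) ;; Assign 40 (Reg 40 [+] Const 1))"
  define f where "f s = exec inp B (tick (1 + cost (Reg 40 [<] Reg 17)) s)" for s
  have main: "while_spmf g f s = map_spmf (filled N k s (14 * (N - k))) (spmf_of_pmf (tape {k..<N}))"
    if "k \<le> N" "reg s 40 = k" "reg s 41 = 0" "reg s 17 = N" for k and s :: ram_state
    using that
  proof (induction "N - k" arbitrary: k s)
    case 0
    then have k: "k = N" by simp
    then have "(reg s)(40 := N) = reg s" using 0 by auto
    \<comment> \<open>The product over no coordinates is concentrated on the default function
      0.\<close>
    then have "filled N k s 0 (\<lambda>_. 0) = s" using k by (intro ram_state.equality) (auto simp: filled_def)
    then show ?case using 0 k by (subst while_spmf.simps) (simp add: g_def)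
  next
    case (Suc j)
    then have kN: "k < N" by simp
    define s' where "s' x = \<lparr>reg = (reg s)(40 := Suc k), mem = (mem s)(k := x), reported = reported s, clock = clock s + 14\<rparr>" for x
    have fs: "f s = map_spmf s' (spmf_of_pmf (word_pmf w))"
    proof -
      have r: "(reg s)(41 := 0, 40 := Suc k) = (reg s)(40 := Suc k)" using Suc.prems by auto
      have "Suc k < 2 ^ w" using kN assms(1) by linarith
      then have "f s = map_spmf s' (spmf_of_set {..<2 ^ w})"
        unfolding f_def B_def map_spmf_conv_bind_spmf using Suc.prems r
        by (auto simp: map_spmf_conv_bind_spmf s'_def tick_def intro!: bind_spmf_cong ram_state.equality)
      also have "spmf_of_set {..<2 ^ w} = spmf_of_pmf (word_pmf w)"
        by (simp add: word_pmf_def spmf_of_pmf_pmf_of_set lessThan_empty_iff)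
      finally show ?thesis .
    qed
    have "while_spmf g f s = bind_spmf (f s) (while_spmf g f)"
      using Suc.prems kN by (subst while_spmf.simps) (simp add: g_def)
    also have "\<dots> = bind_spmf (spmf_of_pmf (word_pmf w)) (\<lambda>x. while_spmf g f (s' x))"
      unfolding fs by (simp add: bind_map_pmf bind_map_spmf o_def)
    also have "\<dots> = bind_spmf (spmf_of_pmf (word_pmf w)) (\<lambda>x. map_spmf (filled N (Suc k) (s' x) (14 * (N - Suc k))) (spmf_of_pmf (tape {Suc k..<N})))"
      using Suc.hyps Suc.prems kN by (intro bind_spmf_cong refl Suc.hyps(1)) (auto simp: s'_def)
    also have "\<dots> = map_spmf (filled N k s (14 * (N - k))) (spmf_of_pmf (tape (insert k {Suc k..<N})))"
    proof -
      have e: "filled N (Suc k) (s' x) (14 * (N - Suc k)) = (\<lambda>h. filled N k s (14 * (N - k)) (fun_upd h k x))" for x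
        using kN by (auto simp: s'_def filled_def fun_eq_iff)
      have "tape (insert k {Suc k..<N}) = bind_pmf (word_pmf w) (\<lambda>x. map_pmf (\<lambda>h. fun_upd h k x) (tape {Suc k..<N}))"
        by (subst Pi_pmf_insert') (auto simp: map_pmf_def)
      then show ?thesis
        by (simp add: e map_bind_pmf pmf.map_comp o_def spmf_of_pmf_bind)
    qed
    also have "insert k {Suc k..<N} = {k..<N}" using kN by auto
    finally show ?case .
  qed
  have "exec inp fill_loop s = map_spmf (tick (1 + cost (Reg 40 [<] Reg 17))) (while_spmf g f s)"
    by (simp only: fill_loop_def exec.simps g_def[abs_def] f_def[abs_def] B_def)
  also have "\<dots> = map_spmf (\<lambda>\<omega>. tick (1 + cost (Reg 40 [<] Reg 17)) (filled N k s (14 * (N - k)) \<omega>)) (spmf_of_pmf (tape {k..<N}))"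
    using main[OF assms(2-5)] by (simp only: spmf.map_comp o_def)
  also have "(\<lambda>\<omega>. tick (1 + cost (Reg 40 [<] Reg 17)) (filled N k s (14 * (N - k)) \<omega>)) = filled N k s (14 * (N - k) + 4)"
    by (auto simp: filled_def tick_def fun_eq_iff)
  finally show ?thesis .
qed

lemma n_ge: "1000 \<le> n" using l_le_n[of 1] l1000 by simp

lemma wp_params:
  assumes s: "reg s 0 = n" "reg s 1 = m" "mem s = (\<lambda>_. 0)" "reported s = {}"
    and post: "\<And>s'. pregs (reg s') \<Longrightarrow> reg s' 17 = ltape \<Longrightarrow> reg s' 31 = 4 * n ^ 3 \<Longrightarrow> mem s' = (\<lambda>_. 0) \<Longrightarrow> reported s' = {} \<Longrightarrow>
       clock s' \<le> clock s + 100 * l + 300 \<Longrightarrow> R s'"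
  shows "wp inp params_com s R"
proof -
  have pow_w: "x \<le> n ^ 7 \<Longrightarrow> x < 2 ^ w" for x by (rule word_lt)
  have npow: "n ^ j \<le> n ^ 7" if "j \<le> 7" for j using that n_pos by (intro power_increasing) auto
  have nw: "n < 2 ^ w" using npow[of 1] by (intro pow_w) simp
  have n8: "8 * n \<le> n ^ 2" using n_ge by (simp add: power2_eq_square)
  have l_le: "l \<le> n" using l_le_n[of 1] by simp
  have lw: "l < 2 ^ w" using l_le nw by linarith
  obtain kD where kD: "D = 2 ^ kD" using Dpow by auto
  obtain kL where kL: "L = 2 ^ kL" using Lpow by auto
  have kDl: "kD < l"
  proof -
    have "2 ^ kD < (2::nat) ^ l" using D_le_n l1 kD by linarith
    then show ?thesis by simp
  qed
  have L_le_n: "L \<le> n" using Ll_le[of 0] by simp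
  have kLl: "kL < l"
  proof -
    have "2 ^ kL < (2::nat) ^ l" using L_le_n l1 kL by linarith
    then show ?thesis by simp
  qed
  define J1 where "J1 k t \<longleftrightarrow> reg t 0 = n \<and> reg t 1 = m \<and> mem t = (\<lambda>_. 0) \<and> reported t = {} \<and> reg t 2 = k \<and> reg t 40 = n div 2 ^ k" for k and t :: ram_state
  define J2 where "J2 k t \<longleftrightarrow> reg t 0 = n \<and> reg t 1 = m \<and> mem t = (\<lambda>_. 0) \<and> reported t = {} \<and> reg t 2 = l \<and> reg t 3 = 2 ^ k" for k and t :: ram_state
  define J3 where "J3 k t \<longleftrightarrow> reg t 0 = n \<and> reg t 1 = m \<and> mem t = (\<lambda>_. 0) \<and> reported t = {} \<and> reg t 2 = l \<and> reg t 3 = D \<and> reg t 4 = 2 ^ k" for k and t :: ram_state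
  have halve: "(n div 2 ^ k \<noteq> 0) = (k < l)" for k
  proof
    assume "n div 2 ^ k \<noteq> 0"
    then have "2 ^ k \<le> n" by (simp add: div_eq_0_iff)
    then have "2 ^ k < (2::nat) ^ l" using l1 by linarith
    then show "k < l" by simp
  next
    assume "k < l"
    then have "2 ^ Suc k \<le> (2::nat) ^ l" by (intro power_increasing) auto
    then show "n div 2 ^ k \<noteq> 0" using l2 by (simp add: div_eq_0_iff)
  qed
  show ?thesis
    unfolding params_com_def
  proof (simp only: wp_Seq_simps, rule wp_Seq, rule wp_While[where J = J1 and N = l and t = "\<lambda>_. 10"], goal_cases)
    case 1 show ?case using s by (simp add: J1_def)
  next
    case (2 k t) then show ?case using halve[of k] by (simp add: J1_def)
  next
    case (3 k t)
    have "Suc k < 2 ^ w" using 3(1) lw by linarith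
    moreover have "n div 2 ^ k div 2 = n div (2 * 2 ^ k)" by (metis div_mult2_eq mult.commute)
    ultimately show ?case using 3(2) by (simp add: J1_def)
  next
    case (4 t) then show ?case using halve[of l] by (simp add: J1_def)
  next
    case (5 k t x) then show ?case by (simp add: J1_def)
  next
    case (6 t1)
    have c1: "clock t1 \<le> clock s + 15 * l + 20" using 6(2) by simp
    show ?case
    proof (simp only: wp_Seq_simps, rule wp_Seq, rule wp_While[where J = J2 and N = kD and t = "\<lambda>_. 10"], goal_cases)
      case 1 show ?case using 6(1) by (simp add: J2_def J1_def)
    next
      case (2 k t)
      have "2 ^ Suc k \<le> (2::nat) ^ kD" using 2(1) by (intro power_increasing) auto
      then have a: "2 ^ k + 2 ^ k \<le> D" using kD by simp
      then have "D \<noteq> 1" using 2(1) kD by simp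
      then have "real (2 ^ k + 2 ^ k) \<le> \<delta> * real m" using Dlow a by (meson of_nat_le_iff order_trans)
      moreover have "2 ^ k + 2 ^ k < (2::nat) ^ w" using a D_le_n nw by linarith
      ultimately show ?case using 2(2) by (simp add: J2_def)
    next
      case (3 k t)
      have "2 ^ Suc k \<le> (2::nat) ^ kD" using 3(1) by (intro power_increasing) auto
      then have "2 ^ k + 2 ^ k < (2::nat) ^ w" using kD D_le_n nw by simp
      then show ?case using 3(2) by (simp add: J2_def)
    next
      case (4 t)
      have "D + D \<le> n ^ 2" using D_le_n n8 by linarith
      then have "D + D < 2 ^ w" using npow[of 2] by (intro pow_w) linarith
      then show ?case using 4 Dup by (simp add: J2_def kD[symmetric])
    next
      case (5 k t x) then show ?case by (simp add: J2_def)
    next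
      case (6 t2)
      have c2: "clock t2 \<le> clock s + 45 * l + 60" using 6(2) c1 kDl by simp
      have r2: "reg t2 3 = D" using 6(1) by (simp add: J2_def kD)
      \<comment> \<open>The last test of the loop looks one doubling beyond \<open>L\<close>, so the
        cube of \<open>2 * L\<close> must fit as well.\<close>
      have cw: "(2 * L) < 2 ^ w" "(2 * L) * (2 * L) < 2 ^ w" "(2 * L) * (2 * L) * (2 * L) < 2 ^ w"
      proof -
        have "(2 * L) * (2 * L) * (2 * L) = 8 * L ^ 3" by (simp add: power3_eq_cube)
        also have "\<dots> \<le> n ^ 2" using L3_le_n n8 by linarith
        finally have a: "(2 * L) * (2 * L) * (2 * L) \<le> n ^ 7" using npow[of 2] by linarith
        then show "(2 * L) * (2 * L) * (2 * L) < 2 ^ w" by (rule pow_w)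
        moreover have "(2 * L) * (2 * L) * 1 \<le> (2 * L) * (2 * L) * (2 * L)" using L_ge1 by (intro mult_left_mono) auto
        moreover have "(2 * L) * 1 \<le> (2 * L) * (2 * L)" using L_ge1 by (intro mult_left_mono) auto
        ultimately show "(2 * L) < 2 ^ w" "(2 * L) * (2 * L) < 2 ^ w" by linarith+
      qed
      have cube: "exp_val inp t (DeltaLe ((Reg 4 [+] Reg 4) [*] (Reg 4 [+] Reg 4) [*] (Reg 4 [+] Reg 4)) (Reg 0)) = of_bool (real (8 * x ^ 3) \<le> \<delta> * real n)"
        if "reg t 4 = x" "x \<le> L" "reg t 0 = n" for t x
      proof -
        have "(2 * x) * (2 * x) \<le> (2 * L) * (2 * L)" using that by (intro mult_mono) auto
        moreover have "(2 * x) * (2 * x) * (2 * x) \<le> (2 * L) * (2 * L) * (2 * L)" using that by (intro mult_mono) auto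
        ultimately have "x + x < 2 ^ w" "(x + x) * (x + x) < 2 ^ w" "(x + x) * (x + x) * (x + x) < 2 ^ w"
          using cw that(2) unfolding mult_2[symmetric] by linarith+
        moreover have "(x + x) * (x + x) * (x + x) = 8 * x ^ 3" by (simp add: power3_eq_cube algebra_simps)
        ultimately show ?thesis using that by simp
      qed
      show ?case
      proof (simp only: wp_Seq_simps, rule wp_Seq, rule wp_While[where J = J3 and N = kL and t = "\<lambda>_. 10"], goal_cases)
        case 1 show ?case using 6(1) r2 by (simp add: J3_def J2_def)
      next
        case (2 k t)
        have "2 ^ Suc k \<le> (2::nat) ^ kL" using 2(1) by (intro power_increasing) auto
        then have a: "2 * 2 ^ k \<le> L" using kL by simp
        then have "L \<noteq> 1" using 2(1) kL by simp
        moreover have "8 * (2 ^ k) ^ 3 \<le> L ^ 3" using power_mono[OF a, of 3] by (simp add: power_mult_distrib)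
        ultimately have "real (8 * (2 ^ k) ^ 3) \<le> \<delta> * real n" using Llow by (meson of_nat_le_iff order_trans)
        then show ?case using 2(2) cube[of t "2 ^ k"] a by (simp add: J3_def del: exp_val.simps)
      next
        case (3 k t)
        have "2 ^ Suc k \<le> (2::nat) ^ kL" using 3(1) by (intro power_increasing) auto
        then have "2 ^ k + 2 ^ k < (2::nat) ^ w" using kL L_le_n nw by simp
        then show ?case using 3(2) by (simp add: J3_def)
      next
        case (4 t)
        then show ?case using Lup cube[of t L] by (simp add: J3_def kL[symmetric] del: exp_val.simps)
      next
        case (5 k t x) then show ?case by (simp add: J3_def)
      next
        case (6 t3)
        have c3: "clock t3 \<le> clock s + 80 * l + 120" using 6(2) c2 kLl by simp
        have r3: "reg t3 0 = n" "reg t3 (Suc 0) = m" "mem t3 = (\<lambda>_. 0)" "reported t3 = {}" "reg t3 2 = l" "reg t3 3 = D" "reg t3 4 = L"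
          using 6(1) by (simp_all add: J3_def kL)
        have lp: "l * l = l ^ 2" "l ^ 2 * l = l ^ 3" "l ^ 3 * l ^ 3 = l ^ 6" "l ^ 6 * l ^ 6 = l ^ 12" "l ^ 12 * l = l ^ 13"
          by (simp_all add: eval_nat_numeral mult_ac)
        have lw': "l ^ j < 2 ^ w" if "j \<le> 60" for j using l_le_n[OF that] nw by linarith
        have n2w: "x < 2 ^ w" if "x \<le> n ^ 2" for x using that npow[of 2] by (intro pow_w) linarith
        have Yw: "YQ < 2 ^ w" "Yp < 2 ^ w" "Yi < 2 ^ w"
        proof -
          have "Y \<le> l ^ 2 * Y" for Y using l_pos by simp
          then show "YQ < 2 ^ w" "Yp < 2 ^ w" "Yi < 2 ^ w" using YQ_le Yp_le Yi_le by (meson n2w order_trans)+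
        qed
        have w1: "L * mu < 2 ^ w"
        proof (rule n2w)
          have "L * mu \<le> n * n" using L_le_n D_le_n mu_le by (intro mult_mono) linarith+
          then show "L * mu \<le> n ^ 2" by (simp add: power2_eq_square)
        qed
        have w2: "L * Suc (m div D) < 2 ^ w" "Suc (m div D) < 2 ^ w"
        proof -
          have "L * (m div D + 1) * 1 \<le> Yi" unfolding Yi_def using l_pos by (intro mult_left_mono) auto
          then show "L * Suc (m div D) < 2 ^ w" using Yw by simp
          moreover have "Suc (m div D) \<le> L * Suc (m div D)" using L_ge1 by (cases L) auto
          ultimately show "Suc (m div D) < 2 ^ w" by (rule order_le_less_trans[rotated])
        qed
        have w3: "tb < 2 ^ w" "ltape < 2 ^ w"
        proof -
          show "ltape < 2 ^ w" using ltape_le nw by linarith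
          have "L * l ^ 13 \<le> n" by (rule Ll_le) simp
          then show "tb < 2 ^ w" using nw by (simp add: tb_def)
        qed
        have w4: "n * n < 2 ^ w" "n * n * n < 2 ^ w" "n + n < 2 ^ w" "n ^ 3 + n ^ 3 < 2 ^ w" "n ^ 3 + n ^ 3 + n ^ 3 < 2 ^ w" "n ^ 3 + n ^ 3 + n ^ 3 + n ^ 3 < 2 ^ w"
        proof -
          show "n * n < 2 ^ w" by (rule n2w) (simp add: power2_eq_square)
          show "n * n * n < 2 ^ w" using npow[of 3] by (intro pow_w) (simp add: power3_eq_cube)
          show "n + n < 2 ^ w" using n8 by (intro n2w) linarith
          have "4 * n ^ 3 \<le> n * n ^ 3" using n_ge by (intro mult_right_mono) auto
          also have "\<dots> = n ^ 4" by (simp flip: power_Suc)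
          also have "\<dots> \<le> n ^ 7" by (rule npow) simp
          finally have "4 * n ^ 3 \<le> n ^ 7" .
          then have "4 * n ^ 3 < 2 ^ w" by (rule pow_w)
          then show "n ^ 3 + n ^ 3 < 2 ^ w" "n ^ 3 + n ^ 3 + n ^ 3 < 2 ^ w" "n ^ 3 + n ^ 3 + n ^ 3 + n ^ 3 < 2 ^ w" by linarith+
        qed
        have w5: "Suc (D div l ^ 2) < 2 ^ w"
          using D_le_n div_le_dividend[of D "l ^ 2"] w4(3) n_pos by linarith
        have Hd: "mu div 4 = 0 \<Longrightarrow> H = 1" "mu div 4 \<noteq> 0 \<Longrightarrow> H = mu div 4" by (simp_all add: H_def)
        have mud: "(if D < L then D else L) = mu" by (simp add: mu_def min_def)
        have d4: "mu div 4 < 2 ^ w" "mu < 2 ^ w" using mu_le D_le_n nw div_le_dividend[of mu 4] by linarith+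
        note defs = YQ_def[symmetric] Yp_def[symmetric]
        have Yi': "L * Suc (m div D) * l ^ 6 = Yi" by (simp add: Yi_def)
        have g': "Suc (D div l ^ 2) = g" by (simp add: g_def)
        have tb': "L * l ^ 13 = tb" by (simp add: tb_def)
        have num: "Suc (Suc (Suc (Suc (Suc (Suc 0))))) = 6" "Suc (Suc (Suc (Suc (Suc (Suc (Suc 0)))))) = 7"
          "Suc (Suc (Suc (Suc (Suc (Suc (Suc (Suc 0))))))) = 8" "Suc 6 = 7" "Suc 7 = 8" by simp_all
        have step1: "wp inp (Cond (Reg 3 [<] Reg 4) (Assign 5 (Reg 3)) (Assign 5 (Reg 4)) ;; c) t3 Q' \<longleftrightarrow>
           wp inp c ((tick 6 t3)\<lparr>reg := (reg t3)(5 := mu)\<rparr>) Q'" for c Q'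
          using r3 mud by (auto simp: tick_tick num)
        have step2: "wp inp (Assign 6 (Reg 5 [/] Const 4) ;; Cond (Reg 6) Skip (Assign 6 (Const 1)) ;; c) t Q' \<longleftrightarrow>
           wp inp c ((tick (if mu div 4 = 0 then 8 else 7) t)\<lparr>reg := (reg t)(6 := H)\<rparr>) Q'" if "reg t 5 = mu" for c Q' t
          using that Hd by (cases "mu div 4 = 0") (auto simp: tick_tick num)
        have gw: "g < 2 ^ w" using w5 by (simp add: g_def)
        have w6: "L + L * (m div D) < 2 ^ w" "(L + L * (m div D)) * l ^ 6 = Yi" using w2(1) Yi' by simp_all
        have w7: "n\<^sup>2 < 2 ^ w" "n\<^sup>2 * n = n ^ 3" "n ^ 3 < 2 ^ w"
          using w4(1,2) by (simp_all add: power2_eq_square power3_eq_cube)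
        show ?case
          unfolding step1
          apply (subst step2)
           apply simp
          apply (cases "mu div 4 = 0")
           apply (simp_all add: r3 lp lw' Yw w1 w2 w3 w4 w5 w6 w7 gw defs Yi' g' tb' tick_tick power2_eq_square[symmetric] ltape_def[symmetric])
           apply (rule post; use c3 in \<open>simp add: pregs_def r3\<close>)
          apply (rule post; use c3 in \<open>simp add: pregs_def r3\<close>)
          done
      qed
    qed
  qed
qed

end

context par begin

definition "out \<omega> = {i \<in> locations P T. \<forall>\<kappa><l ^ 2. hitk \<omega> \<kappa> i}"

lemma locations_eq: "locations P T = {i. i \<le> n - m}"
  by (auto simp: locations_def lenT lenP)

lemma wp_outer:
  assumes s: "pregs (reg s)" "reg s 31 = 4 * n ^ 3" "mem s = (\<lambda>x. if x < ltape then \<omega> x else 0)" "reported s = {}"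
  shows "wp inp (For 20 (Reg 13) inst_com) s (\<lambda>s'. reported s' = out \<omega> \<and>
    real (clock s') \<le> real (clock s) + 33010 * real l ^ 14 * WW + 100 * (\<Sum>\<kappa><l ^ 2. real (cands \<omega> \<kappa>)) + 6)"
proof -
  define c where "c = (2 * n ^ 2 + 1) * n ^ 3"
  define J where "J \<kappa> t \<longleftrightarrow> pregs (reg t) \<and> 4 * n ^ 3 \<le> reg t 31 \<and> reg t 31 \<le> 4 * n ^ 3 + \<kappa> * c \<and>
      (\<forall>x\<ge>reg t 31. mem t x = 0) \<and> (\<forall>x<ltape. mem t x = \<omega> x) \<and> (\<forall>i\<le>n - m. mem t (3 * n ^ 3 + i) = mkf \<omega> \<kappa> i) \<and>
      reported t = {i. i \<le> n - m \<and> mem t (3 * n ^ 3 + i) = l ^ 2}" for \<kappa> and t :: ram_state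
  have lw: "l ^ 2 < 2 ^ w"
  proof (rule word_lt)
    have "l ^ 2 \<le> n" by (rule l_le_n) simp
    moreover have "n \<le> n ^ 7" using n_pos by (intro self_le_power) auto
    ultimately show "l ^ 2 \<le> n ^ 7" by linarith
  qed
  \<comment> \<open>Each of the \<open>l ^ 2\<close> rounds uses at most \<open>c\<close> fresh
    words for head tables; \<open>1000 * l ^ 2 \<le> n\<close> keeps all tables below address
    \<open>n ^ 6\<close>.\<close>
  have cb: "4 * n ^ 3 + \<kappa> * c + c \<le> n ^ 6" if "\<kappa> < l ^ 2" for \<kappa>
  proof -
    have "l ^ 2 * 1000 \<le> l ^ 2 * l" using l1000 by (intro mult_left_mono) auto
    also have "\<dots> = l ^ 3" by (simp add: eval_nat_numeral)
    also have "\<dots> \<le> n" by (rule l_le_n) simp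
    finally have l2: "l ^ 2 * 1000 \<le> n" .
    have n1: "1 \<le> n ^ 2" using n_pos by simp
    have "\<kappa> * c + c = (\<kappa> + 1) * c" by simp
    also have "\<dots> \<le> l ^ 2 * c" using that by (intro mult_right_mono) auto
    also have "l ^ 2 * c = (l ^ 2 * (2 * n ^ 2 + 1)) * n ^ 3" by (simp only: c_def mult.assoc)
    finally have 1: "4 * n ^ 3 + \<kappa> * c + c \<le> (4 + l ^ 2 * (2 * n ^ 2 + 1)) * n ^ 3"
      unfolding add_mult_distrib[of 4] by linarith
    have "1 * 1 \<le> l ^ 2 * n ^ 2" using n_pos l_pos by (intro mult_le_mono) auto
    moreover have "l ^ 2 * 1 \<le> l ^ 2 * n ^ 2" using n1 by (intro mult_left_mono) auto
    moreover have "l ^ 2 * (2 * n ^ 2 + 1) = 2 * (l ^ 2 * n ^ 2) + l ^ 2" "l ^ 2 * 1000 * n ^ 2 = 1000 * (l ^ 2 * n ^ 2)"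
      by (simp_all only: distrib_left mult_1_right mult_ac)
    ultimately have "4 + l ^ 2 * (2 * n ^ 2 + 1) \<le> l ^ 2 * 1000 * n ^ 2" by linarith
    also have "\<dots> \<le> n * n ^ 2" using l2 by (rule mult_right_mono) simp
    also have "\<dots> = n ^ 3" by (simp add: eval_nat_numeral)
    finally have "(4 + l ^ 2 * (2 * n ^ 2 + 1)) * n ^ 3 \<le> n ^ 3 * n ^ 3" by (rule mult_right_mono) simp
    moreover have "n ^ 3 * n ^ 3 = n ^ 6" by (simp add: power_add[symmetric])
    ultimately show ?thesis using 1 by linarith
  qed
  show ?thesis
  proof (rule wp_For[where J = J and N = "l ^ 2" and t = "\<lambda>\<kappa>. nat \<lceil>33000 * real l ^ 12 * WW\<rceil> + 100 * cands \<omega> \<kappa>"], goal_cases)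
    case 1
    have z: "mem s x = 0" if "n ^ 3 \<le> x" for x
    proof -
      have "\<not> x < ltape" using that ltape_le(2) by linarith
      then show ?thesis using s(3) by simp
    qed
    have "\<forall>x\<ge>4 * n ^ 3. mem s x = 0" by (intro allI impI z) linarith
    moreover have m0: "mem s (3 * n ^ 3 + i) = 0" for i by (rule z) linarith
    moreover have "\<forall>x<ltape. mem s x = \<omega> x" using s(3) by simp
    moreover have "pregs ((reg s)(20 := 0))" using s(1) by (simp add: pregs_def)
    moreover have "{i. i \<le> n - m \<and> mem s (3 * n ^ 3 + i) = l ^ 2} = {}" unfolding m0 using l_pos by simp
    ultimately show ?case using s(2,4) unfolding J_def by simp
  next
    case 2 then show ?case using lw l_pos by (cases w) auto
  next
    case 3 then show ?case using lw by simp
  next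
    case (4 \<kappa> t) then show ?case by (simp add: J_def pregs_def)
  next
    case (5 \<kappa> t)
    have J: "pregs (reg t)" "4 * n ^ 3 \<le> reg t 31" "reg t 31 \<le> 4 * n ^ 3 + \<kappa> * c" "\<forall>x\<ge>reg t 31. mem t x = 0"
      "\<forall>x<ltape. mem t x = \<omega> x" "\<forall>i\<le>n - m. mem t (3 * n ^ 3 + i) = mkf \<omega> \<kappa> i"
      "reported t = {i. i \<le> n - m \<and> mem t (3 * n ^ 3 + i) = l ^ 2}"
      using 5(2) unfolding J_def by blast+
    show ?case
    proof (rule wp_inst[of t \<kappa> "reg t 31" \<omega>], goal_cases)
      case (11 s' TB')
      have "pregs (reg s')" using J(1) 11(1) by (simp add: pregs_def)
      then have p: "pregs ((reg s')(20 := Suc \<kappa>))" by (simp add: pregs_def)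
      have "reg s' 31 \<le> 4 * n ^ 3 + Suc \<kappa> * c" using J(3) 11(2,4) unfolding c_def[symmetric] by simp
      then have "J (Suc \<kappa>) (s'\<lparr>reg := (reg s')(20 := Suc \<kappa>)\<rparr>)"
        unfolding J_def using p J(2) 11(2,3,5-8) by (simp del: mkf.simps)
      moreover have "reg s' 20 = \<kappa>" using 11(1) 5(3) by simp
      moreover have "clock s' \<le> clock t + (nat \<lceil>33000 * real l ^ 12 * WW\<rceil> + 100 * cands \<omega> \<kappa>)"
      proof -
        have "real (clock s') \<le> real (clock t) + real (nat \<lceil>33000 * real l ^ 12 * WW\<rceil>) + 100 * real (cands \<omega> \<kappa>)"
          using 11(9) real_nat_ceiling_ge[of "33000 * real l ^ 12 * WW"] by linarith
        then show ?thesis by linarith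
      qed
      ultimately show ?case by simp
    next
      case 6
      have "reg t 31 + c \<le> n ^ 6" using J cb[OF 5(1)] by linarith
      then show ?case by (simp only: c_def)
    next
      case 7 then show ?case using J(4) by blast
    next
      case 8 then show ?case using J(5) by blast
    next
      case 9 then show ?case using J(6) by blast
    qed (use J(1,2,7) 5(1,3) in simp_all)
  next
    case (6 \<kappa> t x) then show ?case by (simp add: J_def)
  next
    case (7 s')
    have "reported s' = {i. i \<le> n - m \<and> mkf \<omega> (l ^ 2) i = l ^ 2}" using 7(1) by (auto simp: J_def)
    then have "reported s' = out \<omega>" by (simp only: mkf_eq(2)) (auto simp: out_def locations_eq)
    moreover have "real (clock s') \<le> real (clock s) + 33010 * real l ^ 14 * WW + 100 * (\<Sum>\<kappa><l ^ 2. real (cands \<omega> \<kappa>)) + 6"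
    proof -
      define K where "K = nat \<lceil>33000 * real l ^ 12 * WW\<rceil>"
      have W1: "1 \<le> WW" by (rule WW_ge)
      have l1: "1 \<le> real l" using l1000 by simp
      have "1 * 1 \<le> real l ^ 12 * WW" using W1 l1 by (intro mult_mono) auto
      then have K: "real K \<le> 33000 * (real l ^ 12 * WW) + 1" unfolding K_def by linarith
      have "clock s' \<le> clock s + ((\<Sum>k<l ^ 2. K + 100 * cands \<omega> k + cost (Reg 13) + 7) + cost (Reg 13) + 5)"
        using 7(2) by (simp add: K_def add.assoc)
      then have "clock s' \<le> clock s + (l ^ 2 * (K + 8) + 100 * (\<Sum>k<l ^ 2. cands \<omega> k) + 6)"
        by (simp add: sum.distrib sum_distrib_left[symmetric] algebra_simps)
      then have "real (clock s') \<le> real (clock s + (l ^ 2 * (K + 8) + 100 * (\<Sum>k<l ^ 2. cands \<omega> k) + 6))" by (rule of_nat_mono)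
      then have "real (clock s') \<le> real (clock s) + real l ^ 2 * (real K + 8) + 100 * (\<Sum>\<kappa><l ^ 2. real (cands \<omega> \<kappa>)) + 6" by simp
      moreover have "real l ^ 2 * (real K + 8) \<le> real l ^ 2 * (33010 * (real l ^ 12 * WW))"
        using K \<open>1 * 1 \<le> real l ^ 12 * WW\<close> by (intro mult_left_mono) auto
      moreover have "real l ^ 2 * (33010 * (real l ^ 12 * WW)) = 33010 * real l ^ 14 * WW" by (simp add: eval_nat_numeral)
      ultimately show ?thesis by linarith
    qed
    ultimately show ?case by simp
  qed
qed

text \<open>Separates randomness from computation: the run is the image of the uniform tape under a
  function \<open>F\<close>, obtained pointwise from total correctness. The exponent 15 is due to
  drawing \<open>L * l ^ 15\<close> words; the \<open>l ^ 2\<close> rounds account for 14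
  only.\<close>

lemma core_exec:
  assumes s: "reg s 0 = n" "reg s 1 = m" "mem s = (\<lambda>_. 0)" "reported s = {}"
  obtains F where "exec inp core_com s = spmf_of_pmf (map_pmf F (tape {..<l ^ 2 * tb}))"
    "\<And>\<omega>. reported (F \<omega>) = out \<omega>"
    "\<And>\<omega>. real (clock (F \<omega>)) \<le> real (clock s) + 34000 * real l ^ 15 * WW + 100 * (\<Sum>\<kappa><l ^ 2. real (cands \<omega> \<kappa>))"
proof -
  let ?R = "\<lambda>s'. pregs (reg s') \<and> reg s' 17 = ltape \<and> reg s' 31 = 4 * n ^ 3 \<and> mem s' = (\<lambda>_. 0) \<and> reported s' = {} \<and>
     clock s' \<le> clock s + 100 * l + 300"
  have "wp inp params_com s ?R" by (rule wp_params[OF s]) auto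
  then obtain s1 where e1: "exec inp params_com s = return_spmf s1" and s1: "?R s1" by (auto simp: wp_def)
  define s2 where "s2 = tick 4 (s1\<lparr>reg := (reg s1)(40 := 0, 41 := 0)\<rparr>)"
  have ltw: "ltape < 2 ^ w" using ltape_le n_pos power_increasing[of 1 7 n] by (intro word_lt) auto
  define G where "G = filled ltape 0 s2 (14 * ltape + 4)"
  have e2: "exec inp fill_loop s2 = spmf_of_pmf (map_pmf G (tape {..<ltape}))"
    using fill_loop[of ltape 0 s2] ltw s1 by (simp add: s2_def G_def atLeast0LessThan)
  have "\<exists>s'. exec inp (For 20 (Reg 13) inst_com) (G \<omega>) = return_spmf s' \<and> reported s' = out \<omega> \<and>
    real (clock s') \<le> real (clock (G \<omega>)) + 33010 * real l ^ 14 * WW + 100 * (\<Sum>\<kappa><l ^ 2. real (cands \<omega> \<kappa>)) + 6" for \<omega>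
  proof -
    have "pregs (reg (G \<omega>))" "reg (G \<omega>) 31 = 4 * n ^ 3" "reported (G \<omega>) = {}"
      "mem (G \<omega>) = (\<lambda>x. if x < ltape then \<omega> x else 0)"
      using s1 by (simp_all add: G_def filled_def s2_def pregs_def fun_eq_iff)
    from wp_outer[OF this(1,2,4,3)] show ?thesis by (auto simp: wp_def)
  qed
  then obtain F where F: "\<And>\<omega>. exec inp (For 20 (Reg 13) inst_com) (G \<omega>) = return_spmf (F \<omega>)" "\<And>\<omega>. reported (F \<omega>) = out \<omega>"
    "\<And>\<omega>. real (clock (F \<omega>)) \<le> real (clock (G \<omega>)) + 33010 * real l ^ 14 * WW + 100 * (\<Sum>\<kappa><l ^ 2. real (cands \<omega> \<kappa>)) + 6"
    by metis
  show ?thesis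
  proof (rule that[of F])
    have "exec inp core_com s = bind_spmf (exec inp fill_loop s2) (exec inp (For 20 (Reg 13) inst_com))"
      by (simp add: core_com_def e1 s2_def tick_tick numeral_eq_Suc)
    also have "\<dots> = spmf_of_pmf (map_pmf F (tape {..<ltape}))"
      unfolding e2 by (simp add: F(1) bind_map_pmf bind_pmf_return_spmf)
    finally show "exec inp core_com s = spmf_of_pmf (map_pmf F (tape {..<l ^ 2 * tb}))" by (simp add: ltape_def)
    show "reported (F \<omega>) = out \<omega>" for \<omega> by (rule F)
    show "real (clock (F \<omega>)) \<le> real (clock s) + 34000 * real l ^ 15 * WW + 100 * (\<Sum>\<kappa><l ^ 2. real (cands \<omega> \<kappa>))" for \<omega>
    proof -
      have "clock (G \<omega>) \<le> clock s + 100 * l + 308 + 14 * ltape" using s1 by (simp add: G_def filled_def s2_def)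
      then have "real (clock (G \<omega>)) \<le> real (clock s + 100 * l + 308 + 14 * ltape)" by (rule of_nat_mono)
      then have c: "real (clock (G \<omega>)) \<le> real (clock s) + 100 * real l + 308 + 14 * real ltape" by simp
      have lt: "real ltape = real L * real l ^ 15" by (simp add: ltape_def tb_def eval_nat_numeral)
      have l1: "1 \<le> real l" using l1000 by simp
      have "real L * real l ^ 15 \<le> WW * real l ^ 15" by (intro mult_right_mono WW_ge) auto
      moreover have "real l ^ 1 * 1 \<le> real l ^ 15 * WW" using l1 WW_ge(7) by (intro mult_mono power_increasing) auto
      moreover have "real l ^ 14 * WW \<le> real l ^ 15 * WW" using l1 WW_ge(7) by (intro mult_right_mono power_increasing) auto
      moreover have "34000 * real l ^ 15 * WW = 34000 * (real l ^ 15 * WW)" "33010 * real l ^ 14 * WW = 33010 * (real l ^ 14 * WW)"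
        "WW * real l ^ 15 = real l ^ 15 * WW" "real l ^ 1 * 1 = real l" by simp_all
      ultimately show ?thesis using F(3)[of \<omega>] c lt l1000 by linarith
    qed
  qed
qed

section \<open>Error probability and expected time of the search\<close>

lemma card_locations_le: "card (locations P T) \<le> n"
  using m1 mn by (simp add: locations_def lenT lenP)

lemma finite_locations: "finite (locations P T)"
  by (simp add: locations_def)

lemma run_core:
  assumes ex: "exec inp core_com s = spmf_of_pmf (map_pmf F (tape {..<l ^ 2 * tb}))"
    and rep: "\<And>\<omega>. reported (F \<omega>) = out \<omega>"
  shows "measure_pmf.prob (exec inp core_com s) {r. \<not> (\<exists>s'. r = Some s' \<and> correct_report P T \<delta> (reported s'))}
    \<le> real n * (1 / 2) ^ (l ^ 2)"
proof -
  let ?T = "tape {..<l ^ 2 * tb}"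
  let ?far = "locations P T - close_locations P T \<delta>"
  \<comment> \<open>Exact occurrences hit in every round with certainty, so an error can only be a
    distant location that survives all rounds.\<close>
  have ok: "correct_report P T \<delta> (out \<omega>)" if "\<forall>i\<in>?far. \<exists>\<kappa><l ^ 2. \<not> hitk \<omega> \<kappa> i" for \<omega>
    using that inst.hit_exact[OF inst_k] by (auto simp: correct_report_def out_def hitk_def)
  have "measure_pmf.prob (exec inp core_com s) {r. \<not> (\<exists>s'. r = Some s' \<and> correct_report P T \<delta> (reported s'))}
     = measure_pmf.prob ?T {\<omega>. \<not> correct_report P T \<delta> (out \<omega>)}"
    unfolding ex spmf_of_pmf_def by (simp add: vimage_def rep)
  also have "\<dots> \<le> measure_pmf.prob ?T (\<Union>i\<in>?far. {f. \<forall>\<kappa><l ^ 2. hitk f \<kappa> i})"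
  proof (rule measure_pmf.finite_measure_mono)
    show "{\<omega>. \<not> correct_report P T \<delta> (out \<omega>)} \<subseteq> (\<Union>i\<in>?far. {f. \<forall>\<kappa><l ^ 2. hitk f \<kappa> i})"
    proof
      fix x assume "x \<in> {\<omega>. \<not> correct_report P T \<delta> (out \<omega>)}"
      then have "\<not> (\<forall>i\<in>?far. \<exists>\<kappa><l ^ 2. \<not> hitk x \<kappa> i)" using ok[of x] by fast
      then obtain i where "i \<in> ?far" "\<forall>\<kappa><l ^ 2. hitk x \<kappa> i" by auto
      then show "x \<in> (\<Union>i\<in>?far. {f. \<forall>\<kappa><l ^ 2. hitk f \<kappa> i})" by blast
    qed
  qed simp
  also have "\<dots> \<le> (\<Sum>i\<in>?far. measure_pmf.prob ?T {f. \<forall>\<kappa><l ^ 2. hitk f \<kappa> i})"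
    using finite_locations by (intro measure_pmf.finite_measure_subadditive_finite) auto
  also have "\<dots> \<le> (\<Sum>i\<in>?far. (1 / 2) ^ (l ^ 2))"
    using prob_all_hits_le[of _ "l ^ 2" "l ^ 2"] by (intro sum_mono) auto
  also have "\<dots> = real (card ?far) * (1 / 2) ^ (l ^ 2)" by simp
  also have "\<dots> \<le> real n * (1 / 2) ^ (l ^ 2)"
  proof (rule mult_right_mono)
    have "card ?far \<le> card (locations P T)" using finite_locations by (intro card_mono) auto
    then show "real (card ?far) \<le> real n" using card_locations_le by linarith
  qed simp
  finally show ?thesis .
qed

text \<open>Linearity of expectation over locations and rounds: a close location is charged as if it
  were a candidate in every round, any other one with probability \<open>1 / (2 * L)\<close>, so
  that the false candidates of a round contribute at most \<open>n / L\<close>.\<close>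

lemma time_core:
  assumes ex: "exec inp core_com s = spmf_of_pmf (map_pmf F (tape {..<l ^ 2 * tb}))"
    and cl: "\<And>\<omega>. real (clock (F \<omega>)) \<le> real c0 + 34000 * real l ^ 15 * WW + 100 * (\<Sum>\<kappa><l ^ 2. real (cands \<omega> \<kappa>))"
  shows "(\<integral>\<^sup>+ r. (case r of None \<Rightarrow> \<infinity> | Some s \<Rightarrow> ennreal (real (clock s))) \<partial>measure_pmf (exec inp core_com s))
    \<le> ennreal (real c0 + 35000 * real l ^ 15 * (WW + real (card (close_locations P T \<delta>))))"
proof -
  let ?T = "tape {..<l ^ 2 * tb}"
  let ?C = "close_locations P T \<delta>"
  let ?A = "real c0 + 34000 * real l ^ 15 * WW"
  let ?p = "\<lambda>\<kappa> i. measure_pmf.prob ?T {f. hitk f \<kappa> i}"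
  have W: "1 \<le> WW" by (rule WW_ge)
  then have A0: "0 \<le> ?A" by simp
  have e100: "ennreal (100 * x) = 100 * ennreal x" if "0 \<le> x" for x
    using ennreal_mult[of 100 x] that by simp
  have c: "real (cands \<omega> \<kappa>) = (\<Sum>i\<in>locations P T. indicator {f. hitk f \<kappa> i} \<omega>)" for \<omega> \<kappa>
  proof -
    have "(\<Sum>i\<in>locations P T. indicator {f. hitk f \<kappa> i} \<omega>) = (\<Sum>i\<in>locations P T. of_bool (hitk \<omega> \<kappa> i) :: real)"
      by (intro sum.cong) (auto simp: indicator_def)
    also have "\<dots> = real (card (locations P T \<inter> {i. hitk \<omega> \<kappa> i}))"
      by (subst sum_of_bool_eq) (simp_all add: locations_def)
    also have "locations P T \<inter> {i. hitk \<omega> \<kappa> i} = {i \<in> locations P T. hitk \<omega> \<kappa> i}" by blast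
    finally show ?thesis by (simp only: cands_def)
  qed
  have p: "(\<Sum>i\<in>locations P T. ?p \<kappa> i) \<le> real (card ?C) + WW" if \<kappa>: "\<kappa> < l ^ 2" for \<kappa>
  proof -
    have "(\<kappa> + 1) * tb \<le> l ^ 2 * tb" using \<kappa> by (intro mult_right_mono) auto
    then have sub: "block \<kappa> \<subseteq> {..<l ^ 2 * tb}" by (auto simp: block_def)
    have Csub: "?C \<subseteq> locations P T" by (auto simp: close_locations_def)
    have "(\<Sum>i\<in>locations P T. ?p \<kappa> i) = (\<Sum>i\<in>?C. ?p \<kappa> i) + (\<Sum>i\<in>locations P T - ?C. ?p \<kappa> i)"
      using sum.subset_diff[OF Csub finite_locations, of "?p \<kappa>"] by simp
    also have "\<dots> \<le> (\<Sum>i\<in>?C. 1) + (\<Sum>i\<in>locations P T - ?C. 1 / (2 * real L))"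
      using prob_hit_le[OF _ sub] by (intro add_mono sum_mono) auto
    also have "\<dots> = real (card ?C) + real (card (locations P T - ?C)) / (2 * real L)" by simp
    also have "real (card (locations P T - ?C)) / (2 * real L) \<le> real n / real L"
    proof (rule frac_le)
      have "card (locations P T - ?C) \<le> card (locations P T)" using finite_locations by (intro card_mono) auto
      then show "real (card (locations P T - ?C)) \<le> real n" using card_locations_le by linarith
    qed (use L_ge1 in auto)
    also have "\<dots> \<le> WW" by (rule WW_ge)
    finally show ?thesis by simp
  qed
  have "(\<integral>\<^sup>+ r. (case r of None \<Rightarrow> \<infinity> | Some s \<Rightarrow> ennreal (real (clock s))) \<partial>measure_pmf (exec inp core_com s))
     = (\<integral>\<^sup>+ \<omega>. ennreal (real (clock (F \<omega>))) \<partial>?T)"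
    unfolding ex spmf_of_pmf_def by simp
  also have "\<dots> \<le> (\<integral>\<^sup>+ \<omega>. ennreal ?A + 100 * (\<Sum>\<kappa><l ^ 2. \<Sum>i\<in>locations P T. indicator {f. hitk f \<kappa> i} \<omega>) \<partial>?T)"
  proof (rule nn_integral_mono)
    fix \<omega>
    have "ennreal (real (clock (F \<omega>))) \<le> ennreal (?A + 100 * (\<Sum>\<kappa><l ^ 2. real (cands \<omega> \<kappa>)))"
      by (rule ennreal_leI) (rule cl)
    also have "\<dots> = ennreal ?A + ennreal (100 * (\<Sum>\<kappa><l ^ 2. real (cands \<omega> \<kappa>)))"
      using A0 by (intro ennreal_plus) (auto intro!: sum_nonneg)
    also have "ennreal (100 * (\<Sum>\<kappa><l ^ 2. real (cands \<omega> \<kappa>))) = 100 * (\<Sum>\<kappa><l ^ 2. \<Sum>i\<in>locations P T. ennreal (indicator {f. hitk f \<kappa> i} \<omega>))"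
      unfolding c by (simp only: e100 sum_nonneg sum_ennreal measure_nonneg indicator_pos_le)
    finally show "ennreal (real (clock (F \<omega>))) \<le> ennreal ?A + 100 * (\<Sum>\<kappa><l ^ 2. \<Sum>i\<in>locations P T. indicator {f. hitk f \<kappa> i} \<omega>)"
      by (simp add: ennreal_indicator)
  qed
  also have "\<dots> = ennreal ?A + 100 * (\<Sum>\<kappa><l ^ 2. \<Sum>i\<in>locations P T. ennreal (?p \<kappa> i))"
    by (simp add: nn_integral_add nn_integral_cmult nn_integral_sum measure_pmf.emeasure_eq_measure)
  also have "100 * (\<Sum>\<kappa><l ^ 2. \<Sum>i\<in>locations P T. ennreal (?p \<kappa> i)) = ennreal (100 * (\<Sum>\<kappa><l ^ 2. \<Sum>i\<in>locations P T. ?p \<kappa> i))"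
    by (simp only: e100 sum_nonneg sum_ennreal measure_nonneg indicator_pos_le)
  also have "ennreal ?A + \<dots> = ennreal (?A + 100 * (\<Sum>\<kappa><l ^ 2. \<Sum>i\<in>locations P T. ?p \<kappa> i))"
    using A0 by (intro ennreal_plus[symmetric]) (auto intro!: sum_nonneg)
  also have "\<dots> \<le> ennreal (real c0 + 35000 * real l ^ 15 * (WW + real (card ?C)))"
  proof (rule ennreal_leI)
    have "(\<Sum>\<kappa><l ^ 2. \<Sum>i\<in>locations P T. ?p \<kappa> i) \<le> (\<Sum>\<kappa><l ^ 2. real (card ?C) + WW)"
      using p by (intro sum_mono) auto
    also have "\<dots> = real l ^ 2 * (real (card ?C) + WW)" by simp
    also have "\<dots> \<le> real l ^ 15 * (real (card ?C) + WW)" using l1000 W by (intro mult_right_mono power_increasing) auto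
    finally have 1: "(\<Sum>\<kappa><l ^ 2. \<Sum>i\<in>locations P T. ?p \<kappa> i) \<le> real l ^ 15 * (real (card ?C) + WW)" .
    have "0 \<le> real l ^ 15 * real (card ?C)" "0 \<le> real l ^ 15 * WW" using W by simp_all
    then show "?A + 100 * (\<Sum>\<kappa><l ^ 2. \<Sum>i\<in>locations P T. ?p \<kappa> i) \<le> real c0 + 35000 * real l ^ 15 * (WW + real (card ?C))"
      using 1 unfolding distrib_left mult.assoc by linarith
  qed
  finally show ?thesis .
qed

end

section \<open>Balancing the terms of the running time\<close>

lemma cube_root:
  fixes y :: real assumes "0 < y"
  shows "(y powr (1 / 3)) ^ 3 = y" "0 < y powr (1 / 3)"
  using assms by (simp_all add: powr_powr flip: powr_realpow)

text \<open>With \<open>z = (\<delta> * n)^(1/3)\<close> the costs \<open>n / z\<close> and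
  \<open>z^2 / \<delta>\<close> are the same number, namely the first term of the claimed bound;
  this determines the choice of \<open>L\<close>.\<close>

lemma ratio_cube_root:
  fixes x y :: real assumes "0 < x" "0 < y"
  shows "x powr (- 1 / 3) * y powr (2 / 3) = y / (x * y) powr (1 / 3)"
    "x powr (- 1 / 3) * y powr (2 / 3) = ((x * y) powr (1 / 3))\<^sup>2 / x"
proof -
  have x: "x powr (- 1 / 3) = 1 / x powr (1 / 3)" by (simp add: powr_minus_divide)
  have "y powr (2 / 3) = y powr (1 / 3) * y powr (1 / 3)" by (simp flip: powr_add)
  moreover have "(y powr (1 / 3)) ^ 3 = y" "(x powr (1 / 3)) ^ 3 = x" using cube_root assms by auto
  moreover have "y powr (1 / 3) > 0" "x powr (1 / 3) > 0" using assms by simp_all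
  ultimately show "x powr (- 1 / 3) * y powr (2 / 3) = y / (x * y) powr (1 / 3)"
    "x powr (- 1 / 3) * y powr (2 / 3) = ((x * y) powr (1 / 3))\<^sup>2 / x"
    unfolding x using assms by (simp_all add: powr_mult field_simps power2_eq_square power3_eq_cube)
qed

lemma ex_power_two:
  fixes y :: real
  shows "\<exists>D::nat. (\<exists>k. D = 2 ^ k) \<and> (D = 1 \<or> real D \<le> y) \<and> y < 2 * real D"
proof (cases "y < 1")
  case True
  then show ?thesis by (intro exI[of _ 1]) (auto intro: exI[of _ 0])
next
  case False
  define N where "N = nat \<lfloor>y\<rfloor>"
  have N: "1 \<le> N" "real N \<le> y" "y < real N + 1" using False by (auto simp: N_def le_nat_iff)
  obtain k where k: "2 ^ k \<le> N" "N < 2 ^ (k + 1)" using ex_power_ivl1[of 2 N] N by auto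
  have "real (2 ^ k) \<le> y" using k(1) N(2) by (meson of_nat_mono order_trans)
  moreover have "real (N + 1) \<le> real (2 ^ (k + 1))" using k(2) by (intro of_nat_mono) simp
  ultimately show ?thesis using N(3) by (intro exI[of _ "2 ^ k"]) auto
qed

context par begin

lemma WW_le: "WW \<le> 4 * (\<delta> powr (- 1 / 3) * real n powr (2 / 3) + 1 / \<delta> * (real n / real m))"
proof -
  define x where "x = (\<delta> * real n) powr (1 / 3)"
  define X where "X = \<delta> powr (- 1 / 3) * real n powr (2 / 3)"
  have x: "x ^ 3 = \<delta> * real n" "0 < x" using cube_root[of "\<delta> * real n"] d0 n_pos by (simp_all add: x_def)
  have X: "X = real n / x" "X = x\<^sup>2 / \<delta>" using ratio_cube_root[of \<delta> "real n"] d0 n_pos by (simp_all add: X_def x_def)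
  have L1: "1 \<le> real L" and D1: "1 \<le> real D" using L_ge1 D_ge1 by simp_all
  have "x ^ 3 < (2 * real L) ^ 3" using Lup x by (simp add: power_mult_distrib)
  then have xL: "x < 2 * real L" by (rule power_less_imp_less_base) simp
  have nL: "real n / real L \<le> 2 * X"
  proof -
    have "real n / real L \<le> real n / (x / 2)" using xL x(2) by (intro divide_left_mono) auto
    then show ?thesis by (simp add: X(1) mult.commute)
  qed
  have mD: "real m / real D \<le> 2 / \<delta>" using Dup d0 D1 by (simp add: field_simps)
  \<comment> \<open>For \<open>L = 1\<close> the value may exceed the cube root \<open>x\<close>.
    The term is then at most \<open>n\<close>, which equals \<open>n / L\<close> and is already
    bounded.\<close>
  have LmD: "(real L)\<^sup>2 * (real m / real D) \<le> 2 * X"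
  proof (cases "L = 1")
    case True
    have "real m / real D \<le> real m / 1" using D1 by (intro divide_left_mono) auto
    also have "\<dots> \<le> real n" using mn by simp
    finally show ?thesis using nL True by simp
  next
    case False
    then have "real L ^ 3 \<le> x ^ 3" using Llow x by simp
    then have "real L \<le> x" using x(2) by (simp add: power_mono_iff)
    then have "(real L)\<^sup>2 * (real m / real D) \<le> x\<^sup>2 * (2 / \<delta>)" using mD by (intro mult_mono power_mono) auto
    then show ?thesis by (simp add: X(2) mult.commute)
  qed
  have "real n / real D = real n / real m * (real m / real D)" using m1 by simp
  also have "\<dots> \<le> real n / real m * (2 / \<delta>)" using mD by (intro mult_left_mono) auto
  finally have nD: "real n / real D \<le> 2 * (1 / \<delta> * (real n / real m))" by (simp add: mult_ac)
  define Z where "Z = 1 / \<delta> * (real n / real m)"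
  have "0 \<le> Z" using d0 by (simp add: Z_def)
  have "WW \<le> 2 * Z + 2 * X + 2 * X" unfolding WW_def by (intro add_mono nL LmD nD[folded Z_def])
  also have "\<dots> \<le> 4 * (X + Z)" using \<open>0 \<le> Z\<close> by simp
  finally show ?thesis by (simp only: X_def Z_def)
qed

lemma core_result:
  assumes s: "reg s 0 = n" "reg s 1 = m" "mem s = (\<lambda>_. 0)" "reported s = {}"
  shows "measure_pmf.prob (exec inp core_com s) {r. \<not> (\<exists>s'. r = Some s' \<and> correct_report P T \<delta> (reported s'))}
      \<le> real n * (1 / 2) ^ (l ^ 2)"
    "(\<integral>\<^sup>+ r. (case r of None \<Rightarrow> \<infinity> | Some s \<Rightarrow> ennreal (real (clock s))) \<partial>measure_pmf (exec inp core_com s))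
      \<le> ennreal (real (clock s) + 35000 * real l ^ 15 * (WW + real (card (close_locations P T \<delta>))))"
proof -
  obtain F where F: "exec inp core_com s = spmf_of_pmf (map_pmf F (tape {..<l ^ 2 * tb}))"
    "\<And>\<omega>. reported (F \<omega>) = out \<omega>"
    "\<And>\<omega>. real (clock (F \<omega>)) \<le> real (clock s) + 34000 * real l ^ 15 * WW + 100 * (\<Sum>\<kappa><l ^ 2. real (cands \<omega> \<kappa>))"
  proof (rule core_exec[OF s], goal_cases)
    case (1 F)
    show thesis by (rule 1(1)[OF 1(2-4)])
  qed
  show "measure_pmf.prob (exec inp core_com s) {r. \<not> (\<exists>s'. r = Some s' \<and> correct_report P T \<delta> (reported s'))}
      \<le> real n * (1 / 2) ^ (l ^ 2)" by (rule run_core[OF F(1,2)])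
  show "(\<integral>\<^sup>+ r. (case r of None \<Rightarrow> \<infinity> | Some s \<Rightarrow> ennreal (real (clock s))) \<partial>measure_pmf (exec inp core_com s))
      \<le> ennreal (real (clock s) + 35000 * real l ^ 15 * (WW + real (card (close_locations P T \<delta>))))"
    by (rule time_core[OF F(1,3)])
qed

end

lemma core_bounds:
  assumes len: "length T = n" "length P = m" "1 \<le> m" "m \<le> n" and lt: "set T \<subseteq> {..<2 ^ w}" "set P \<subseteq> {..<2 ^ w}"
    and d: "0 < \<delta>" "\<delta> < 1" and l: "n < 2 ^ l" "2 ^ l \<le> 2 * n" "l ^ 60 \<le> n" "1000 \<le> l" and w: "w \<le> l ^ 2" "n ^ 8 \<le> 2 ^ w"
    and I: "I = \<lparr>word_size = w, text_arr = T, pat_arr = P, delta = \<delta>\<rparr>"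
    and s: "reg s 0 = n" "reg s 1 = m" "mem s = (\<lambda>_. 0)" "reported s = {}"
  shows "measure_pmf.prob (exec I core_com s) {r. \<not> (\<exists>s'. r = Some s' \<and> correct_report P T \<delta> (reported s'))}
      \<le> real n * (1 / 2) ^ (l ^ 2)"
    "(\<integral>\<^sup>+ r. (case r of None \<Rightarrow> \<infinity> | Some s \<Rightarrow> ennreal (real (clock s))) \<partial>measure_pmf (exec I core_com s))
      \<le> ennreal (real (clock s) + 140000 * real l ^ 15 *
        (\<delta> powr (- 1 / 3) * real n powr (2 / 3) + 1 / \<delta> * (real n / real m) + real (card (close_locations P T \<delta>))))"
proof -
  define x where "x = (\<delta> * real n) powr (1 / 3)"
  have x: "x ^ 3 = \<delta> * real n" "0 < x" using cube_root[of "\<delta> * real n"] d len by (simp_all add: x_def)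
  obtain D :: nat where D: "\<exists>k. D = 2 ^ k" "D = 1 \<or> real D \<le> \<delta> * real m" "\<delta> * real m < 2 * real D"
    using ex_power_two by blast
  obtain L :: nat where L: "\<exists>k. L = 2 ^ k" "L = 1 \<or> real L \<le> x" "x < 2 * real L"
    using ex_power_two by blast
  have L3: "L = 1 \<or> real (L ^ 3) \<le> \<delta> * real n" using L(2) power_mono[of "real L" x 3] x by auto
  have "x ^ 3 < (2 * real L) ^ 3" using L(3) x by (intro power_strict_mono) auto
  then have L4: "\<delta> * real n < 8 * real (L ^ 3)" using x by (simp add: power_mult_distrib)
  interpret par w n m l D L T P \<delta>
    by unfold_locales (use len lt d l w D L(1) L3 L4 in auto)
  note r = core_result[OF s, folded I]
  show "measure_pmf.prob (exec I core_com s) {r. \<not> (\<exists>s'. r = Some s' \<and> correct_report P T \<delta> (reported s'))}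
      \<le> real n * (1 / 2) ^ (l ^ 2)" by (rule r)
  let ?X = "\<delta> powr (- 1 / 3) * real n powr (2 / 3) + 1 / \<delta> * (real n / real m)"
  have "35000 * real l ^ 15 * (WW + real (card (close_locations P T \<delta>)))
      \<le> 35000 * real l ^ 15 * (4 * (?X + real (card (close_locations P T \<delta>))))"
    using WW_le by (intro mult_left_mono) auto
  also have "35000 * real l ^ 15 * (4 * (?X + real (card (close_locations P T \<delta>)))) = 140000 * real l ^ 15 * (?X + real (card (close_locations P T \<delta>)))"
    by simp
  finally have "real (clock s) + 35000 * real l ^ 15 * (WW + real (card (close_locations P T \<delta>)))
      \<le> real (clock s) + 140000 * real l ^ 15 * (?X + real (card (close_locations P T \<delta>)))" by (rule add_left_mono)
  then show "(\<integral>\<^sup>+ r. (case r of None \<Rightarrow> \<infinity> | Some s \<Rightarrow> ennreal (real (clock s))) \<partial>measure_pmf (exec I core_com s))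
      \<le> ennreal (real (clock s) + 140000 * real l ^ 15 * (?X + real (card (close_locations P T \<delta>))))"
    by (rule order_trans[OF r(2) ennreal_leI])
qed

section \<open>The final program, small inputs and the constants\<close>

text \<open>Tests \<open>n \<ge> 2 ^ k\<close> by \<open>k\<close> single shifts: for small
  \<open>n\<close> neither \<open>2 ^ k\<close> nor \<open>k\<close> itself need fit into a word,
  and \<open>Const\<close> truncates.\<close>

primrec shr_expr :: "nat \<Rightarrow> expr" where
  "shr_expr 0 = Reg 0"
| "shr_expr (Suc k) = Bin Shr (shr_expr k) (Const 1)"

definition all_com :: com where
  "all_com = For 2 (Reg 0 [-] Reg 1 [+] Const 1) (Report (Reg 2))"

text \<open>Below the threshold the program does nothing and the constant \<open>C\<close> makes the
  error bound trivial. For \<open>\<delta> \<ge> 1\<close> every location is close, so reporting all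
  of them takes time proportional to \<open>occ\<close>.\<close>

definition main_com :: "nat \<Rightarrow> com" where
  "main_com k = Cond (shr_expr k) (Cond (DeltaLe (Const 1) (Const 1)) all_com core_com) Skip"

lemma exp_val_shr_expr: "0 < word_size I \<Longrightarrow> exp_val I s (shr_expr k) = reg s 0 div 2 ^ k"
proof (induction k)
  case (Suc k)
  then obtain v where "word_size I = Suc v" by (cases "word_size I") auto
  moreover have "reg s 0 div 2 ^ k div 2 = reg s 0 div (2 * 2 ^ k)" by (metis div_mult2_eq mult.commute)
  ultimately show ?case using Suc by (simp add: drop_bit_eq_div)
qed simp

lemma wp_all:
  assumes w: "word_size I = w" "n < 2 ^ w" "1 \<le> m" "m \<le> n"
    and s: "reg s 0 = n" "reg s 1 = m" "reported s = {}"
  shows "wp I all_com s (\<lambda>s'. reported s' = {..<n - m + 1} \<and> clock s' \<le> clock s + 24 * (n - m + 1))"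
  unfolding all_com_def
proof (rule wp_For[where J = "\<lambda>k t. reg t 0 = n \<and> reg t 1 = m \<and> reported t = {..<k}" and N = "n - m + 1" and t = "\<lambda>_. 2"], goal_cases)
  case 2 then show ?case using w by (cases w) auto
next
  case 3 then show ?case using w by simp
next
  case (4 k t)
  have "n - m + 1 < 2 ^ w" "0 < w" using w by (auto intro: Nat.gr0I)
  then show ?case using 4 w by (simp add: apply_op_Sub del: apply_op.simps(2))
next
  case (7 s')
  then show ?case by simp
qed (use s in \<open>auto simp: lessThan_Suc\<close>)

lemma ham_at_le: "ham_at P T i \<le> length P"
  using card_mono[of "{..<length P}" "{j. j < length P \<and> P ! j \<noteq> T ! (i + j)}"] by (auto simp: ham_at_def)

lemma close_locations_all: "1 \<le> \<delta> \<Longrightarrow> close_locations P T \<delta> = locations P T"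
proof -
  assume d: "1 \<le> \<delta>"
  have "real (ham_at P T i) \<le> \<delta> * real (length P)" for i
  proof -
    have "real (ham_at P T i) \<le> 1 * real (length P)" using ham_at_le by simp
    also have "\<dots> \<le> \<delta> * real (length P)" using d by (intro mult_right_mono) auto
    finally show ?thesis .
  qed
  then show ?thesis by (auto simp: close_locations_def)
qed

text \<open>Allows additive constants of the running time to be absorbed into the claimed
  bound.\<close>

lemma bound_ge_1:
  assumes "1 \<le> m" "m \<le> n" "length T = n" "length P = m" "0 < \<delta>"
  shows "1 \<le> \<delta> powr (- 1 / 3) * real n powr (2 / 3) + 1 / \<delta> * (real n / real m) + real (card (close_locations P T \<delta>))"
proof (cases "1 \<le> \<delta>")
  case True
  have "1 \<le> real (card (close_locations P T \<delta>))" by (simp add: close_locations_all[OF True] locations_def)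
  moreover have "0 \<le> \<delta> powr (- 1 / 3) * real n powr (2 / 3)" "0 \<le> 1 / \<delta> * (real n / real m)" using True by simp_all
  ultimately show ?thesis by linarith
next
  case False
  have "1 powr (1 / 3) \<ge> \<delta> powr (1 / 3)" using False assms by (intro powr_mono2) auto
  then have "1 \<le> \<delta> powr (- 1 / 3)" using assms by (simp add: powr_minus_divide)
  moreover have "1 \<le> real n powr (2 / 3)" using assms by (intro ge_one_powr_ge_zero) auto
  ultimately have "1 * 1 \<le> \<delta> powr (- 1 / 3) * real n powr (2 / 3)" by (intro mult_mono) auto
  moreover have "0 \<le> 1 / \<delta> * (real n / real m)" using assms by simp
  ultimately show ?thesis by linarith
qed

text \<open>The switch \<open>ok\<close> permits one rule for both deterministic branches; with
  \<open>ok\<close> false only the time is claimed.\<close>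

lemma wp_error_time:
  assumes "wp I c (init_state I) (\<lambda>s'. (ok \<longrightarrow> correct_report (pat_arr I) (text_arr I) (delta I) (reported s')) \<and> clock s' \<le> t)"
  shows "ok \<Longrightarrow> error_prob c I = 0" "expected_time c I \<le> ennreal (real t)"
proof -
  obtain s' where e: "run c I = return_pmf (Some s')" and s': "ok \<longrightarrow> correct_report (pat_arr I) (text_arr I) (delta I) (reported s')" "clock s' \<le> t"
    using assms by (auto simp: wp_def run_def)
  show "error_prob c I = 0" if ok using s' that unfolding error_prob_def e by (auto simp: measure_return_pmf)
  show "expected_time c I \<le> ennreal (real t)" using s' unfolding expected_time_def e by (simp add: ennreal_leI)
qed

lemma main_com_bounds:
  fixes b c :: real
  obtains k0 C K where
    "\<And>n m \<sigma> w T P \<delta>. \<lbrakk>1 \<le> m; m \<le> n; length T = n; set T \<subseteq> {..<\<sigma>}; length P = m; set P \<subseteq> {..<\<sigma>}; 0 < \<delta>;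
       8 * log 2 (real n + 1) \<le> real w; real w \<le> b * log 2 (real n + 1); \<sigma> \<le> 2 ^ w\<rbrakk> \<Longrightarrow>
     error_prob (main_com k0) \<lparr>word_size = w, text_arr = T, pat_arr = P, delta = \<delta>\<rparr> \<le> C * real n powr (- c) \<and>
     expected_time (main_com k0) \<lparr>word_size = w, text_arr = T, pat_arr = P, delta = \<delta>\<rparr> \<le> ennreal (K * log 2 (real n + 1) ^ 15 *
       (\<delta> powr (- 1 / 3) * real n powr (2 / 3) + 1 / \<delta> * (real n / real m) + real (card (close_locations P T \<delta>))))"
proof -
  have "eventually (\<lambda>l::nat. 2 * real l ^ 60 \<le> 2 ^ l) at_top" by real_asymp
  then obtain k1 where k1: "\<And>l. k1 \<le> l \<Longrightarrow> 2 * real l ^ 60 \<le> 2 ^ l" by (auto simp: eventually_at_top_linorder)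
  \<comment> \<open>For \<open>l > k0\<close> the summands give \<open>l ^ 60 \<le> n\<close>,
    \<open>l \<ge> 1000\<close>, \<open>w \<le> b * log 2 (n + 1) \<le> l ^ 2\<close>, and
    \<open>c + 1 \<le> l\<close> for the error.\<close>
  define k0 where "k0 = k1 + 1000 + nat \<lceil>b\<rceil> + nat \<lceil>c + 1\<rceil>"
  define t0 where "t0 = cost (shr_expr k0) + 40"
  \<comment> \<open>The power makes \<open>C * n powr (- c)\<close> at least 1 for all
    \<open>n < 2 ^ k0\<close>; the summand 1 gives \<open>C \<ge> 1\<close> for large
    \<open>n\<close>.\<close>
  define C where "C = (2 ^ k0) powr (max c 0) + (1::real)"
  \<comment> \<open>The factor \<open>2 ^ 15\<close> comes from replacing \<open>l\<close> by
    \<open>2 * log 2 (n + 1)\<close>.\<close>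
  define K where "K = real t0 + 140000 * 2 ^ 15"
  show ?thesis
  proof (rule that[of k0 C K])
    fix n m \<sigma> w :: nat and T P :: "nat list" and \<delta> :: real
    assume m1: "1 \<le> m" and mn: "m \<le> n" and T: "length T = n" "set T \<subseteq> {..<\<sigma>}" and P: "length P = m" "set P \<subseteq> {..<\<sigma>}"
      and d: "\<delta> > 0" and wl: "8 * log 2 (real n + 1) \<le> real w" and wu: "real w \<le> b * log 2 (real n + 1)" and \<sigma>: "\<sigma> \<le> 2 ^ w"
    define I where "I = \<lparr>word_size = w, text_arr = T, pat_arr = P, delta = \<delta>\<rparr>"
    define occ where "occ = card (close_locations P T \<delta>)"
    define X where "X = \<delta> powr (- 1 / 3) * real n powr (2 / 3) + (1 / \<delta>) * (real n / real m)"
    define lg where "lg = log 2 (real n + 1)"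
    have n1: "1 \<le> n" using m1 mn by simp
    have lg1: "1 \<le> lg" using n1 by (simp add: lg_def le_log_iff)
    have Y1: "1 \<le> X + real occ" using bound_ge_1[OF m1 mn T(1) P(1) d] by (simp add: X_def occ_def)
    have X0: "0 \<le> X" using d by (simp add: X_def)
    have wn: "n ^ 8 \<le> 2 ^ w" and nw: "n < 2 ^ w" and w0: "0 < w"
    proof -
      have "(2::real) powr (8 * lg) \<le> 2 powr real w" using wl by (simp add: lg_def)
      moreover have "(2::real) powr (8 * lg) = (real n + 1) ^ 8"
      proof -
        have "(2::real) powr (8 * lg) = (2 powr lg) powr 8" by (simp only: powr_powr mult.commute)
        also have "2 powr lg = real n + 1" by (simp add: lg_def)
        also have "(real n + 1) powr 8 = (real n + 1) ^ 8" using powr_realpow[of "real n + 1" 8] by simp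
        finally show ?thesis .
      qed
      ultimately have 1: "(real n + 1) ^ 8 \<le> 2 ^ w" by (simp add: powr_realpow)
      then have "real ((n + 1) ^ 8) \<le> real (2 ^ w)" by (simp only: of_nat_power of_nat_add of_nat_1 of_nat_numeral)
      then have 2: "(n + 1) ^ 8 \<le> 2 ^ w" by (simp only: of_nat_le_iff)
      moreover have "n ^ 8 \<le> (n + 1) ^ 8" by (intro power_mono) auto
      ultimately show "n ^ 8 \<le> 2 ^ w" by linarith
      have "n + 1 \<le> (n + 1) ^ 8" by (intro self_le_power) auto
      then show "n < 2 ^ w" using 2 by linarith
      then show "0 < w" using n1 by (cases w) auto
    qed
    have init: "reg (init_state I) 0 = n" "reg (init_state I) 1 = m" "mem (init_state I) = (\<lambda>_. 0)" "reported (init_state I) = {}" "clock (init_state I) = 0"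
      using nw mn T P by (simp_all add: init_state_def I_def take_bit_nat_eq_self)
    have guard: "exp_val I (init_state I) (shr_expr k0) \<noteq> 0 \<longleftrightarrow> 2 ^ k0 \<le> n"
      using w0 init by (simp add: exp_val_shr_expr I_def div_eq_0_iff not_less)
    have guard2: "exp_val I s (DeltaLe (Const 1) (Const 1)) \<noteq> 0 \<longleftrightarrow> 1 \<le> \<delta>" for s
      using w0 by (cases w) (auto simp: I_def)
    have c4: "1 + cost (DeltaLe (Const 1) (Const 1)) = 4" by simp
    have sel: "pat_arr I = P" "text_arr I = T" "delta I = \<delta>" by (simp_all add: I_def)
    have C1: "1 \<le> C" by (simp add: C_def)
    have Cpos: "0 \<le> C * real n powr (- c)" using C1 by simp
    have time: "expected_time prog I \<le> ennreal (K * lg ^ 15 * (X + real occ))"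
      if "expected_time prog I \<le> ennreal t" "t \<le> real t0 * (X + real occ) + 140000 * 2 ^ 15 * lg ^ 15 * (X + real occ)" for prog :: com and t
    proof (rule order_trans[OF that(1)], rule ennreal_leI)
      have "1 \<le> lg ^ 15" using lg1 by simp
      then have "real t0 * 1 * (X + real occ) \<le> real t0 * lg ^ 15 * (X + real occ)" using Y1 by (intro mult_right_mono mult_left_mono) auto
      then show "t \<le> K * lg ^ 15 * (X + real occ)"
        using that(2) unfolding K_def distrib_right[of "real t0"] distrib_right[of "real t0 * lg ^ 15"] mult_1_right by linarith
    qed
    have "error_prob (main_com k0) I \<le> C * real n powr (- c) \<and> expected_time (main_com k0) I \<le> ennreal (K * lg ^ 15 * (X + real occ))"
    proof (cases "2 ^ k0 \<le> n")
      case False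
      have t: "wp I (main_com k0) (init_state I) (\<lambda>s'. (False \<longrightarrow> correct_report (pat_arr I) (text_arr I) (delta I) (reported s')) \<and> clock s' \<le> t0)"
        using guard False init by (simp add: main_com_def t0_def)
      have "real t0 * 1 \<le> real t0 * (X + real occ)" using Y1 by (intro mult_left_mono) auto
      moreover have "0 \<le> 140000 * 2 ^ 15 * lg ^ 15 * (X + real occ)" using lg1 Y1 by simp
      ultimately have 2: "expected_time (main_com k0) I \<le> ennreal (K * lg ^ 15 * (X + real occ))"
        by (intro time[OF wp_error_time(2)[OF t]]) linarith
      have "real n powr c \<le> real n powr max c 0" using n1 by (intro powr_mono) auto
      also have "\<dots> \<le> (2 ^ k0) powr max c 0"
      proof (rule powr_mono2)
        have "real n \<le> real (2 ^ k0)" using False by (intro of_nat_mono) simp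
        then show "real n \<le> 2 ^ k0" by simp
      qed auto
      finally have "real n powr c * real n powr (- c) \<le> C * real n powr (- c)" by (intro mult_right_mono) (auto simp: C_def)
      then have "1 \<le> C * real n powr (- c)" using n1 by (simp flip: powr_add)
      moreover have "error_prob (main_com k0) I \<le> 1" by (simp add: error_prob_def)
      ultimately show ?thesis using 2 by linarith
    next
      case big: True
      show ?thesis
      proof (cases "1 \<le> \<delta>")
        case True
        have occ: "occ = n - m + 1" by (simp add: occ_def close_locations_all[OF True] locations_def T P)
        have t: "wp I (main_com k0) (init_state I) (\<lambda>s'. (True \<longrightarrow> correct_report (pat_arr I) (text_arr I) (delta I) (reported s')) \<and> clock s' \<le> t0 + 24 * occ)"
        proof -
          have "wp I all_com (tick 4 (tick (1 + cost (shr_expr k0)) (init_state I)))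
             (\<lambda>s'. reported s' = {..<n - m + 1} \<and> clock s' \<le> clock (tick 4 (tick (1 + cost (shr_expr k0)) (init_state I))) + 24 * (n - m + 1))"
            using nw m1 mn init by (intro wp_all[of I w]) (simp_all add: I_def)
          then have "wp I all_com (tick 4 (tick (1 + cost (shr_expr k0)) (init_state I))) (\<lambda>s'. (True \<longrightarrow> correct_report (pat_arr I) (text_arr I) (delta I) (reported s')) \<and> clock s' \<le> t0 + 24 * occ)"
          proof (rule wp_mono, goal_cases)
            case (1 s')
            have "correct_report P T \<delta> {..<n - m + 1}"
              by (auto simp: correct_report_def close_locations_all[OF True] locations_def T P)
            then show ?case using 1 init by (simp add: sel occ t0_def)
          qed
          then show ?thesis using big True by (simp only: main_com_def wp_Cond exp_val_tick guard guard2 if_True c4)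
        qed
        have 1: "error_prob (main_com k0) I = 0" by (rule wp_error_time(1)[OF t]) simp
        have "real t0 * 1 \<le> real t0 * (X + real occ)" using Y1 by (intro mult_left_mono) auto
        moreover have "24 * real occ \<le> 140000 * 2 ^ 15 * lg ^ 15 * (X + real occ)"
        proof -
          have "24 * real occ \<le> 140000 * 2 ^ 15 * (X + real occ)" using X0 by (simp add: distrib_left)
          then have "1 * (24 * real occ) \<le> lg ^ 15 * (140000 * 2 ^ 15 * (X + real occ))"
            using one_le_power[OF lg1, of 15] lg1 X0 by (intro mult_mono) auto
          also have "\<dots> = 140000 * 2 ^ 15 * lg ^ 15 * (X + real occ)" by (simp only: mult_ac)
          finally show ?thesis by (simp only: mult_1_left)
        qed
        ultimately have 2: "expected_time (main_com k0) I \<le> ennreal (K * lg ^ 15 * (X + real occ))"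
          by (intro time[OF wp_error_time(2)[OF t]]) (unfold of_nat_add of_nat_mult of_nat_numeral, linarith)
        show ?thesis using 1 2 Cpos by simp
      next
        case False
        obtain k where k: "2 ^ k \<le> n" "n < 2 ^ (k + 1)" using ex_power_ivl1[of 2 n] n1 by auto
        define l where "l = k + 1"
        have l: "n < 2 ^ l" "2 ^ l \<le> 2 * n" using k by (simp_all add: l_def)
        have "2 ^ k0 < (2::nat) ^ l" using big l(1) by linarith
        then have lk: "k0 < l" by simp
        then have l1000: "1000 \<le> l" and lb: "b \<le> real l" and lc: "c + 1 \<le> real l" and "k1 \<le> l" by (auto simp: k0_def) linarith+
        then have "2 * real l ^ 60 \<le> 2 ^ l" using k1 by blast
        also have "\<dots> \<le> real (2 * n)" using of_nat_mono[OF l(2), where 'a = real] by simp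
        finally have "real (l ^ 60) \<le> real n" by simp
        then have l60: "l ^ 60 \<le> n" by (simp only: of_nat_le_iff)
        have n2l: "real n + 1 \<le> 2 ^ l"
          using of_nat_mono[of "n + 1" "2 ^ l", where 'a = real] l(1) by simp
        have lgl: "lg \<le> real l"
        proof -
          have "lg \<le> log 2 (2 ^ l)" unfolding lg_def using n2l by (subst log_le_cancel_iff) auto
          then show ?thesis by (simp add: log_nat_power)
        qed
        have llg: "real l \<le> 2 * lg"
        proof -
          have "real (2 ^ k) \<le> real n" using k(1) by (rule of_nat_mono)
          then have "2 ^ k \<le> real n + 1" unfolding of_nat_power of_nat_numeral by linarith
          then have "log 2 (2 ^ k) \<le> lg" unfolding lg_def by (subst log_le_cancel_iff) auto
          then have "real k \<le> lg" by (simp add: log_nat_power)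
          then show ?thesis using lg1 by (simp add: l_def)
        qed
        have "real w \<le> real l * real l"
        proof -
          have "b * lg \<le> real l * real l" using lb lgl lg1 by (intro mult_mono) auto
          then show ?thesis using wu by (simp add: lg_def)
        qed
        then have "real w \<le> real (l ^ 2)" by (simp add: power2_eq_square)
        then have wl2: "w \<le> l ^ 2" by (simp only: of_nat_le_iff)
        let ?s = "tick 4 (tick (1 + cost (shr_expr k0)) (init_state I))"
        have ex: "run (main_com k0) I = exec I core_com ?s"
          using big False by (simp only: run_def main_com_def exec.simps Let_def exp_val_tick guard guard2 if_True if_False c4)
        have sub: "set T \<subseteq> {..<2 ^ w}" "set P \<subseteq> {..<2 ^ w}" using T P \<sigma> by auto
        have d1: "\<delta> < 1" using False by simp
        have s: "reg ?s 0 = n" "reg ?s 1 = m" "mem ?s = (\<lambda>_. 0)" "reported ?s = {}" using init by simp_all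
        note r = core_bounds[OF T(1) P(1) m1 mn sub d d1 l l60 l1000 wl2 wn I_def s]
        have e: "error_prob (main_com k0) I \<le> real n * (1 / 2) ^ (l ^ 2)"
          unfolding error_prob_def ex sel by (rule r)
        \<comment> \<open>Since \<open>n < 2 ^ l\<close>, surviving \<open>l ^ 2\<close> rounds has
          probability at most \<open>n powr (- l)\<close>, which beats the union bound over
          \<open>n\<close> locations for any fixed \<open>c\<close>.\<close>
        have "((1::real) / 2) ^ (l ^ 2) = ((1 / 2) ^ l) ^ l" by (simp add: power2_eq_square power_mult)
        then have "(1 / 2) ^ (l ^ 2) = ((1 / 2 ^ l) ^ l :: real)" by (simp add: power_one_over)
        also have "\<dots> \<le> (1 / real n) ^ l" using n1 l(1) by (intro power_mono divide_left_mono) auto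
        also have "\<dots> = real n powr (- real l)" using n1 by (simp add: powr_minus_divide powr_realpow power_one_over)
        finally have "real n * (1 / 2) ^ (l ^ 2) \<le> real n powr 1 * real n powr (- real l)" using n1 by (simp add: mult_left_mono)
        also have "\<dots> = real n powr (1 - real l)" by (simp only: powr_add[symmetric]) simp
        also have "\<dots> \<le> real n powr (- c)" using n1 lc by (intro powr_mono) auto
        also have "\<dots> \<le> C * real n powr (- c)" using mult_right_mono[OF C1, of "real n powr (- c)"] by simp
        finally have 1: "error_prob (main_com k0) I \<le> C * real n powr (- c)" using e by linarith
        have tm: "expected_time (main_com k0) I \<le> ennreal (real (clock ?s) + 140000 * real l ^ 15 * (X + real occ))"
          unfolding expected_time_def ex X_def occ_def by (rule r)
        have "real l ^ 15 \<le> (2 * lg) ^ 15" using llg by (intro power_mono) auto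
        then have "140000 * real l ^ 15 * (X + real occ) \<le> 140000 * (2 * lg) ^ 15 * (X + real occ)"
          using Y1 by (intro mult_right_mono mult_left_mono) auto
        also have "\<dots> = 140000 * 2 ^ 15 * lg ^ 15 * (X + real occ)" by (simp only: power_mult_distrib mult.assoc)
        finally have "140000 * real l ^ 15 * (X + real occ) \<le> \<dots>" .
        moreover have "real (clock ?s) * 1 \<le> real t0 * (X + real occ)" using Y1 init by (intro mult_mono) (auto simp: t0_def)
        ultimately have 2: "expected_time (main_com k0) I \<le> ennreal (K * lg ^ 15 * (X + real occ))"
          by (intro time[OF tm]) linarith
        show ?thesis using 1 2 by simp
      qed
    qed
    then show "error_prob (main_com k0) \<lparr>word_size = w, text_arr = T, pat_arr = P, delta = \<delta>\<rparr> \<le> C * real n powr (- c) \<and>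
     expected_time (main_com k0) \<lparr>word_size = w, text_arr = T, pat_arr = P, delta = \<delta>\<rparr> \<le> ennreal (K * log 2 (real n + 1) ^ 15 *
       (\<delta> powr (- 1 / 3) * real n powr (2 / 3) + 1 / \<delta> * (real n / real m) + real (card (close_locations P T \<delta>))))" by (simp only: I_def occ_def lg_def X_def)
  qed
qed

text \<open>The program may depend on \<open>b\<close> and \<open>c\<close> because its threshold
  for small inputs does. The constant \<open>a = 8\<close> is the word length that makes room for
  all tables and excludes overflow.\<close>

theorem theorem10p6:
  "\<exists>a::real. a \<ge> 1 \<and> (\<forall>(b::real) (c::real). \<exists>(prog::com) (C::real) (K::real) (k::nat).
     \<forall>(n::nat) (m::nat) (\<sigma>::nat) (w::nat) (T::nat list) (P::nat list) (\<delta>::real).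
       1 \<le> m \<longrightarrow> m \<le> n \<longrightarrow>
       length T = n \<longrightarrow> set T \<subseteq> {..<\<sigma>} \<longrightarrow>
       length P = m \<longrightarrow> set P \<subseteq> {..<\<sigma>} \<longrightarrow>
       \<delta> > 0 \<longrightarrow>
       a * log 2 (real n + 1) \<le> real w \<longrightarrow> real w \<le> b * log 2 (real n + 1) \<longrightarrow>
       \<sigma> \<le> 2 ^ w \<longrightarrow>
       (let I = \<lparr>word_size = w, text_arr = T, pat_arr = P, delta = \<delta>\<rparr>;
            occ = card (close_locations P T \<delta>)
        in error_prob prog I \<le> C * real n powr (- c) \<and>
           expected_time prog I \<le> ennreal (K * (log 2 (real n + 1)) ^ k *
             (\<delta> powr (- 1 / 3) * real n powr (2 / 3) + (1 / \<delta>) * (real n / real m)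
              + real occ))))"
proof (intro exI[of _ "8::real"] conjI allI, goal_cases)
  case 1 show ?case by simp
next
  case (2 b c)
  show ?case
  proof (rule main_com_bounds[of b c], goal_cases)
    case (1 k0 C K)
    show ?case
      unfolding Let_def
      by (intro exI[of _ "main_com k0"] exI[of _ C] exI[of _ K] exI[of _ "15::nat"] allI impI) (rule 1)
  qed
qed

end
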